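(* Fix any positive integer $s \leq 2 \alpha c n \log n$. Starting from an empty $n$-node graph, one can process the first $T$ updates in a dynamic stream so as to maintain a random subset of edges $S^{(t)} \subseteq E^{(t)}$ at each time-step $t \in [T]$, using $\tilde O(n)$ space and $\tilde O(1)$ worst-case update time. For every edge $e \in E^{(t)}$ let $X_e^{(t)} \in \{0, 1\}$ be the indicator that $e \in S^{(t)}$. Then: 1. With high probability, $E[X_e^{(t)}] \in [(1- \epsilon) s/m^{(t)}, (1+\epsilon)s/m^{(t)}]$ for all edges $e \in E^{(t)}$, at each $t \leq T$ with $m^{(t)} \geq 4 \alpha c^2 n \log^2 n$. 2. At each time-step $t \leq T$, the random variables $\{ X_e^{(t)} \}_{e \in E^{(t)}}$ are negatively associated. 3. Insertion or deletion of an edge in $G$ leads to at most two insertions/deletions in the set $S$.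
   Context: Standing parameters: $\epsilon\in(0,1)$ is a sufficiently small constant; $\alpha=2+c^*\epsilon$ for a constant $c^*$ independent of $\epsilon$; $\lambda\ge1$ is a constant and $c$ is a constant with $c\gg\lambda$; $T=\lceil n^{\lambda}\rceil$. The graph $G=(V,E)$ has fixed node set $V$, $|V|=n$, starts with no edges, and each update inserts a new edge or deletes an existing one; $G^{(t)}=(V,E^{(t)})$ is the graph after $t$ updates and $m^{(t)}=|E^{(t)}|$. The update sequence is fixed independently of the algorithm's random bits. Random variables $X_1,\dots,X_t$ are negatively associated iff for all disjoint $I,J\subseteq\{1,\dots,t\}$ and all non-decreasing functions $f,g$, $E[f(X_i,i\in I)\,g(X_j,j\in J)]\le E[f(X_i,i\in I)]\,E[g(X_j,j\in J)]$. $\tilde O(\cdot)$ hides $\mathrm{poly}(\log n,1/\epsilon)$ factors; "with high probability" means with probability at least $1-1/\mathrm{poly}(n)$. *)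

theory Defs
  imports "HOL-Probability.Probability"
begin

section \<open>Dynamic graph streams\<close>

text \<open>The node set is \<open>{..<n}\<close>; an edge is a two-element set of nodes. The stream is a
  function of the update index; only its first \<open>T\<close> entries matter.\<close>

datatype update = Insert nat nat | Delete nat nat

primrec edges :: "(nat \<Rightarrow> update) \<Rightarrow> nat \<Rightarrow> nat set set" where
  "edges us 0 = {}"
| "edges us (Suc t) =
     (case us t of Insert u v \<Rightarrow> insert {u, v} (edges us t) | Delete u v \<Rightarrow> edges us t - {{u, v}})"

definition valid_stream :: "nat \<Rightarrow> (nat \<Rightarrow> update) \<Rightarrow> nat \<Rightarrow> bool" where
  "valid_stream n us T \<longleftrightarrow> (\<forall>t<T. case us t of
       Insert u v \<Rightarrow> u < n \<and> v < n \<and> u \<noteq> v \<and> {u, v} \<notin> edges us t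
     | Delete u v \<Rightarrow> {u, v} \<in> edges us t)"


section \<open>A randomised word RAM\<close>

text \<open>The machine has \<open>M\<close> memory cells of \<open>w\<close> bits each, unit-cost arithmetic modulo \<open>2 ^ w\<close>
  (subtraction truncates at 0, \<open>Less\<close> returns 0 or 1), indirect addressing, and no other
  storage. Random bits come from two one-way tapes: a bit that is to be used again has to be
  kept in memory.

  The two tapes separate the two stages of randomness in the claim. An expectation is a number,
  so "with high probability the expectation lies in an interval" refers to an expectation
  conditional on part of the random bits: the bits on the tape \<open>Setup\<close> are the ones conditioned
  upon, and expectation (and negative association) are with respect to the independent bits on
  the tape \<open>Sampling\<close>.\<close>

datatype tape = Setup | Sampling

datatype bop = Add | Sub | Mul | Div | Mod | Less

datatype expr = Const nat | Load expr | Bin bop expr expr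

datatype com =
    Skip
  | Store expr expr
  | Flip tape expr
  | Seq com com
  | Cond expr com com
  | While expr com

record config =
  mem :: "nat \<Rightarrow> nat"
  pos :: "tape \<Rightarrow> nat"

primrec apply_bop :: "bop \<Rightarrow> nat \<Rightarrow> nat \<Rightarrow> nat" where
  "apply_bop Add x y = x + y"
| "apply_bop Sub x y = x - y"
| "apply_bop Mul x y = x * y"
| "apply_bop Div x y = x div y"
| "apply_bop Mod x y = x mod y"
| "apply_bop Less x y = (if x < y then 1 else 0)"

primrec expr_val :: "nat \<Rightarrow> (nat \<Rightarrow> nat) \<Rightarrow> expr \<Rightarrow> nat" where
  "expr_val w m (Const k) = k mod 2 ^ w"
| "expr_val w m (Load a) = m (expr_val w m a)"
| "expr_val w m (Bin f a b) = apply_bop f (expr_val w m a) (expr_val w m b) mod 2 ^ w"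

primrec expr_cost :: "expr \<Rightarrow> nat" where
  "expr_cost (Const k) = 1"
| "expr_cost (Load a) = 1 + expr_cost a"
| "expr_cost (Bin f a b) = 1 + expr_cost a + expr_cost b"

text \<open>\<open>exec w M \<tau> p \<sigma> k \<sigma>'\<close>: on tapes \<open>\<tau>\<close>, the program \<open>p\<close> started in \<open>\<sigma>\<close> halts after \<open>k\<close> steps
  in \<open>\<sigma>'\<close>. A write to an address \<open>\<ge> M\<close> blocks the run. Reads need no such guard: cells outside
  \<open>{..<M}\<close> always contain their initial value 0.\<close>

inductive exec ::
  "nat \<Rightarrow> nat \<Rightarrow> (tape \<Rightarrow> nat \<Rightarrow> bool) \<Rightarrow> com \<Rightarrow> config \<Rightarrow> nat \<Rightarrow> config \<Rightarrow> bool"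
  for w M :: nat and \<tau> :: "tape \<Rightarrow> nat \<Rightarrow> bool" where
  exec_Skip: "exec w M \<tau> Skip \<sigma> 1 \<sigma>"
| exec_Store: "expr_val w (mem \<sigma>) a < M \<Longrightarrow>
    exec w M \<tau> (Store a b) \<sigma> (1 + expr_cost a + expr_cost b)
      (\<sigma>\<lparr>mem := (mem \<sigma>)(expr_val w (mem \<sigma>) a := expr_val w (mem \<sigma>) b)\<rparr>)"
| exec_Flip: "expr_val w (mem \<sigma>) a < M \<Longrightarrow>
    exec w M \<tau> (Flip r a) \<sigma> (1 + expr_cost a)
      (\<sigma>\<lparr>mem := (mem \<sigma>)(expr_val w (mem \<sigma>) a := of_bool (\<tau> r (pos \<sigma> r)) mod 2 ^ w),
         pos := (pos \<sigma>)(r := Suc (pos \<sigma> r))\<rparr>)"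
| exec_Seq: "exec w M \<tau> p \<sigma> k \<sigma>' \<Longrightarrow> exec w M \<tau> q \<sigma>' l \<sigma>'' \<Longrightarrow>
    exec w M \<tau> (Seq p q) \<sigma> (k + l) \<sigma>''"
| exec_CondT: "expr_val w (mem \<sigma>) b \<noteq> 0 \<Longrightarrow> exec w M \<tau> p \<sigma> k \<sigma>' \<Longrightarrow>
    exec w M \<tau> (Cond b p q) \<sigma> (1 + expr_cost b + k) \<sigma>'"
| exec_CondF: "expr_val w (mem \<sigma>) b = 0 \<Longrightarrow> exec w M \<tau> q \<sigma> k \<sigma>' \<Longrightarrow>
    exec w M \<tau> (Cond b p q) \<sigma> (1 + expr_cost b + k) \<sigma>'"
| exec_WhileF: "expr_val w (mem \<sigma>) b = 0 \<Longrightarrow>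
    exec w M \<tau> (While b p) \<sigma> (1 + expr_cost b) \<sigma>"
| exec_WhileT: "expr_val w (mem \<sigma>) b \<noteq> 0 \<Longrightarrow> exec w M \<tau> p \<sigma> k \<sigma>' \<Longrightarrow>
    exec w M \<tau> (While b p) \<sigma>' l \<sigma>'' \<Longrightarrow>
    exec w M \<tau> (While b p) \<sigma> (1 + expr_cost b + k + l) \<sigma>''"

inductive_cases exec_SkipE: "exec w M \<tau> Skip \<sigma> k \<sigma>'"
inductive_cases exec_StoreE: "exec w M \<tau> (Store a b) \<sigma> k \<sigma>'"
inductive_cases exec_FlipE: "exec w M \<tau> (Flip r a) \<sigma> k \<sigma>'"
inductive_cases exec_SeqE: "exec w M \<tau> (Seq p q) \<sigma> k \<sigma>'"
inductive_cases exec_CondE: "exec w M \<tau> (Cond b p q) \<sigma> k \<sigma>'"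
inductive_cases exec_WhileE: "exec w M \<tau> (While b p) \<sigma> k \<sigma>'"

lemma exec_deterministic:
  "exec w M \<tau> p \<sigma> k \<sigma>' \<Longrightarrow> exec w M \<tau> p \<sigma> l \<sigma>'' \<Longrightarrow> k = l \<and> \<sigma>' = \<sigma>''"
proof (induction arbitrary: l \<sigma>'' rule: exec.induct)
  case (exec_Skip \<sigma>)
  from exec_Skip.prems show ?case by (rule exec_SkipE) simp
next
  case (exec_Store \<sigma> a b)
  from exec_Store.prems show ?case by (rule exec_StoreE) simp
next
  case (exec_Flip \<sigma> a r)
  from exec_Flip.prems show ?case by (rule exec_FlipE) simp
next
  case (exec_Seq p \<sigma> k \<sigma>1 q k2 \<sigma>2)
  from exec_Seq.prems obtain l1 l2 \<tau>1
    where *: "l = l1 + l2" "exec w M \<tau> p \<sigma> l1 \<tau>1" "exec w M \<tau> q \<tau>1 l2 \<sigma>''"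
    by (rule exec_SeqE)
  have "k = l1 \<and> \<sigma>1 = \<tau>1" by (rule exec_Seq.IH(1)[OF *(2)])
  with exec_Seq.IH(2)[of l2 \<sigma>''] * show ?case by simp
next
  case (exec_CondT \<sigma> b p k \<sigma>' q)
  from exec_CondT.prems obtain l1 where *: "l = 1 + expr_cost b + l1" "exec w M \<tau> p \<sigma> l1 \<sigma>''"
    by (rule exec_CondE) (use exec_CondT.hyps in simp_all)
  show ?case using exec_CondT.IH[OF *(2)] *(1) by simp
next
  case (exec_CondF \<sigma> b q k \<sigma>' p)
  from exec_CondF.prems obtain l1 where *: "l = 1 + expr_cost b + l1" "exec w M \<tau> q \<sigma> l1 \<sigma>''"
    by (rule exec_CondE) (use exec_CondF.hyps in simp_all)
  show ?case using exec_CondF.IH[OF *(2)] *(1) by simp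
next
  case (exec_WhileF \<sigma> b p)
  from exec_WhileF.prems show ?case
    by (rule exec_WhileE) (use exec_WhileF.hyps in simp_all)
next
  case (exec_WhileT \<sigma> b p k \<sigma>1 k2 \<sigma>2)
  from exec_WhileT.prems obtain l1 l2 \<tau>1
    where *: "l = 1 + expr_cost b + l1 + l2" "exec w M \<tau> p \<sigma> l1 \<tau>1"
      "exec w M \<tau> (While b p) \<tau>1 l2 \<sigma>''"
    by (rule exec_WhileE) (use exec_WhileT.hyps in simp_all)
  have "k = l1 \<and> \<sigma>1 = \<tau>1" by (rule exec_WhileT.IH(1)[OF *(2)])
  with exec_WhileT.IH(2)[of l2 \<sigma>''] * show ?case by simp
qed

definition halts :: "nat \<Rightarrow> nat \<Rightarrow> (tape \<Rightarrow> nat \<Rightarrow> bool) \<Rightarrow> com \<Rightarrow> config \<Rightarrow> bool" where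
  "halts w M \<tau> p \<sigma> \<longleftrightarrow> (\<exists>k \<sigma>'. exec w M \<tau> p \<sigma> k \<sigma>')"

definition run_time :: "nat \<Rightarrow> nat \<Rightarrow> (tape \<Rightarrow> nat \<Rightarrow> bool) \<Rightarrow> com \<Rightarrow> config \<Rightarrow> nat" where
  "run_time w M \<tau> p \<sigma> = (THE k. \<exists>\<sigma>'. exec w M \<tau> p \<sigma> k \<sigma>')"

definition final :: "nat \<Rightarrow> nat \<Rightarrow> (tape \<Rightarrow> nat \<Rightarrow> bool) \<Rightarrow> com \<Rightarrow> config \<Rightarrow> config" where
  "final w M \<tau> p \<sigma> = (THE \<sigma>'. \<exists>k. exec w M \<tau> p \<sigma> k \<sigma>')"


section \<open>Streaming algorithms on the word RAM\<close>

text \<open>An algorithm consists of an initialisation program, run once on input \<open>(n, s)\<close>, and an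
  update program, run once per update. Cells 0 to 6 are the interface:
  cells 0 and 1 hold \<open>n\<close> and \<open>s\<close> at the start; before each run of the update program the update
  is written to cell 2 (1 = insert, 0 = delete) and cells 3, 4 (the endpoints); cells 5 and 6
  hold the base address and the number of slots of the array that stores the sample.\<close>

definition initial :: "nat \<Rightarrow> nat \<Rightarrow> config" where
  "initial n s = \<lparr>mem = (\<lambda>_. 0)(0 := n, 1 := s), pos = (\<lambda>_. 0)\<rparr>"

definition feed :: "update \<Rightarrow> config \<Rightarrow> config" where
  "feed x \<sigma> = \<sigma>\<lparr>mem := (case x of
       Insert u v \<Rightarrow> (mem \<sigma>)(2 := 1, 3 := u, 4 := v)
     | Delete u v \<Rightarrow> (mem \<sigma>)(2 := 0, 3 := u, 4 := v))\<rparr>"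

primrec config_after ::
  "nat \<Rightarrow> nat \<Rightarrow> (tape \<Rightarrow> nat \<Rightarrow> bool) \<Rightarrow> com \<Rightarrow> com \<Rightarrow> nat \<Rightarrow> nat \<Rightarrow> (nat \<Rightarrow> update) \<Rightarrow> nat \<Rightarrow> config"
where
  "config_after w M \<tau> init upd n s us 0 = final w M \<tau> init (initial n s)"
| "config_after w M \<tau> init upd n s us (Suc t) =
     final w M \<tau> upd (feed (us t) (config_after w M \<tau> init upd n s us t))"

text \<open>A slot occupies two consecutive cells; a slot with two equal entries is empty.\<close>

definition stored_edges :: "config \<Rightarrow> nat set set" where
  "stored_edges \<sigma> = (let m = mem \<sigma>; b = m 5 in
     {{m (b + 2 * i), m (b + 2 * i + 1)} | i. i < m 6 \<and> m (b + 2 * i) \<noteq> m (b + 2 * i + 1)})"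

definition sample ::
  "nat \<Rightarrow> nat \<Rightarrow> com \<Rightarrow> com \<Rightarrow> nat \<Rightarrow> nat \<Rightarrow> (nat \<Rightarrow> update)
    \<Rightarrow> (nat \<Rightarrow> bool) \<Rightarrow> (nat \<Rightarrow> bool) \<Rightarrow> nat \<Rightarrow> nat set set" where
  "sample w M init upd n s us \<rho> \<omega> t =
     stored_edges (config_after w M (case_tape \<rho> \<omega>) init upd n s us t)"

text \<open>The first \<open>T\<close> updates are processed with worst-case update time at most \<open>B\<close>, whatever the
  random bits are. The space bound is enforced by \<open>M\<close>.\<close>

definition processes ::
  "nat \<Rightarrow> nat \<Rightarrow> com \<Rightarrow> com \<Rightarrow> nat \<Rightarrow> nat \<Rightarrow> (nat \<Rightarrow> update) \<Rightarrow> nat \<Rightarrow> real \<Rightarrow> bool" where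
  "processes w M init upd n s us T B \<longleftrightarrow> (\<forall>\<tau>.
     halts w M \<tau> init (initial n s) \<and>
     (\<forall>t<T. let \<sigma> = feed (us t) (config_after w M \<tau> init upd n s us t) in
        halts w M \<tau> upd \<sigma> \<and> real (run_time w M \<tau> upd \<sigma>) \<le> B))"


section \<open>Probability\<close>

definition fair_bits :: "(nat \<Rightarrow> bool) measure" where
  "fair_bits = Pi\<^sub>M UNIV (\<lambda>_. measure_pmf (bernoulli_pmf (1 / 2)))"

text \<open>Functions of \<open>(X\<^sub>i)\<^sub>i\<^sub>\<in>\<^sub>I\<close> are functions of the whole family restricted to \<open>I\<close>; every
  non-decreasing function on \<open>I\<close>-indexed tuples extends to a monotone function of this kind.\<close>

definition neg_associated :: "'a measure \<Rightarrow> 'i set \<Rightarrow> ('i \<Rightarrow> 'a \<Rightarrow> real) \<Rightarrow> bool" where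
  "neg_associated P A X \<longleftrightarrow>
     (\<forall>i\<in>A. X i \<in> borel_measurable P) \<and>
     (\<forall>I J (f :: ('i \<Rightarrow> real) \<Rightarrow> real) (g :: ('i \<Rightarrow> real) \<Rightarrow> real).
        let F = (\<lambda>x. f (\<lambda>i\<in>I. X i x)); G = (\<lambda>x. g (\<lambda>j\<in>J. X j x)) in
        I \<subseteq> A \<and> J \<subseteq> A \<and> I \<inter> J = {} \<and> mono f \<and> mono g \<and>
        integrable P F \<and> integrable P G \<and> integrable P (\<lambda>x. F x * G x) \<longrightarrow>
        (\<integral>x. F x * G x \<partial>P) \<le> (\<integral>x. F x \<partial>P) * (\<integral>x. G x \<partial>P))"

end

theory Submission
  imports Defs
begin

text \<open>
  Identify an edge \<open>{x, y}\<close>, \<open>x < y\<close>, with the line \<open>g \<mapsto> g * y + x\<close>. The \<open>i\<close>-th hash value of an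
  edge is the sum of the entries of a table of random words at the points of its line with abscissae
  in the \<open>i\<close>-th block of \<open>q\<close> integers. As two lines meet at most once, each of at most \<open>q\<close> edges has an
  entry of its own in every block, so the hash functions are \<open>q\<close>-wise independent.

  The low digits of hash value \<open>0\<close> distribute the edges over \<open>nb\<close> buckets, where \<open>s \<le> nb < 2 s\<close>, and every
  bucket owns one random sampling word \<open>z\<close>. The bucket contributes an edge only if \<open>z mod nb < s\<close>; the next
  digits of \<open>z\<close> select one of \<open>2 ^ l\<close> cells of the bucket, the level \<open>l\<close> being fixed by the size of the bucket so that
  a cell has about \<open>L\<close> edges, and the remaining digits select the rank of an edge in that cell. If the cells are
  balanced, each of the \<open>m\<close> edges is chosen with probability close to \<open>s / nb * (1 / 2 ^ l) / (m / (nb * 2 ^ l)) = s / m\<close>,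
  and balance holds with high probability by a moment bound for \<open>q\<close>-wise independent indicators. The edges of a
  cell are recovered from linear sketches: \<open>R\<close> rows of \<open>W\<close> columns, each column with the number and the sum
  of the codes of its edges; with high probability some row separates the edges of the cell.

  An update touches a single bucket, and a bucket contributes at most one edge, hence at most two
  changes of the sample. For fixed setup bits the buckets are sampled independently and in each of them
  the indicators have sum at most one, hence they are negatively associated.
\<close>

section \<open>Program verification\<close>

text \<open>A dense graph has buckets too large to store, and the cells grow and shrink with the
  graph. Space is saved by drawing the sampling words once: at each level only the cell named by the
  digits of \<open>z\<close> can ever be asked for, so a bucket keeps one sketch per level instead
  of one per cell. Fixed words also make the memory a function of the two random arrays and the
  current edge set. Nothing depends on the history, a deletion is a subtraction, and each edge set
  can be analysed alone; since the stream is oblivious, a union bound over time handles the table.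
  Lines replace polynomials over a field because they need no prime, and a sum modulo
  \<open>2 ^ w\<close> has exactly uniform low digits; for this reason \<open>nb\<close>,
  \<open>W\<close> and the numbers of cells are powers of two. A failed recovery yields no edge,
  never a false one. Hence containment, negative association and the bound on changes hold for all
  setup bits, and only the inclusion probabilities need a good table.\<close>

definition wp :: "nat \<Rightarrow> nat \<Rightarrow> (tape \<Rightarrow> nat \<Rightarrow> bool) \<Rightarrow> com \<Rightarrow> (nat \<Rightarrow> nat) \<Rightarrow> (tape \<Rightarrow> nat)
    \<Rightarrow> (nat \<Rightarrow> (nat \<Rightarrow> nat) \<Rightarrow> (tape \<Rightarrow> nat) \<Rightarrow> bool) \<Rightarrow> bool" where
  "wp w M \<tau> c m p Q \<longleftrightarrow>
     (\<exists>k m' p'. exec w M \<tau> c \<lparr>mem = m, pos = p\<rparr> k \<lparr>mem = m', pos = p'\<rparr> \<and> Q k m' p')"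

lemma config_cases: "\<exists>m p. (\<sigma> :: config) = \<lparr>mem = m, pos = p\<rparr>"
  by (metis config.surjective old.unit.exhaust)

lemma wp_mono:
  assumes "wp w M \<tau> c m p Q" "\<And>k m' p'. Q k m' p' \<Longrightarrow> Q' k m' p'"
  shows "wp w M \<tau> c m p Q'"
  using assms unfolding wp_def by blast

text \<open>The rules for the loop-free commands are equivalences declared as simp rules, so that
  the simplifier executes straight-line code symbolically.\<close>

lemma wp_Skip [simp]: "wp w M \<tau> Skip m p Q \<longleftrightarrow> Q 1 m p"
proof
  show "Q 1 m p" if "wp w M \<tau> Skip m p Q"
    using that unfolding wp_def by (auto elim!: exec_SkipE)
  show "wp w M \<tau> Skip m p Q" if "Q 1 m p"
    using that exec_Skip unfolding wp_def by blast
qed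

lemma wp_Store [simp]:
  "wp w M \<tau> (Store a b) m p Q \<longleftrightarrow>
     expr_val w m a < M \<and> Q (1 + expr_cost a + expr_cost b) (m(expr_val w m a := expr_val w m b)) p"
proof
  assume "wp w M \<tau> (Store a b) m p Q"
  then show "expr_val w m a < M \<and> Q (1 + expr_cost a + expr_cost b) (m(expr_val w m a := expr_val w m b)) p"
    unfolding wp_def by (auto elim!: exec_StoreE)
next
  assume *: "expr_val w m a < M \<and> Q (1 + expr_cost a + expr_cost b) (m(expr_val w m a := expr_val w m b)) p"
  have "exec w M \<tau> (Store a b) \<lparr>mem = m, pos = p\<rparr> (1 + expr_cost a + expr_cost b)
     \<lparr>mem = m(expr_val w m a := expr_val w m b), pos = p\<rparr>"
    using exec_Store[of w "\<lparr>mem = m, pos = p\<rparr>" a M \<tau> b] * by simp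
  then show "wp w M \<tau> (Store a b) m p Q" unfolding wp_def using * by blast
qed

lemma wp_Flip [simp]:
  "wp w M \<tau> (Flip r a) m p Q \<longleftrightarrow>
     expr_val w m a < M \<and> Q (1 + expr_cost a) (m(expr_val w m a := of_bool (\<tau> r (p r)) mod 2 ^ w)) (p(r := Suc (p r)))"
proof
  assume "wp w M \<tau> (Flip r a) m p Q"
  then show "expr_val w m a < M \<and> Q (1 + expr_cost a) (m(expr_val w m a := of_bool (\<tau> r (p r)) mod 2 ^ w)) (p(r := Suc (p r)))"
    unfolding wp_def by (auto elim!: exec_FlipE)
next
  assume *: "expr_val w m a < M \<and> Q (1 + expr_cost a) (m(expr_val w m a := of_bool (\<tau> r (p r)) mod 2 ^ w)) (p(r := Suc (p r)))"
  have "exec w M \<tau> (Flip r a) \<lparr>mem = m, pos = p\<rparr> (1 + expr_cost a)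
     \<lparr>mem = m(expr_val w m a := of_bool (\<tau> r (p r)) mod 2 ^ w), pos = p(r := Suc (p r))\<rparr>"
    using exec_Flip[of w "\<lparr>mem = m, pos = p\<rparr>" a M \<tau> r] * by simp
  then show "wp w M \<tau> (Flip r a) m p Q" unfolding wp_def using * by blast
qed

lemma wp_Seq [simp]:
  "wp w M \<tau> (Seq c1 c2) m p Q \<longleftrightarrow>
     wp w M \<tau> c1 m p (\<lambda>k m' p'. wp w M \<tau> c2 m' p' (\<lambda>l. Q (k + l)))"
proof
  assume "wp w M \<tau> (Seq c1 c2) m p Q"
  then obtain k m' p' where *: "exec w M \<tau> (Seq c1 c2) \<lparr>mem = m, pos = p\<rparr> k \<lparr>mem = m', pos = p'\<rparr>" "Q k m' p'"
    unfolding wp_def by blast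
  from *(1) obtain k1 k2 \<sigma> where **: "k = k1 + k2" "exec w M \<tau> c1 \<lparr>mem = m, pos = p\<rparr> k1 \<sigma>"
    "exec w M \<tau> c2 \<sigma> k2 \<lparr>mem = m', pos = p'\<rparr>" by (rule exec_SeqE)
  obtain m1 p1 where "\<sigma> = \<lparr>mem = m1, pos = p1\<rparr>" using config_cases by blast
  then show "wp w M \<tau> c1 m p (\<lambda>k m' p'. wp w M \<tau> c2 m' p' (\<lambda>l. Q (k + l)))"
    unfolding wp_def using * ** by blast
next
  assume "wp w M \<tau> c1 m p (\<lambda>k m' p'. wp w M \<tau> c2 m' p' (\<lambda>l. Q (k + l)))"
  then show "wp w M \<tau> (Seq c1 c2) m p Q"
    unfolding wp_def by (meson exec_Seq)
qed

lemma wp_Cond [simp]: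
  "wp w M \<tau> (Cond b c1 c2) m p Q \<longleftrightarrow>
     (if expr_val w m b \<noteq> 0 then wp w M \<tau> c1 m p (\<lambda>k. Q (1 + expr_cost b + k))
      else wp w M \<tau> c2 m p (\<lambda>k. Q (1 + expr_cost b + k)))"
proof
  assume "wp w M \<tau> (Cond b c1 c2) m p Q"
  then show "if expr_val w m b \<noteq> 0 then wp w M \<tau> c1 m p (\<lambda>k. Q (1 + expr_cost b + k))
      else wp w M \<tau> c2 m p (\<lambda>k. Q (1 + expr_cost b + k))"
    unfolding wp_def by (auto elim!: exec_CondE)
next
  assume *: "if expr_val w m b \<noteq> 0 then wp w M \<tau> c1 m p (\<lambda>k. Q (1 + expr_cost b + k))
      else wp w M \<tau> c2 m p (\<lambda>k. Q (1 + expr_cost b + k))"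
  show "wp w M \<tau> (Cond b c1 c2) m p Q"
  proof (cases "expr_val w m b = 0")
    case True
    with * obtain k m' p' where "exec w M \<tau> c2 \<lparr>mem = m, pos = p\<rparr> k \<lparr>mem = m', pos = p'\<rparr>"
      "Q (1 + expr_cost b + k) m' p'" unfolding wp_def by auto
    with True show ?thesis unfolding wp_def by (metis exec_CondF config.select_convs(1))
  next
    case False
    with * obtain k m' p' where "exec w M \<tau> c1 \<lparr>mem = m, pos = p\<rparr> k \<lparr>mem = m', pos = p'\<rparr>"
      "Q (1 + expr_cost b + k) m' p'" unfolding wp_def by auto
    with False show ?thesis unfolding wp_def by (metis exec_CondT config.select_convs(1))
  qed
qed

lemma wp_While_done:
  "expr_val w m b = 0 \<Longrightarrow> Q (1 + expr_cost b) m p \<Longrightarrow> wp w M \<tau> (While b c) m p Q"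
  unfolding wp_def using exec_WhileF[of w "\<lparr>mem = m, pos = p\<rparr>" b M \<tau> c] by auto

lemma wp_While_step:
  assumes "expr_val w m b \<noteq> 0"
    and "wp w M \<tau> c m p (\<lambda>k m' p'. wp w M \<tau> (While b c) m' p' (\<lambda>l. Q (1 + expr_cost b + k + l)))"
  shows "wp w M \<tau> (While b c) m p Q"
  using assms exec_WhileT[of w "\<lparr>mem = m, pos = p\<rparr>" b M \<tau> c] unfolding wp_def
  by (simp, meson)

text \<open>All loops here run a number of rounds \<open>N\<close> known in advance. Indexing the
  invariant by the round makes the index serve as the variant, and the bound \<open>B\<close> on one
  round becomes a bound on the whole loop.\<close>

lemma wp_While:
  assumes "I 0 m p"
    and step: "\<And>i m p. i < N \<Longrightarrow> I i m p \<Longrightarrow>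
      expr_val w m b \<noteq> 0 \<and> wp w M \<tau> c m p (\<lambda>k m' p'. k \<le> B \<and> I (Suc i) m' p')"
    and last: "\<And>m p. I N m p \<Longrightarrow> expr_val w m b = 0"
    and post: "\<And>k m p. I N m p \<Longrightarrow> k \<le> N * (1 + expr_cost b + B) + 1 + expr_cost b \<Longrightarrow> Q k m p"
  shows "wp w M \<tau> (While b c) m p Q"
proof -
  have "I i m p \<Longrightarrow> i \<le> N \<Longrightarrow> wp w M \<tau> (While b c) m p
      (\<lambda>k m' p'. I N m' p' \<and> k \<le> (N - i) * (1 + expr_cost b + B) + 1 + expr_cost b)" for i m p
  proof (induction "N - i" arbitrary: i m p)
    case 0
    then have "i = N" by simp
    then show ?case using 0 last by (intro wp_While_done) auto
  next
    case (Suc x)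
    have "i < N" using Suc by simp
    have s: "expr_val w m b \<noteq> 0" "wp w M \<tau> c m p (\<lambda>k m' p'. k \<le> B \<and> I (Suc i) m' p')"
      using step[OF \<open>i < N\<close> Suc.prems(1)] by auto
    have x: "x = N - Suc i" and d: "N - i = Suc (N - Suc i)" using Suc \<open>i < N\<close> by auto
    show ?case
    proof (rule wp_While_step[OF s(1)], rule wp_mono[OF s(2)], elim conjE)
      fix k m' p'
      assume k: "k \<le> B" and I: "I (Suc i) m' p'"
      have "wp w M \<tau> (While b c) m' p'
        (\<lambda>k m' p'. I N m' p' \<and> k \<le> (N - Suc i) * (1 + expr_cost b + B) + 1 + expr_cost b)"
        using Suc.hyps(1)[OF x I] \<open>i < N\<close> by simp
      then show "wp w M \<tau> (While b c) m' p' (\<lambda>l m' p'. I N m' p' \<and>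
         1 + expr_cost b + k + l \<le> (N - i) * (1 + expr_cost b + B) + 1 + expr_cost b)"
        by (rule wp_mono) (use k in \<open>simp add: d\<close>)
    qed
  qed
  from this[OF assms(1)] have "wp w M \<tau> (While b c) m p
      (\<lambda>k m' p'. I N m' p' \<and> k \<le> (N - 0) * (1 + expr_cost b + B) + 1 + expr_cost b)" by simp
  then show ?thesis by (rule wp_mono) (auto intro: post)
qed

text \<open>Determinism of \<open>exec\<close> makes the descriptions in \<open>run_time\<close> and
  \<open>final\<close> denote the run exhibited by \<open>wp\<close>.\<close>

lemma halts_wp: "wp w M \<tau> c (mem \<sigma>) (pos \<sigma>) Q \<Longrightarrow>
   halts w M \<tau> c \<sigma> \<and> Q (run_time w M \<tau> c \<sigma>) (mem (final w M \<tau> c \<sigma>)) (pos (final w M \<tau> c \<sigma>))"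
proof -
  assume "wp w M \<tau> c (mem \<sigma>) (pos \<sigma>) Q"
  then obtain k m' p' where *: "exec w M \<tau> c \<sigma> k \<lparr>mem = m', pos = p'\<rparr>" "Q k m' p'"
    unfolding wp_def by (cases \<sigma>) auto
  have "run_time w M \<tau> c \<sigma> = k" unfolding run_time_def
    using * exec_deterministic by (intro the_equality) blast+
  moreover have "final w M \<tau> c \<sigma> = \<lparr>mem = m', pos = p'\<rparr>" unfolding final_def
    using * exec_deterministic by (intro the_equality) blast+
  ultimately show ?thesis using * unfolding halts_def by auto
qed

section \<open>The sampling program\<close>

text \<open>
  Use of the memory: the cells below \<open>64\<close> serve as registers. Cells \<open>0\<close> to \<open>5\<close> form the interface (\<open>n\<close>, \<open>s\<close>,
  kind and endpoints of the update, address of the output); the other cells below \<open>18\<close> hold the constants listed in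
  \<open>params\<close> below. The registers \<open>20\<close> to \<open>22\<close> hold the smaller endpoint, the larger endpoint and the code of the
  updated edge, \<open>23\<close> and \<open>25\<close> argument and value of the hash function, and \<open>26\<close> to \<open>29\<close> the bucket, the rest of
  hash value \<open>0\<close>, the sampling word, and its part beyond the lowest digit. The table of random words starts
  at \<open>64\<close> and is followed by the sampling words (\<open>zb\<close>), the output (\<open>ob\<close>) and the counters (\<open>cb\<close>).
\<close>

abbreviation "V i \<equiv> Load (Const i)"
abbreviation "asg i e \<equiv> Store (Const i) e"
abbreviation "add \<equiv> Bin Add"
abbreviation "sub \<equiv> Bin Sub"
abbreviation "mul \<equiv> Bin Mul"
abbreviation "quo \<equiv> Bin Div"
abbreviation "rem \<equiv> Bin Mod"
abbreviation "lt \<equiv> Bin Less"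

text \<open>The machine has no equality test. Subtraction truncates at 0, so at most one of the two
  differences is non-zero; their sum fits into a word and vanishes exactly for equal words.\<close>

definition "neq a b = add (sub a b) (sub b a)"

lemma neq_cost [simp]: "expr_cost (neq a b) = 3 + 2 * (expr_cost a + expr_cost b)"
  by (simp add: neq_def)

lemma neq_val [simp]:
  assumes "expr_val w m a < 2 ^ w" "expr_val w m b < 2 ^ w"
  shows "expr_val w m (neq a b) = 0 \<longleftrightarrow> expr_val w m a = expr_val w m b"
proof -
  define x y where "x = expr_val w m a" and "y = expr_val w m b"
  have "x < 2 ^ w" "y < 2 ^ w" using assms by (simp_all add: x_def y_def)
  then have "x - y < 2 ^ w" "y - x < 2 ^ w" "x - y + (y - x) < 2 ^ w" by auto
  then show ?thesis unfolding x_def[symmetric] y_def[symmetric] neq_def by (simp flip: x_def y_def) auto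
qed

lemma neq_pos [simp]:
  assumes "expr_val w m a < 2 ^ w" "expr_val w m b < 2 ^ w"
  shows "0 < expr_val w m (neq a b) \<longleftrightarrow> expr_val w m a \<noteq> expr_val w m b"
  using neq_val[OF assms] by auto

text \<open>The table is a matrix with rows of length \<open>P\<close>. For abscissa
  \<open>g\<close> the address is \<open>g * (P + y) + x = g * P + (g * y + x)\<close>, the point of
  the line in row \<open>g\<close>.\<close>

definition "hash_loop =
  While (lt (V 24) (V 39))
   (Seq (asg 25 (add (V 25) (Load (add (Const 64) (add (mul (V 24) (add (V 13) (V 21))) (V 20))))))
        (asg 24 (add (V 24) (Const 1))))"

definition "hash_prog =
  Seq (asg 24 (mul (V 23) (V 8)))
 (Seq (asg 39 (add (V 24) (V 8)))
 (Seq (asg 25 (Const 0))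
  hash_loop))"

definition "bump =
  Cond (V 2)
   (Seq (Store (V 30) (add (Load (V 30)) (Const 1)))
   (Seq (Store (V 33) (add (Load (V 33)) (Const 1)))
        (Store (add (V 33) (Const 1)) (add (Load (add (V 33) (Const 1))) (V 22)))))
   (Seq (Store (V 30) (sub (Load (V 30)) (Const 1)))
   (Seq (Store (V 33) (sub (Load (V 33)) (Const 1)))
        (Store (add (V 33) (Const 1)) (sub (Load (add (V 33) (Const 1))) (V 22)))))"

text \<open>One pass over all rows of all levels of a bucket. Register 32 holds the power of two of
  the current level, and it doubles whenever the row number in register 31 reaches a multiple of
  \<open>R\<close>. Tests have the form \<open>Cond (neq a b) Skip\<close>, so the second branch is
  taken on equality.\<close>

definition "sketch_body =
  Seq (Cond (neq (rem (V 27) (V 32)) (rem (V 29) (V 32))) Skip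
       (Seq (asg 23 (add (rem (V 31) (V 9)) (Const 1)))
       (Seq hash_prog
       (Seq (asg 33 (add (add (V 30) (Const 1)) (mul (Const 2) (rem (V 25) (V 11)))))
            bump))))
 (Seq (asg 30 (add (V 30) (V 12)))
 (Seq (asg 31 (add (V 31) (Const 1)))
      (Cond (rem (V 31) (V 9)) Skip (asg 32 (mul (V 32) (Const 2))))))"

definition "sketch_loop = While (lt (V 31) (V 14)) sketch_body"

definition "level_loop =
  While (sub (Const 1) (lt (V 33) (mul (Const 2) (mul (V 32) (V 10)))))
   (Seq (asg 32 (mul (V 32) (Const 2))) (asg 31 (add (V 31) (Const 1))))"

definition "scan_loop =
  While (lt (V 33) (V 11))
   (Seq (asg 41 (add (add (V 30) (Const 1)) (mul (Const 2) (V 33))))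
   (Seq (Cond (neq (Load (V 41)) (Const 1)) Skip
          (Seq (Cond (neq (V 38) (V 36)) Skip (asg 37 (Load (add (V 41) (Const 1)))))
               (asg 38 (add (V 38) (Const 1)))))
        (asg 33 (add (V 33) (Const 1)))))"

definition "rows_loop =
  While (lt (V 31) (V 9))
   (Seq (asg 35 (Load (V 30)))
   (Seq (asg 36 (rem (V 40) (V 35)))
   (Seq (asg 37 (Const 0))
   (Seq (asg 38 (Const 0))
   (Seq (asg 33 (Const 0))
   (Seq scan_loop
   (Seq (Cond (neq (V 38) (V 35)) Skip (asg 34 (V 37)))
   (Seq (asg 30 (add (V 30) (V 12)))
        (asg 31 (add (V 31) (Const 1)))))))))))"

definition "locate_post =
  Seq (asg 26 (rem (V 25) (V 6)))
 (Seq (asg 27 (quo (V 25) (V 6)))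
 (Seq (asg 28 (Load (add (V 16) (V 26))))
 (Seq (asg 29 (quo (V 28) (V 6)))
 (Seq (asg 30 (add (V 17) (mul (V 26) (mul (V 14) (V 12)))))
 (Seq (asg 31 (Const 0))
      (asg 32 (Const 1)))))))"

definition "locate_prog =
  Seq (Cond (lt (V 3) (V 4)) (Seq (asg 20 (V 3)) (asg 21 (V 4))) (Seq (asg 20 (V 4)) (asg 21 (V 3))))
 (Seq (asg 22 (add (mul (V 20) (V 0)) (V 21)))
 (Seq (asg 23 (Const 0))
 (Seq hash_prog locate_post)))"

text \<open>The code 0 stands for no edge: it is split into two equal entries, which is an empty
  slot, whereas a true edge has a positive code because its larger endpoint is positive.\<close>

definition "query_post =
  Seq (Cond (lt (rem (V 28) (V 6)) (V 1)) Skip (asg 34 (Const 0)))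
 (Seq (asg 33 (add (V 5) (mul (Const 2) (V 26))))
 (Seq (Store (V 33) (quo (V 34) (V 0)))
      (Store (add (V 33) (Const 1)) (rem (V 34) (V 0)))))"

definition "query_prog =
  Seq (asg 30 (add (V 17) (mul (V 26) (mul (V 14) (V 12)))))
 (Seq (asg 33 (Load (V 30)))
 (Seq (asg 31 (Const 0))
 (Seq (asg 32 (Const 1))
 (Seq level_loop
 (Seq (asg 40 (quo (V 29) (V 32)))
 (Seq (asg 30 (add (V 30) (mul (V 31) (mul (V 9) (V 12)))))
 (Seq (asg 34 (Const 0))
 (Seq (asg 31 (Const 0))
 (Seq rows_loop query_post)))))))))"

definition "update_prog = Seq locate_prog (Seq sketch_loop query_prog)"

text \<open>
  A row \<open>f\<close> stores the number of its edges at index \<open>0\<close>, and for column \<open>c\<close> the number of edges and the sum of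
  their codes at \<open>1 + 2 * c\<close> and \<open>2 + 2 * c\<close>. Scanning it counts the columns with exactly one edge and finds the
  code in the \<open>k\<close>-th of them; the row is usable if all of its edges lie in such columns.
\<close>

primrec scan :: "(nat \<Rightarrow> nat) \<Rightarrow> nat \<Rightarrow> nat \<Rightarrow> nat \<times> nat" where
  "scan f k 0 = (0, 0)"
| "scan f k (Suc c) = (case scan f k c of (e, r) \<Rightarrow>
     if f (1 + 2 * c) = 1 then (if r = k then f (2 + 2 * c) else e, Suc r) else (e, r))"

primrec rows :: "nat \<Rightarrow> (nat \<Rightarrow> nat \<Rightarrow> nat) \<Rightarrow> nat \<Rightarrow> nat \<Rightarrow> nat" where
  "rows W f v 0 = 0"
| "rows W f v (Suc i) =
     (if snd (scan (f i) (v mod f i 0) W) = f i 0 then fst (scan (f i) (v mod f i 0) W) else rows W f v i)"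

text \<open>For a bucket with \<open>c \<ge> L\<close> edges this makes \<open>c / 2 ^ p\<close> lie
  between \<open>L\<close> and \<open>2 * L\<close>, so the expected size of a cell is logarithmic
  whatever the size of the bucket.\<close>

definition level :: "nat \<Rightarrow> nat \<Rightarrow> nat" where
  "level L c = (LEAST p. c < 2 * (2 ^ p * L))"

lemma snd_scan_le: "snd (scan f k c) \<le> c"
  by (induction c) (auto split: prod.split)

text \<open>Collects the inequalities under which no machine operation overflows. A bucket has fewer
  than \<open>n ^ 2\<close> edges with codes below \<open>n ^ 2\<close>, whence
  \<open>n ^ 4\<close>; the product with \<open>4 * L\<close> covers the powers formed while the
  level is searched; \<open>n_Lam\<close> keeps every level that can occur below
  \<open>\<Lambda>\<close>.\<close>

locale layout =
  fixes w M n s q R L W \<Lambda> nb :: nat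
  fixes P G zb ob cb S top :: nat
  assumes P_def: "P = G * n" and G_def: "G = (R + 1) * q"
    and zb_def: "zb = 64 + G * P" and ob_def: "ob = zb + nb" and cb_def: "cb = ob + 2 * nb"
    and S_def: "S = 2 * W + 1" and top_def: "top = cb + nb * (\<Lambda> * R * S)"
    and top_M: "top \<le> M" and top_w: "top < 2 ^ w"
    and n_w: "n ^ 4 < 2 ^ w" and s_w: "s < 2 ^ w" and n_ge: "n \<ge> 2"
    and lev_w: "n ^ 2 * (4 * L) < 2 ^ w" and Lam_w: "2 ^ \<Lambda> < (2 ^ w :: nat)" and n_Lam: "n\<^sup>2 \<le> 2 ^ \<Lambda>"
    and pos: "q > 0" "R > 0" "W > 0" "\<Lambda> > 0" "nb > 0" "L > 0"
begin

definition params :: "(nat \<Rightarrow> nat) \<Rightarrow> bool" where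
  "params m \<longleftrightarrow> m 0 = n \<and> m 1 = s \<and> m 5 = ob \<and> m 6 = nb \<and> m 8 = q \<and> m 9 = R \<and> m 10 = L \<and>
     m 11 = W \<and> m 12 = S \<and> m 13 = P \<and> m 14 = \<Lambda> * R \<and> m 16 = zb \<and> m 17 = cb"

definition hash :: "(nat \<Rightarrow> nat) \<Rightarrow> nat \<Rightarrow> nat \<Rightarrow> nat \<Rightarrow> nat" where
  "hash tab i x y = (\<Sum>g\<in>{i * q..<i * q + q}. tab (g * (P + y) + x)) mod 2 ^ w"

lemma w_ge: "w \<ge> 7" and two_w: "64 < (2 ^ w :: nat)"
proof -
  have "64 < (2 ^ w :: nat)" using top_w top_def cb_def ob_def zb_def by linarith
  then show "64 < (2 ^ w :: nat)" .
  then have "(2::nat) ^ 6 < 2 ^ w" by simp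
  then have "6 < w" using power_less_imp_less_exp[of "2::nat" 6 w] by simp
  then show "w \<ge> 7" by simp
qed

lemma const_mod [simp]: "numeral k \<le> (64 :: nat) \<Longrightarrow> numeral k mod 2 ^ w = (numeral k :: nat)"
  "0 < w"
  using two_w w_ge by (auto intro!: mod_less simp del: numeral_le_iff)

lemma M_ge: "a < 64 \<Longrightarrow> a < M"
  using top_M top_def cb_def ob_def zb_def by linarith

lemma const_M [simp]: "numeral k < (64::nat) \<Longrightarrow> numeral k < M" "0 < M" "Suc 0 < M"
  using M_ge by auto

lemma index_less:
  assumes "g < G" "x < n" "y < n"
  shows "g * y + x < P" "g * (P + y) + x < G * P"
proof -
  have "g * y + x \<le> (G - 1) * (n - 1) + (n - 1)"
    using assms by (intro add_mono mult_mono) auto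
  also have "\<dots> = G * (n - 1)" using assms by (cases G) auto
  also have "\<dots> < G * n" using assms by auto
  finally show *: "g * y + x < P" by (simp add: P_def)
  have "g * (P + y) + x = g * P + (g * y + x)" by (simp add: algebra_simps)
  also have "\<dots> < Suc g * P" using * by simp
  also have "\<dots> \<le> G * P" using assms by (intro mult_right_mono) auto
  finally show "g * (P + y) + x < G * P" .
qed

text \<open>The machine reduces modulo \<open>2 ^ w\<close> after every addition,
  \<open>hash\<close> reduces once at the end; the invariant carries the reduced partial
  sum.\<close>

lemma wp_hash:
  assumes par: "params m" and i: "m 23 = i" "i \<le> R" and x: "m 20 = x" "x < n" and y: "m 21 = y" "y < n"
    and tab: "\<And>k. k < G * P \<Longrightarrow> m (64 + k) = tab k"
  shows "wp w M \<tau> hash_prog m p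
    (\<lambda>k m' p'. k \<le> 50 + 50 * q \<and> m' 25 = hash tab i x y \<and> (\<forall>a. a \<notin> {24, 25, 39} \<longrightarrow> m' a = m a) \<and> p' = p)"
proof -
  have iq: "i * q + q \<le> G" using i(2) unfolding G_def
    by (metis add.commute mult_Suc mult_le_mono1 Suc_eq_plus1 Suc_le_mono)
  have GP: "64 + G * P < 2 ^ w" using top_w top_def cb_def ob_def zb_def by linarith
  have "G > 0" using pos by (simp add: G_def)
  then have "G \<le> G * P" using n_ge by (simp add: P_def)
  then have Gw: "G < 2 ^ w" using GP by linarith
  \<comment> \<open>The address expression forms \<open>P + y\<close> before multiplying, and this
    intermediate sum has to fit into a word as well, even for \<open>g = 0\<close>.\<close>
  have P1: "P + n \<le> 64 + G * P"
  proof -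
    have "G \<ge> 2" using pos unfolding G_def by (metis One_nat_def Suc_leI add_Suc_right add_0_right mult_le_mono numeral_2_eq_2 Suc_le_mono mult.right_neutral)
    then have "G * P \<ge> 2 * P" by simp
    moreover have "P \<ge> n" using \<open>G > 0\<close> by (simp add: P_def)
    ultimately show ?thesis by linarith
  qed
  define I where "I j m' p' \<longleftrightarrow> m' 24 = i * q + j \<and> m' 39 = i * q + q \<and> 
     m' 25 = (\<Sum>g\<in>{i * q..<i * q + j}. tab (g * (P + y) + x)) mod 2 ^ w \<and> (\<forall>a. a \<notin> {24, 25, 39} \<longrightarrow> m' a = m a) \<and> p' = p" 
    for j and m' :: "nat \<Rightarrow> nat" and p'
  have loop: "wp w M \<tau> hash_loop m0 p (\<lambda>k m' p'. k \<le> q * 40 + 10 \<and> I q m' p')"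
    if m0: "I 0 m0 p" for m0
    unfolding hash_loop_def
  proof (rule wp_While[where I = I and N = q and B = 30, OF m0])
    fix j m' p' assume j: "j < q" and I: "I j m' p'"
    have g: "i * q + j < G" using j iq by linarith
    have a: "64 + ((i * q + j) * (P + y) + x) < 2 ^ w" using index_less(2)[OF g x(2) y(2)] GP by linarith
    then have b: "(i * q + j) * (P + y) + x < 2 ^ w" "(i * q + j) * (P + y) < 2 ^ w" by linarith+
    have c: "P + y < 2 ^ w" using P1 y GP by linarith
    have m': "m' 24 = i * q + j" "m' 39 = i * q + q" "m' 25 = (\<Sum>g\<in>{i * q..<i * q + j}. tab (g * (P + y) + x)) mod 2 ^ w"
      "m' 13 = P" "m' 21 = y" "m' 20 = x" "p' = p" "m' (64 + ((i * q + j) * (P + y) + x)) = tab ((i * q + j) * (P + y) + x)"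
      using I par x y tab[OF index_less(2)[OF g x(2) y(2)]] unfolding I_def params_def by auto
    have fr: "m' a = m a" if "a \<notin> {24, 25, 39}" for a using I that unfolding I_def by auto
    show "expr_val w m' (lt (V 24) (V 39)) \<noteq> 0 \<and>
       wp w M \<tau> (Seq (asg 25 (add (V 25) (Load (add (Const 64) (add (mul (V 24) (add (V 13) (V 21))) (V 20))))))
        (asg 24 (add (V 24) (Const 1)))) m' p' (\<lambda>k m' p'. k \<le> 30 \<and> I (Suc j) m' p')"
      using g Gw by (simp add: m' mod_less[OF a] mod_less[OF b(1)] mod_less[OF b(2)] mod_less[OF c] j I_def fr mod_add_left_eq)
  next
    show "expr_val w m' (lt (V 24) (V 39)) = 0" if "I q m' p'" for m' p'
      using that unfolding I_def by simp
  qed (simp_all add: I_def)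
  have "i * q < 2 ^ w" "i * q + q < 2 ^ w" using iq Gw by linarith+
  then show ?thesis
    unfolding hash_prog_def using par i
    by (auto simp: params_def I_def hash_def intro!: wp_mono[OF loop])
qed

text \<open>By minimality the predecessor of \<open>i\<close> violates the inequality that defines
  the level, so \<open>2 ^ i * L\<close> exceeds neither \<open>c\<close> nor, for
  \<open>i = 0\<close>, \<open>L\<close>. This bounds the products formed by the search for the
  level.\<close>

lemma level_bound:
  assumes "c < n\<^sup>2" "i \<le> level L c"
  shows "2 * (2 ^ i * L) \<le> n\<^sup>2 * (4 * L)" "2 ^ i * L \<le> c + L"
proof -
  show *: "2 ^ i * L \<le> c + L"
  proof (cases i)
    case (Suc i')
    then have "i' < level L c" using assms by simp
    then have "\<not> c < 2 * (2 ^ i' * L)" unfolding level_def by (rule not_less_Least)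
    then show ?thesis using Suc by simp
  qed simp
  have "c \<le> n\<^sup>2 * L" using assms pos by (metis One_nat_def Suc_leI less_or_eq_imp_le mult_le_mono mult.right_neutral)
  moreover have "L \<le> n\<^sup>2 * L" using n_ge by simp
  ultimately show "2 * (2 ^ i * L) \<le> n\<^sup>2 * (4 * L)" using * by linarith
qed

lemma level_less: "c < 2 * (2 ^ level L c * L)"
proof -
  have "c < 2 ^ c" by simp
  also have "(2::nat) ^ c \<le> 2 * (2 ^ c * L)" using pos by simp
  finally show ?thesis unfolding level_def by (rule LeastI)
qed

lemma wp_level:
  assumes par: "params m" and m: "m 31 = 0" "m 32 = 1" "m 33 = c" and c: "c < n\<^sup>2"
  shows "wp w M \<tau> level_loop m p (\<lambda>k m' p'. k \<le> level L c * 40 + 20 \<and> m' 31 = level L c \<and>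
      m' 32 = 2 ^ level L c \<and> (\<forall>a. a \<notin> {31, 32} \<longrightarrow> m' a = m a) \<and> p' = p)"
  unfolding level_loop_def
proof (rule wp_While[where N = "level L c" and B = 20 and
    I = "\<lambda>i m' p'. m' 31 = i \<and> m' 32 = 2 ^ i \<and> (\<forall>a. a \<notin> {31, 32} \<longrightarrow> m' a = m a) \<and> p' = p"])
  fix i m' p' assume i: "i < level L c"
    and I: "m' 31 = i \<and> m' 32 = 2 ^ i \<and> (\<forall>a. a \<notin> {31, 32} \<longrightarrow> m' a = m a) \<and> p' = p"
  have b: "2 * (2 ^ i * L) < 2 ^ w" using le_less_trans[OF level_bound(1)[OF c, of i] lev_w] i by simp
  have b2: "2 * 2 ^ i \<le> 2 * (2 ^ i * L)" and "2 ^ i * L < 2 ^ w" using pos b by auto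
  have "i < (2::nat) ^ i" by simp
  then have "Suc i < 2 ^ w" "2 ^ i * 2 < (2 ^ w :: nat)" using b b2 by linarith+
  moreover have "\<not> c < 2 * (2 ^ i * L)" using i unfolding level_def by (rule not_less_Least)
  ultimately show "expr_val w m' (sub (Const 1) (lt (V 33) (mul (Const 2) (mul (V 32) (V 10))))) \<noteq> 0 \<and>
     wp w M \<tau> (Seq (asg 32 (mul (V 32) (Const 2))) (asg 31 (add (V 31) (Const 1)))) m' p'
      (\<lambda>k m' p'. k \<le> 20 \<and> m' 31 = Suc i \<and> m' 32 = 2 ^ Suc i \<and> (\<forall>a. a \<notin> {31, 32} \<longrightarrow> m' a = m a) \<and> p' = p)"
    using I par m b \<open>2 ^ i * L < 2 ^ w\<close> by (simp add: params_def)
next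
  fix m' p' assume I: "m' 31 = level L c \<and> m' 32 = 2 ^ level L c \<and> (\<forall>a. a \<notin> {31, 32} \<longrightarrow> m' a = m a) \<and> p' = p"
  have b: "2 * (2 ^ level L c * L) < 2 ^ w" using le_less_trans[OF level_bound(1)[OF c, of "level L c"] lev_w] by simp
  then have b2: "2 ^ level L c * L < 2 ^ w" by simp
  show "expr_val w m' (sub (Const 1) (lt (V 33) (mul (Const 2) (mul (V 32) (V 10))))) = 0"
    using I par m level_less[of c] mod_less[OF b] mod_less[OF b2] by (simp add: params_def)
qed (use m in auto)

lemma wp_scan:
  assumes par: "params m" and wf: "\<And>a. 64 \<le> a \<Longrightarrow> m a < 2 ^ w" and v: "v < 2 ^ w"
    and m: "m 30 = ptr" "m 33 = 0" "m 36 = v" "m 37 = 0" "m 38 = 0"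
    and ptr: "ptr \<ge> 64" "ptr + S \<le> top"
  shows "wp w M \<tau> scan_loop m p (\<lambda>k m' p'. k \<le> W * 100 + 10 \<and>
      m' 37 = fst (scan (\<lambda>i. m (ptr + i)) v W) \<and> m' 38 = snd (scan (\<lambda>i. m (ptr + i)) v W) \<and>
      (\<forall>a. a \<notin> {33, 37, 38, 41} \<longrightarrow> m' a = m a) \<and> p' = p)"
  unfolding scan_loop_def
proof (rule wp_While[where N = W and B = 80 and
    I = "\<lambda>c m' p'. m' 33 = c \<and> m' 37 = fst (scan (\<lambda>i. m (ptr + i)) v c) \<and>
      m' 38 = snd (scan (\<lambda>i. m (ptr + i)) v c) \<and>
      (\<forall>a. a \<notin> {33, 37, 38, 41} \<longrightarrow> m' a = m a) \<and> p' = p"])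
  fix c m' p' assume c: "c < W"
    and I: "m' 33 = c \<and> m' 37 = fst (scan (\<lambda>i. m (ptr + i)) v c) \<and>
      m' 38 = snd (scan (\<lambda>i. m (ptr + i)) v c) \<and>
      (\<forall>a. a \<notin> {33, 37, 38, 41} \<longrightarrow> m' a = m a) \<and> p' = p"
  obtain e r where sc: "scan (\<lambda>i. m (ptr + i)) v c = (e, r)" by fastforce
  have sle: "r \<le> c" using snd_scan_le[of "\<lambda>i. m (ptr + i)" v c] by (simp add: sc)
  have b: "ptr + 2 + 2 * c < top" using ptr c by (simp add: S_def)
  then have b': "Suc (ptr + 2 * c) < 2 ^ w" "Suc (Suc (ptr + 2 * c)) < 2 ^ w" "2 * c < 2 ^ w" "Suc ptr < 2 ^ w" "Suc c < 2 ^ w"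
    "W < 2 ^ w" "r < 2 ^ w" "Suc r < 2 ^ w"
    using top_w c sle ptr S_def by linarith+
  have rd: "m' (Suc (ptr + 2 * c)) = m (Suc (ptr + 2 * c))" "m' (Suc (Suc (ptr + 2 * c))) = m (Suc (Suc (ptr + 2 * c)))"
    using I ptr by auto
  have wf': "m (Suc (ptr + 2 * c)) < 2 ^ w" "m (Suc (Suc (ptr + 2 * c))) < 2 ^ w" "v < 2 ^ w" using wf v ptr by auto
  have ne: "Suc (ptr + 2 * c) \<noteq> 41" "Suc (Suc (ptr + 2 * c)) \<noteq> 41" "Suc (Suc (ptr + 2 * c)) \<noteq> 38" using ptr by auto
  have mm: "m' 33 = c" "m' 37 = e" "m' 38 = r" "m' 11 = W" "m' 30 = ptr" "m' 36 = v" "p' = p"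
    using I par m by (auto simp: params_def sc)
  have fr: "m' a = m a" if "a \<notin> {33, 37, 38, 41}" for a using I that by blast
  show "expr_val w m' (lt (V 33) (V 11)) \<noteq> 0 \<and>
     wp w M \<tau> (Seq (asg 41 (add (add (V 30) (Const 1)) (mul (Const 2) (V 33))))
   (Seq (Cond (neq (Load (V 41)) (Const 1)) Skip
          (Seq (Cond (neq (V 38) (V 36)) Skip (asg 37 (Load (add (V 41) (Const 1)))))
               (asg 38 (add (V 38) (Const 1)))))
        (asg 33 (add (V 33) (Const 1))))) m' p'
      (\<lambda>k m' p'. k \<le> 80 \<and> m' 33 = Suc c \<and> m' 37 = fst (scan (\<lambda>i. m (ptr + i)) v (Suc c)) \<and>
      m' 38 = snd (scan (\<lambda>i. m (ptr + i)) v (Suc c)) \<and>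
      (\<forall>a. a \<notin> {33, 37, 38, 41} \<longrightarrow> m' a = m a) \<and> p' = p)"
    using c b' wf' ne by (simp add: mm rd sc fr)
qed (use m par in \<open>auto simp: params_def\<close>)

text \<open>The hypothesis that the cells from 64 on contain words enters through
  \<open>neq\<close>, which decides equality only for words.\<close>

lemma wp_rows:
  assumes par: "params m" and wf: "\<And>a. 64 \<le> a \<Longrightarrow> m a < 2 ^ w" and vw: "v < 2 ^ w"
    and m: "m 30 = ptr" "m 31 = 0" "m 34 = 0" "m 40 = v"
    and ptr: "ptr \<ge> 64" "ptr + R * S \<le> top"
  shows "wp w M \<tau> rows_loop m p (\<lambda>k m' p'. k \<le> R * (W * 100 + 110) + 10 \<and>
      m' 34 = rows W (\<lambda>i x. m (ptr + i * S + x)) v R \<and>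
      (\<forall>a. a \<notin> {30, 31, 33, 34, 35, 36, 37, 38, 41} \<longrightarrow> m' a = m a) \<and> p' = p)"
  unfolding rows_loop_def
proof (rule wp_While[where N = R and B = "W * 100 + 100" and
    I = "\<lambda>i m' p'. m' 31 = i \<and> m' 30 = ptr + i * S \<and> m' 34 = rows W (\<lambda>i x. m (ptr + i * S + x)) v i \<and> m' 34 < 2 ^ w \<and>
      (\<forall>a. a \<notin> {30, 31, 33, 34, 35, 36, 37, 38, 41} \<longrightarrow> m' a = m a) \<and> p' = p"])
  fix i m' p' assume i: "i < R"
    and I: "m' 31 = i \<and> m' 30 = ptr + i * S \<and> m' 34 = rows W (\<lambda>i x. m (ptr + i * S + x)) v i \<and> m' 34 < 2 ^ w \<and>
      (\<forall>a. a \<notin> {30, 31, 33, 34, 35, 36, 37, 38, 41} \<longrightarrow> m' a = m a) \<and> p' = p"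
  define vf where "vf = (\<lambda>i x. m (ptr + i * S + x))"
  have iS: "ptr + i * S + S \<le> top"
    using ptr(2) mult_le_mono1[of "Suc i" R S] i by simp
  have RS: "R \<le> R * S" by (simp add: S_def)
  have b: "ptr + i * S < 2 ^ w" "ptr + (i * S + S) < 2 ^ w" "Suc i < 2 ^ w" "R < 2 ^ w" "W < 2 ^ w"
    using iS top_w i RS ptr S_def by linarith+
  have fr: "m' a = m a" if "a \<notin> {30, 31, 33, 34, 35, 36, 37, 38, 41}" for a using I that by blast
  have r: "m' (ptr + i * S) = m (ptr + i * S)" by (rule fr) (use ptr in auto)
  have mm: "m' 31 = i" "m' 30 = ptr + i * S" "m' 34 = rows W vf v i" "m' 40 = v" "m' 9 = R" "m' 12 = S" "p' = p"
    using I par m by (auto simp: params_def vf_def)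
  have rw: "rows W vf v i < 2 ^ w" using I by (simp add: vf_def)
  define tot where "tot = m (ptr + i * S)"
  have totw: "tot < 2 ^ w" "v < 2 ^ w" using wf[of "ptr + i * S"] vw ptr by (simp_all add: tot_def)
  \<comment> \<open>An empty cell has \<open>tot = 0\<close>, where \<open>v mod 0 = v\<close>; the
    machine operation is the same function, so this case needs no branch.\<close>
  have vt: "v mod tot < 2 ^ w" using totw(2) by (meson le_less_trans mod_less_eq_dividend)
  define m1 where "m1 = m'(35 := tot, 36 := v mod tot, 37 := 0, 38 := 0, 33 := 0)"
  have s: "wp w M \<tau> scan_loop m1 p (\<lambda>k m' p'. k \<le> W * 100 + 10 \<and>
      m' 37 = fst (scan (\<lambda>x. m1 ((ptr + i * S) + x)) (v mod tot) W) \<and> m' 38 = snd (scan (\<lambda>x. m1 ((ptr + i * S) + x)) (v mod tot) W) \<and>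
      (\<forall>a. a \<notin> {33, 37, 38, 41} \<longrightarrow> m' a = m1 a) \<and> p' = p)"
  proof (rule wp_scan)
    show "params m1" using par fr unfolding params_def m1_def by simp
    show "m1 a < 2 ^ w" if "64 \<le> a" for a
      using wf[of a] fr[of a] that by (auto simp: m1_def)
    show "v mod tot < 2 ^ w" by (rule vt)
  qed (use ptr iS in \<open>auto simp: m1_def mm\<close>)
  have m1a: "m1 (ptr + i * S + x) = m (ptr + i * S + x)" for x
    using fr[of "ptr + i * S + x"] ptr by (auto simp: m1_def)
  have s': "wp w M \<tau> scan_loop m1 p (\<lambda>k m' p'. k \<le> W * 100 + 10 \<and>
      m' 37 = fst (scan (\<lambda>x. m (ptr + i * S + x)) (v mod tot) W) \<and> m' 38 = snd (scan (\<lambda>x. m (ptr + i * S + x)) (v mod tot) W) \<and>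
      (\<forall>a. a \<notin> {33, 37, 38, 41} \<longrightarrow> m' a = m1 a) \<and> p' = p)"
    using s unfolding m1a .
  have tv: "tot = vf i 0" by (simp add: vf_def tot_def)
  show "expr_val w m' (lt (V 31) (V 9)) \<noteq> 0 \<and>
     wp w M \<tau> (Seq (asg 35 (Load (V 30)))
   (Seq (asg 36 (rem (V 40) (V 35)))
   (Seq (asg 37 (Const 0))
   (Seq (asg 38 (Const 0))
   (Seq (asg 33 (Const 0))
   (Seq scan_loop
   (Seq (Cond (neq (V 38) (V 35)) Skip (asg 34 (V 37)))
   (Seq (asg 30 (add (V 30) (V 12)))
        (asg 31 (add (V 31) (Const 1))))))))))) m' p'
      (\<lambda>k m' p'. k \<le> W * 100 + 100 \<and> m' 31 = Suc i \<and> m' 30 = ptr + Suc i * S \<and>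
       m' 34 = rows W (\<lambda>i x. m (ptr + i * S + x)) v (Suc i) \<and> m' 34 < 2 ^ w \<and>
      (\<forall>a. a \<notin> {30, 31, 33, 34, 35, 36, 37, 38, 41} \<longrightarrow> m' a = m a) \<and> p' = p)"
  proof -
    have sw: "snd (scan (vf i) (v mod tot) W) < 2 ^ w"
      using snd_scan_le[of "vf i" "v mod tot" W] b by linarith
    have fw: "fst (scan (vf i) u c) < 2 ^ w" for u c
      by (induction c) (use wf ptr in \<open>auto simp: vf_def split: prod.split\<close>)
    have tt: "m' (ptr + i * S) = tot" using r by (simp add: tot_def)
    have s2: "wp w M \<tau> scan_loop m1 p (\<lambda>k m' p'. k \<le> W * 100 + 10 \<and>
      m' 37 = fst (scan (vf i) (v mod tot) W) \<and> m' 38 = snd (scan (vf i) (v mod tot) W) \<and>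
      (\<forall>a. a \<notin> {33, 37, 38, 41} \<longrightarrow> m' a = m1 a) \<and> p' = p)"
      using s' unfolding vf_def .
    define rs where "rs = rows W vf v (Suc i)"
    have rs: "rs = (if snd (scan (vf i) (v mod tot) W) = tot then fst (scan (vf i) (v mod tot) W) else rows W vf v i)"
      by (simp add: rs_def tv)
    have rsw: "rs < 2 ^ w" using fw rw by (simp add: rs)
    show ?thesis
      unfolding vf_def[symmetric] rs_def[symmetric]
      using i b totw vt
      apply (simp add: mm tt)
      apply (rule wp_mono[OF s2[unfolded m1_def]])
      using sw rsw by (auto simp: mm fr rs add.assoc)
  qed
qed (use m par in \<open>auto simp: params_def algebra_simps\<close>)

text \<open>The effect of one update on a counter, with \<open>b\<close> the content of cell 2.
  Truncated subtraction is exact in use, since an edge is deleted only if its weight is part of the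
  counter.\<close>

definition bop :: "nat \<Rightarrow> nat \<Rightarrow> nat \<Rightarrow> nat" where
  "bop b v d = (if b = 0 then v - d else v + d)"

lemma bop_0 [simp]: "bop b v 0 = v"
  by (simp add: bop_def)

lemma wp_bump:
  assumes m: "m 30 = ptr" "m 33 = c" "m 22 = x" "m 2 = b"
    and b: "64 \<le> ptr" "ptr < c" "c + 1 < top"
    and wf: "\<And>a. 64 \<le> a \<Longrightarrow> m a < 2 ^ w"
    and ov: "\<And>a. a \<in> {ptr, c, c + 1} \<Longrightarrow> b \<noteq> 0 \<Longrightarrow> m a + x < 2 ^ w" and x: "x > 0"
    and Q: "\<And>k. k \<le> 50 \<Longrightarrow> Q k (m(ptr := bop b (m ptr) 1, c := bop b (m c) 1, c + 1 := bop b (m (c + 1)) x)) p"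
  shows "wp w M \<tau> bump m p Q"
proof -
  have a: "Suc c < 2 ^ w" "c < M" "Suc c < M" "ptr < M" using b top_M top_w by linarith+
  have r: "ptr \<noteq> k" "c \<noteq> k" "Suc c \<noteq> k" if "k < 64" for k using b that by auto
  have mc: "m ptr < 2 ^ w" "m c < 2 ^ w" "m (Suc c) < 2 ^ w" using wf b by auto
  have ov': "Suc (m ptr) < 2 ^ w" "Suc (m c) < 2 ^ w" "m (Suc c) + x < 2 ^ w" if "b \<noteq> 0"
    using ov[of ptr] ov[of c] ov[of "Suc c"] that x by auto
  show ?thesis
  proof (cases "b = 0")
    case True
    have "m ptr - Suc 0 < 2 ^ w" "m c - Suc 0 < 2 ^ w" "m (Suc c) - x < 2 ^ w" using mc by linarith+
    then show ?thesis
      using Q True b a m by (simp add: bump_def r bop_def)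
  next
    case False
    then show ?thesis
      using Q ov' b a m by (simp add: bump_def r bop_def)
  qed
qed

definition weight :: "(nat \<Rightarrow> nat) \<Rightarrow> nat \<Rightarrow> nat \<Rightarrow> nat \<Rightarrow> nat \<Rightarrow> nat \<Rightarrow> nat \<Rightarrow> nat" where
  "weight tab h z x y j i =
    (if h mod 2 ^ (j div R) = z mod 2 ^ (j div R) then
       (if i = 0 \<or> i = 1 + 2 * (hash tab (j mod R + 1) x y mod W) then 1
        else if i = 2 + 2 * (hash tab (j mod R + 1) x y mod W) then x * n + y else 0)
     else 0)"

lemma wp_sketch:
  assumes par: "params m" and wf: "\<And>a. 64 \<le> a \<Longrightarrow> m a < 2 ^ w"
    and m: "m 2 = b" "m 20 = x" "m 21 = y" "m 22 = x * n + y" "m 27 = h" "m 29 = z" "m 30 = ptr" "m 31 = 0" "m 32 = 1"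
    and xy: "x < y" "y < n"
    and tab: "\<And>k. k < G * P \<Longrightarrow> m (64 + k) = tab k"
    and ptr: "cb \<le> ptr" "ptr + \<Lambda> * R * S \<le> top"
    and ov: "\<And>a. ptr \<le> a \<Longrightarrow> a < ptr + \<Lambda> * R * S \<Longrightarrow> b \<noteq> 0 \<Longrightarrow> m a + (x * n + y) < 2 ^ w"
    and hz: "h < 2 ^ w" "z < 2 ^ w"
  shows "wp w M \<tau> sketch_loop m p (\<lambda>k m' p'. k \<le> \<Lambda> * R * (200 + 50 * q) + 10 \<and>
      (\<forall>a\<ge>64. m' a = (if ptr \<le> a \<and> a < ptr + \<Lambda> * R * S
         then bop b (m a) (weight tab h z x y ((a - ptr) div S) ((a - ptr) mod S)) else m a)) \<and>
      (\<forall>a<64. a \<notin> {23, 24, 25, 30, 31, 32, 33, 39} \<longrightarrow> m' a = m a) \<and> p' = p)"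
proof -
  define F where "F a = bop b (m a) (weight tab h z x y ((a - ptr) div S) ((a - ptr) mod S))" for a
  define I where "I j m' p' \<longleftrightarrow> m' 30 = ptr + j * S \<and> m' 31 = j \<and> m' 32 = 2 ^ (j div R) \<and>
     (\<forall>a\<ge>64. m' a = (if ptr \<le> a \<and> a < ptr + j * S then F a else m a)) \<and>
     (\<forall>a<64. a \<notin> {23, 24, 25, 30, 31, 32, 33, 39} \<longrightarrow> m' a = m a) \<and> p' = p"
    for j and m' :: "nat \<Rightarrow> nat" and p'
  have cb64: "64 + G * P \<le> cb" by (simp add: cb_def ob_def zb_def)
  have Fw: "F a < 2 ^ w" if "ptr \<le> a" "a < ptr + \<Lambda> * R * S" for a
  proof -
    have "m a < 2 ^ w" using wf that ptr cb64 by auto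
    \<comment> \<open>The weight 1 is also covered by the code, which is positive because of
      \<open>x < y\<close>; the single overflow hypothesis on codes therefore serves all
      counters.\<close>
    moreover have "weight tab h z x y u v \<le> x * n + y" for u v using xy by (auto simp: weight_def)
    then have "b \<noteq> 0 \<Longrightarrow> m a + weight tab h z x y u v < 2 ^ w" for u v
      using ov[OF that] by (meson add_left_mono le_less_trans)
    ultimately show ?thesis unfolding F_def bop_def by auto
  qed
  have LRS: "\<Lambda> * R \<le> \<Lambda> * R * S" by (simp add: S_def)
  show ?thesis
    unfolding sketch_loop_def
  proof (rule wp_While[where I = I and N = "\<Lambda> * R" and B = "190 + 50 * q"])
    show "I 0 m p" using m by (simp add: I_def)
  next
    fix j m' p' assume j: "j < \<Lambda> * R" and I: "I j m' p'"
    define pt where "pt = ptr + j * S"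
    have fr: "m' a = m a" if "a < 64" "a \<notin> {23, 24, 25, 30, 31, 32, 33, 39}" for a using I that unfolding I_def by blast
    have fr64: "m' a = (if ptr \<le> a \<and> a < pt then F a else m a)" if "64 \<le> a" for a using I that unfolding I_def pt_def by blast
    have ptS: "pt + S \<le> ptr + \<Lambda> * R * S" using mult_le_mono1[of "Suc j" "\<Lambda> * R" S] j by (simp add: pt_def)
    have pt64: "64 \<le> pt" using cb64 ptr by (simp add: pt_def)
    have mm: "m' 30 = pt" "m' 31 = j" "m' 32 = 2 ^ (j div R)" "m' 2 = b" "m' 20 = x" "m' 21 = y" "m' 22 = x * n + y" "m' 27 = h"
       "m' 29 = z" "m' 9 = R" "m' 12 = S" "m' 11 = W" "m' 14 = \<Lambda> * R" "p' = p"
      using I m par fr unfolding I_def pt_def params_def by auto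
    have jR: "j div R < \<Lambda>" using j pos by (simp add: less_mult_imp_div_less)
    have pw: "2 ^ (j div R) * 2 \<le> (2 ^ \<Lambda> :: nat)" using power_increasing[of "Suc (j div R)" \<Lambda> "2::nat"] jR by simp
    then have pww: "2 ^ (j div R) * 2 < (2 ^ w :: nat)" using Lam_w by linarith
    have b1: "\<Lambda> * R < 2 ^ w" "Suc j < 2 ^ w" "pt + S < 2 ^ w" "j mod R < 2 ^ w" "Suc (j mod R) < 2 ^ w"
      using LRS top_w ptr ptS j mod_less_eq_dividend[of j R] by linarith+
    have hzm: "h mod 2 ^ (j div R) < 2 ^ w" "z mod 2 ^ (j div R) < 2 ^ w"
      using hz by (auto intro: le_less_trans[OF mod_less_eq_dividend])
    define J where "J m2 \<longleftrightarrow> (\<forall>a<64. a \<notin> {23, 24, 25, 33, 39} \<longrightarrow> m2 a = m' a) \<and>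
       (\<forall>a\<ge>64. m2 a = (if ptr \<le> a \<and> a < pt + S then F a else m a))" for m2 :: "nat \<Rightarrow> nat"
    have Fpt: "F a = bop b (m a) (weight tab h z x y j (a - pt))" if "pt \<le> a" "a < pt + S" for a
    proof -
      have "a - ptr = (a - pt) + j * S" using that by (simp add: pt_def)
      moreover have "a - pt < S" using that by auto
      ultimately show ?thesis by (simp add: F_def)
    qed
    have ptp: "ptr \<le> pt" by (simp add: pt_def)
    have first: "wp w M \<tau> (Cond (neq (rem (V 27) (V 32)) (rem (V 29) (V 32))) Skip
       (Seq (asg 23 (add (rem (V 31) (V 9)) (Const 1)))
       (Seq hash_prog
       (Seq (asg 33 (add (add (V 30) (Const 1)) (mul (Const 2) (rem (V 25) (V 11)))))
            bump)))) m' p (\<lambda>k m2 p2. k \<le> 150 + 50 * q \<and> J m2 \<and> p2 = p)"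
    proof (cases "h mod 2 ^ (j div R) = z mod 2 ^ (j div R)")
      case False
      have "weight tab h z x y j i = 0" for i using False by (simp add: weight_def)
      then have "J m'" unfolding J_def using fr64 Fpt ptp by auto
      then show ?thesis using False hzm by (simp add: mm)
    next
      case True
      define i where "i = Suc (j mod R)"
      have iR: "i \<le> R" using pos by (simp add: i_def Suc_le_eq)
      define m1 where "m1 = m'(23 := i)"
      have cbt: "64 + k \<noteq> 23" "64 \<le> 64 + k" for k :: nat by auto
      have hp: "wp w M \<tau> hash_prog m1 p (\<lambda>k m' p'. k \<le> 50 + 50 * q \<and> m' 25 = hash tab i x y \<and>
          (\<forall>a. a \<notin> {24, 25, 39} \<longrightarrow> m' a = m1 a) \<and> p' = p)"
      proof (rule wp_hash)
        show "params m1" using par fr unfolding params_def m1_def by simp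
        show "m1 (64 + k) = tab k" if "k < G * P" for k
          using tab[OF that] fr64[of "64 + k"] ptr cb64 that by (simp add: m1_def)
      qed (use iR xy in \<open>auto simp: m1_def mm\<close>)
      define c where "c = pt + 1 + 2 * (hash tab i x y mod W)"
      have cS: "c + 1 < pt + S" using pos mod_less_divisor[of W "hash tab i x y"] unfolding c_def S_def by linarith
      have ct: "c + 1 < top" "c + 1 < 2 ^ w" using cS ptS ptr top_w by linarith+
      have cw: "hash tab i x y mod W < 2 ^ w" "2 * (hash tab i x y mod W) < 2 ^ w" "Suc pt < 2 ^ w" "Suc (pt + 2 * (hash tab i x y mod W)) < 2 ^ w"
        using ct unfolding c_def by linarith+
      have post: "J ((m2(33 := c))(pt := bop b ((m2(33 := c)) pt) 1, c := bop b ((m2(33 := c)) c) 1, c + 1 := bop b ((m2(33 := c)) (c + 1)) (x * n + y)))"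
        if m2: "\<forall>a. a \<notin> {24, 25, 39} \<longrightarrow> m2 a = m1 a" for m2
      proof -
        have m2a: "m2 a = (if ptr \<le> a \<and> a < pt then F a else m a)" if "64 \<le> a" for a
          using m2 that fr64[OF that] by (simp add: m1_def)
        have w: "weight tab h z x y j (a - pt) = (if a = pt \<or> a = c then 1 else if a = c + 1 then x * n + y else 0)"
          if "pt \<le> a" for a
          using that True by (auto simp: weight_def i_def[symmetric] c_def)
        have c64: "64 \<le> c" "pt < c" using pt64 by (auto simp: c_def)
        show ?thesis
          unfolding J_def
        proof (intro conjI allI impI)
          fix a :: nat assume a: "a < 64" "a \<notin> {23, 24, 25, 33, 39}"
          then show "((m2(33 := c))(pt := bop b ((m2(33 := c)) pt) 1, c := bop b ((m2(33 := c)) c) 1, c + 1 := bop b ((m2(33 := c)) (c + 1)) (x * n + y))) a = m' a"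
            using c64 pt64 m2 by (auto simp: m1_def)
        next
          fix a :: nat assume a: "64 \<le> a"
          show "((m2(33 := c))(pt := bop b ((m2(33 := c)) pt) 1, c := bop b ((m2(33 := c)) c) 1, c + 1 := bop b ((m2(33 := c)) (c + 1)) (x * n + y))) a
            = (if ptr \<le> a \<and> a < pt + S then F a else m a)"
          proof (cases "pt \<le> a \<and> a < pt + S")
            case True
            then show ?thesis using Fpt[of a] w[of a] m2a[OF a] a c64 pt64 ptp by (auto simp: m2a)
          next
            case False
            then have "a \<noteq> pt" "a \<noteq> c" "a \<noteq> c + 1" using cS c64 by auto
            then show ?thesis using False m2a[OF a] a ptp by auto
          qed
        qed
      qed
      have "wp w M \<tau> hash_prog m1 p (\<lambda>k m2 p2. k \<le> 50 + 50 * q \<and> wp w M \<tau> bump (m2(33 := c)) p2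
          (\<lambda>l m3 p3. l \<le> 50 \<and> J m3 \<and> p3 = p) \<and> m2 30 = pt \<and> m2 11 = W \<and> m2 25 = hash tab i x y)"
      proof (rule wp_mono[OF hp], elim conjE, intro conjI)
        fix k m2 p2
        assume *: "k \<le> 50 + 50 * q" "m2 25 = hash tab i x y" "\<forall>a. a \<notin> {24, 25, 39} \<longrightarrow> m2 a = m1 a" "p2 = p"
        have m2a: "m2 a = (if ptr \<le> a \<and> a < pt then F a else m a)" if "64 \<le> a" for a
          using * that fr64[OF that] by (simp add: m1_def)
        show "wp w M \<tau> bump (m2(33 := c)) p2 (\<lambda>l m3 p3. l \<le> 50 \<and> J m3 \<and> p3 = p)"
        proof (rule wp_bump[where ptr = pt and c = c and x = "x * n + y" and b = b])
          show "(m2(33 := c)) a < 2 ^ w" if "64 \<le> a" for a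
            using that Fw[of a] wf[of a] m2a[OF that] ptS by auto
          show "(m2(33 := c)) a + (x * n + y) < 2 ^ w" if "a \<in> {pt, c, c + 1}" "b \<noteq> 0" for a
          proof -
            have "pt \<le> a" "a < pt + S" using that(1) cS by (auto simp: c_def)
            then show ?thesis using m2a[of a] ov[of a] ptS ptp pt64 that(2) by auto
          qed
        qed (use * xy post[OF *(3)] ct pt64 in \<open>auto simp: m1_def mm c_def\<close>)
      qed (auto simp: m1_def mm)
      note hp2 = this
      have iw: "i < 2 ^ w" using b1 by (simp add: i_def)
      show ?thesis
        using True b1 hzm
        apply (simp add: mm)
        apply (rule wp_mono[OF hp2[unfolded m1_def i_def]])
        using cw[unfolded i_def] by (auto simp: c_def i_def elim!: wp_mono)
    qed
    show "expr_val w m' (lt (V 31) (V 14)) \<noteq> 0 \<and>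
       wp w M \<tau> sketch_body m' p' (\<lambda>k m' p'. k \<le> 190 + 50 * q \<and> I (Suc j) m' p')"
    proof
      show "expr_val w m' (lt (V 31) (V 14)) \<noteq> 0" using j by (simp add: mm)
      show "wp w M \<tau> sketch_body m' p' (\<lambda>k m' p'. k \<le> 190 + 50 * q \<and> I (Suc j) m' p')"
        unfolding sketch_body_def wp_Seq[of w M \<tau> "Cond _ _ _"] \<open>p' = p\<close>
      proof (rule wp_mono[OF first], elim conjE)
        fix k m2 p2 assume k: "k \<le> 150 + 50 * q" and J: "J m2" and p2: "p2 = p"
        have m2: "m2 30 = pt" "m2 31 = j" "m2 32 = 2 ^ (j div R)" "m2 9 = R" "m2 12 = S"
          using J unfolding J_def by (auto simp: mm)
        \<comment> \<open>The level changes exactly when the next row number is a multiple of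
          \<open>R\<close>, which is the test of the last \<open>Cond\<close> of the loop
          body.\<close>
        have d: "Suc j div R = (if Suc j mod R = 0 then Suc (j div R) else j div R)" by (simp add: div_Suc)
        have smw: "Suc j mod R < 2 ^ w" using b1(2) by (auto intro: le_less_trans[OF mod_less_eq_dividend])
        have ptSj: "pt + S = ptr + Suc j * S" by (simp add: pt_def)
        have fr2: "m2 a = m a" if "a < 64" "a \<notin> {23, 24, 25, 30, 31, 32, 33, 39}" for a
          using J fr[OF that] that unfolding J_def by auto
        have fr3: "m2 a = (if ptr \<le> a \<and> a < ptr + Suc j * S then F a else m a)" if "64 \<le> a" for a
          using J that unfolding J_def ptSj by auto
        show "wp w M \<tau> (Seq (asg 30 (add (V 30) (V 12)))
           (Seq (asg 31 (add (V 31) (Const 1)))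
          (Cond (rem (V 31) (V 9)) Skip (asg 32 (mul (V 32) (Const 2)))))) m2 p2
          (\<lambda>l m' p'. k + l \<le> 190 + 50 * q \<and> I (Suc j) m' p')"
          using k b1 pww smw
          by (simp add: m2 I_def d p2 fr2 fr3 ptSj[symmetric]) (simp add: pt_def)
      qed
    qed
  next
    show "expr_val w m' (lt (V 31) (V 14)) = 0" if "I (\<Lambda> * R) m' p'" for m' p'
      using that par unfolding I_def params_def by simp
  next
    fix k m' p' assume "I (\<Lambda> * R) m' p'" "k \<le> \<Lambda> * R * (1 + expr_cost (lt (V 31) (V 14)) + (190 + 50 * q)) + 1 + expr_cost (lt (V 31) (V 14))"
    then show "k \<le> \<Lambda> * R * (200 + 50 * q) + 10 \<and>
      (\<forall>a\<ge>64. m' a = (if ptr \<le> a \<and> a < ptr + \<Lambda> * R * S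
         then bop b (m a) (weight tab h z x y ((a - ptr) div S) ((a - ptr) mod S)) else m a)) \<and>
      (\<forall>a<64. a \<notin> {23, 24, 25, 30, 31, 32, 33, 39} \<longrightarrow> m' a = m a) \<and> p' = p"
      unfolding I_def F_def by (auto simp: algebra_simps)
  qed
qed

text \<open>As \<open>n\<^sup>2 \<le> 2 ^ \<Lambda>\<close>, the number \<open>\<Lambda> - 1\<close>
  is already a candidate in the definition of the level. The level selected is thus one of the
  levels that have a sketch.\<close>

lemma level_Lam: "c < n\<^sup>2 \<Longrightarrow> level L c < \<Lambda>"
proof -
  assume "c < n\<^sup>2"
  also have "n\<^sup>2 \<le> 2 ^ \<Lambda>" by (rule n_Lam)
  also have "(2::nat) ^ \<Lambda> = 2 * 2 ^ (\<Lambda> - 1)" using pos by (cases \<Lambda>) auto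
  also have "\<dots> \<le> 2 * (2 ^ (\<Lambda> - 1) * L)" using pos by simp
  finally have "level L c \<le> \<Lambda> - 1" unfolding level_def by (rule Least_le)
  then show ?thesis using pos by simp
qed

lemma block_le: "j < nb \<Longrightarrow> cb + j * (\<Lambda> * R * S) + \<Lambda> * R * S \<le> top"
  using mult_le_mono1[of "Suc j" nb "\<Lambda> * R * S"] by (simp add: top_def)

lemma small:
  "64 + G * P + nb \<le> 2 ^ w" "\<Lambda> * R * S < 2 ^ w" "nb < 2 ^ w" "R * S < 2 ^ w" "zb + nb < 2 ^ w" "cb < 2 ^ w" "n < 2 ^ w"
proof -
  have "n ^ 1 \<le> n ^ 4" by (rule power_increasing) (use n_ge in auto)
  then show "n < 2 ^ w" using n_w by simp
  have "\<Lambda> * R * S \<le> nb * (\<Lambda> * R * S)" "R * S \<le> \<Lambda> * R * S" using pos by auto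
  then show "64 + G * P + nb \<le> 2 ^ w" "\<Lambda> * R * S < 2 ^ w" "nb < 2 ^ w" "R * S < 2 ^ w" "zb + nb < 2 ^ w" "cb < 2 ^ w"
    using top_w unfolding top_def cb_def ob_def zb_def by linarith+
qed

lemma wp_locate:
  assumes par: "params m" and m: "m 3 = u" "m 4 = v" and uv: "u < n" "v < n" "u \<noteq> v"
    and tab: "\<And>k. k < G * P \<Longrightarrow> m (64 + k) = tab k" and zs: "\<And>j. j < nb \<Longrightarrow> m (zb + j) = zs j"
    and zw: "\<And>j. j < nb \<Longrightarrow> zs j < 2 ^ w"
    and xy: "x = min u v" "y = max u v" and h: "h = hash tab 0 x y"
  shows "wp w M \<tau> locate_prog m p (\<lambda>k m' p'. k \<le> 200 + 50 * q \<and>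
     m' 20 = x \<and> m' 21 = y \<and> m' 22 = x * n + y \<and> m' 26 = h mod nb \<and> m' 27 = h div nb \<and> m' 28 = zs (h mod nb) \<and>
     m' 29 = zs (h mod nb) div nb \<and> m' 30 = cb + h mod nb * (\<Lambda> * R * S) \<and> m' 31 = 0 \<and> m' 32 = 1 \<and>
     (\<forall>a. a < 20 \<or> 64 \<le> a \<longrightarrow> m' a = m a) \<and> p' = p)"
proof -
  have xn: "x < n" "y < n" using uv xy by auto
  have "x * n + y < Suc x * n" using xn by simp
  also have "\<dots> \<le> n * n" using xn by (intro mult_le_mono1) auto
  also have "\<dots> \<le> n ^ 4" using n_ge by (simp add: power4_eq_xxxx)
  also have "\<dots> < 2 ^ w" by (rule n_w)
  finally have idw: "x * n + y < 2 ^ w" .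
  define m1 where "m1 = m(20 := x, 21 := y, 22 := x * n + y, 23 := 0)"
  have hp: "wp w M \<tau> hash_prog m1 p (\<lambda>k m' p'. k \<le> 50 + 50 * q \<and> m' 25 = hash tab 0 x y \<and>
          (\<forall>a. a \<notin> {24, 25, 39} \<longrightarrow> m' a = m1 a) \<and> p' = p)"
    by (rule wp_hash) (use par tab xn in \<open>auto simp: m1_def params_def\<close>)
  have hw: "h < 2 ^ w" by (simp add: h hash_def)
  have hn: "h mod nb < nb" using pos by simp
  have zj: "zs (h mod nb) < 2 ^ w" "zs (h mod nb) div nb < 2 ^ w" "h div nb < 2 ^ w" "h mod nb < 2 ^ w"
    using zw[OF hn] hw by (auto intro: le_less_trans[OF div_le_dividend] le_less_trans[OF mod_less_eq_dividend])
  have ad: "zb + h mod nb < 2 ^ w" using small(5) hn by linarith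
  have bw: "cb + h mod nb * (\<Lambda> * R * S) < 2 ^ w" "h mod nb * (\<Lambda> * R * S) < 2 ^ w"
    using block_le[OF hn] top_w small(2) by linarith+
  have zb64: "64 \<le> zb" by (simp add: zb_def)
  have rd: "m2 (zb + h mod nb) = zs (h mod nb)" if "\<forall>a. a \<notin> {24, 25, 39} \<longrightarrow> m2 a = m1 a" for m2
    using that zb64 zs[OF hn] by (auto simp: m1_def)
  have nz: "zb + h mod nb \<noteq> 26" "zb + h mod nb \<noteq> 27" using zb64 by auto
  have mm: "m 0 = n" "m (Suc 0) = s" "m 16 = zb" "m 17 = cb" "m 6 = nb" "m 14 = \<Lambda> * R" "m 12 = S" using par by (auto simp: params_def)
  have xnw: "x * n < 2 ^ w" using idw by simp
  define Q where "Q k m' p' \<longleftrightarrow> k \<le> 200 + 50 * q \<and>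
     m' 20 = x \<and> m' 21 = y \<and> m' 22 = x * n + y \<and> m' 26 = h mod nb \<and> m' 27 = h div nb \<and> m' 28 = zs (h mod nb) \<and>
     m' 29 = zs (h mod nb) div nb \<and> m' 30 = cb + h mod nb * (\<Lambda> * R * S) \<and> m' 31 = 0 \<and> m' 32 = 1 \<and>
     (\<forall>a. a < 20 \<or> 64 \<le> a \<longrightarrow> m' a = m a) \<and> p' = p" for k and m' :: "nat \<Rightarrow> nat" and p'
  have rest: "wp w M \<tau> locate_post m2 p2 (\<lambda>l. Q (l + (k + 50)))"
    if k: "k \<le> 50 + 50 * q" and m2: "m2 25 = hash tab 0 x y" "\<forall>a. a \<notin> {24, 25, 39} \<longrightarrow> m2 a = m1 a" "p2 = p" for k m2 p2
    unfolding locate_post_def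
    using k m2 rd[OF m2(2)] ad nz bw zj small(2) hw
    by (simp add: h[symmetric] m1_def mm) (auto simp: Q_def)
  have Qm: "Q k m' p' \<Longrightarrow> l \<le> k \<Longrightarrow> Q l m' p'" for k l m' p' by (auto simp: Q_def)
  have rest': "wp w M \<tau> hash_prog m1 p (\<lambda>k m2 p2. wp w M \<tau> locate_post m2 p2 (\<lambda>l. Q (l + (k + 50))))"
    by (rule wp_mono[OF hp]) (use rest in blast)
  \<comment> \<open>The offset \<open>c\<close> is the cost of the instructions before the hash; it
    is 27 in both branches below.\<close>
  have fin: "wp w M \<tau> hash_prog m1 p (\<lambda>k m2 p2. wp w M \<tau> locate_post m2 p2 (\<lambda>l. Q (c + (k + l))))" if "c \<le> 50" for c
    by (rule wp_mono[OF rest'], erule wp_mono, erule Qm) (use that in simp)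
  have "wp w M \<tau> locate_prog m p Q"
  proof (cases "u < v")
    case True
    then have "x = u" "y = v" using xy by auto
    then show ?thesis
      unfolding locate_prog_def
      using True m idw xnw
      apply (simp add: mm)
      apply (rule wp_mono[OF fin[of 27, unfolded m1_def \<open>x = u\<close> \<open>y = v\<close>]])
       apply (simp, erule wp_mono, erule Qm, simp)
      done
  next
    case False
    then have "x = v" "y = u" using xy by auto
    then show ?thesis
      unfolding locate_prog_def
      using False m idw xnw
      apply (simp add: mm)
      apply (rule wp_mono[OF fin[of 27, unfolded m1_def \<open>x = v\<close> \<open>y = u\<close>]])
       apply (simp, erule wp_mono, erule Qm, simp)
      done
  qed
  then show ?thesis unfolding Q_def[abs_def] .
qed

text \<open>The level is computed from \<open>m base\<close>, the first entry of row 0: at level 0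
  no digit is compared, so this entry counts the whole bucket.\<close>

lemma wp_query:
  assumes par: "params m" and wf: "\<And>a. 64 \<le> a \<Longrightarrow> m a < 2 ^ w"
    and m: "m 26 = j" "m 28 = z" "m 29 = z div nb" and j: "j < nb" and z: "z < 2 ^ w"
    and base: "base = cb + j * (\<Lambda> * R * S)" and c: "m base < n\<^sup>2"
    and lev: "lev = level L (m base)"
    and res: "res = (if z mod nb < s then rows W (\<lambda>i x. m (base + lev * (R * S) + i * S + x)) (z div nb div 2 ^ lev) R else 0)"
  shows "wp w M \<tau> query_prog m p (\<lambda>k m' p'. k \<le> \<Lambda> * 40 + R * (W * 100 + 110) + 300 \<and>
     (\<forall>a\<ge>64. m' a = (m(ob + 2 * j := res div n, ob + 2 * j + 1 := res mod n)) a) \<and>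
     (\<forall>a<26. m' a = m a) \<and> p' = p)"
proof -
  have cb64: "64 \<le> cb" by (simp add: cb_def ob_def zb_def)
  have base64: "64 \<le> base" using cb64 by (simp add: base)
  have levL: "lev < \<Lambda>" using level_Lam[OF c] by (simp add: lev)
  have "Suc lev * (R * S) \<le> \<Lambda> * (R * S)" by (rule mult_le_mono1) (use levL in simp)
  then have blk: "base + lev * (R * S) + R * S \<le> top"
    using block_le[OF j] unfolding base by (simp add: mult.assoc)
  have mm: "m 0 = n" "m (Suc 0) = s" "m 16 = zb" "m 17 = cb" "m 6 = nb" "m 14 = \<Lambda> * R" "m 12 = S" "m 9 = R" "m 5 = ob" using par by (auto simp: params_def)
  have bw: "j * (\<Lambda> * R * S) < 2 ^ w" "base < 2 ^ w" "base + lev * (R * S) < 2 ^ w" "lev * (R * S) < 2 ^ w" "R * S < 2 ^ w" "\<Lambda> * R * S < 2 ^ w"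
    using blk top_w small unfolding base by linarith+
  have obw: "ob + 2 * j < 2 ^ w" "2 * j < 2 ^ w" "Suc (ob + 2 * j) < 2 ^ w" "Suc (ob + 2 * j) < M" "ob + 2 * j < M" and ob64: "64 \<le> ob"
    using j top_w top_M unfolding top_def cb_def ob_def zb_def by linarith+
  define v where "v = z div nb div 2 ^ lev"
  have vw: "v < 2 ^ w" unfolding v_def using z by (meson div_le_dividend le_less_trans)
  define m1 where "m1 = m(30 := base, 33 := m base, 31 := 0, 32 := 1)"
  define p1 where "p1 = base + lev * (R * S)"
  define Q where "Q k m' p' \<longleftrightarrow> k \<le> \<Lambda> * 40 + R * (W * 100 + 110) + 300 \<and>
     (\<forall>a\<ge>64. m' a = (m(ob + 2 * j := res div n, ob + 2 * j + 1 := res mod n)) a) \<and>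
     (\<forall>a<26. m' a = m a) \<and> p' = p" for k and m' :: "nat \<Rightarrow> nat" and p'
  have Qm: "Q k m' p' \<Longrightarrow> l \<le> k \<Longrightarrow> Q l m' p'" for k l m' p' by (auto simp: Q_def)
  have l1: "wp w M \<tau> level_loop m1 p (\<lambda>k m' p'. k \<le> level L (m base) * 40 + 20 \<and> m' 31 = level L (m base) \<and>
      m' 32 = 2 ^ level L (m base) \<and> (\<forall>a. a \<notin> {31, 32} \<longrightarrow> m' a = m1 a) \<and> p' = p)"
    by (rule wp_level) (use par c base64 in \<open>auto simp: m1_def params_def\<close>)
  define r where "r = rows W (\<lambda>i x. m (p1 + i * S + x)) v R"
  have fsc: "fst (scan (f i) u k) < 2 ^ w" if "\<And>i x. f i x < 2 ^ w" for f :: "nat \<Rightarrow> nat \<Rightarrow> nat" and u i k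
    by (induction k) (use that in \<open>auto split: prod.split\<close>)
  have rwf: "rows W f u k < 2 ^ w" if "\<And>i x. f i x < 2 ^ w" for f u k
    by (induction k) (use that in \<open>auto intro: fsc\<close>)
  have rw: "r < 2 ^ w" unfolding r_def by (rule rwf) (use wf base64 in \<open>auto simp: p1_def\<close>)
  have post: "wp w M \<tau> query_post m3 p (\<lambda>l. Q (l + (\<Lambda> * 40 + R * (W * 100 + 110) + 150)))"
    if m3: "m3 34 = r" "\<And>a. a \<ge> 64 \<Longrightarrow> m3 a = m a" "\<And>a. a < 30 \<Longrightarrow> m3 a = m a" for m3
  proof -
    have rr: "res = (if z mod nb < s then r else 0)"
      unfolding res r_def p1_def v_def by simp
    have ne: "ob + 2 * j \<noteq> k" "Suc (ob + 2 * j) \<noteq> k" if "k < 64" for k using ob64 that by auto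
    have md: "z mod nb < 2 ^ w" "r div n < 2 ^ w" "r mod n < 2 ^ w"
      using rw z by (auto intro: le_less_trans[OF div_le_dividend] le_less_trans[OF mod_less_eq_dividend])
    have fin: "Q k (m4(ob + 2 * j := res div n, Suc (ob + 2 * j) := res mod n)) p"
      if "k \<le> \<Lambda> * 40 + R * (W * 100 + 110) + 250" "\<And>a. a \<ge> 64 \<Longrightarrow> m4 a = m a" "\<And>a. a < 30 \<Longrightarrow> m4 a = m a" for k m4
      unfolding Q_def using that ob64 by auto
    have m3s: "m3 0 = n" "m3 (Suc 0) = s" "m3 6 = nb" "m3 5 = ob" "m3 26 = j" "m3 28 = z" using m3(3) mm m by auto
    show ?thesis
    proof (cases "z mod nb < s")
      case True
      then have res_eq: "res = r" using rr by simp
      show ?thesis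
        unfolding query_post_def using md obw True ob64
        by (simp add: m3s m3(1) ne) (use m3 ob64 in \<open>simp add: fin[unfolded res_eq]\<close>)
    next
      case False
      then have res_eq: "res = 0" using rr by simp
      show ?thesis
        unfolding query_post_def using md obw False ob64
        by (simp add: m3s m3(1) ne) (use m3 ob64 fin[unfolded res_eq] in \<open>simp\<close>)
    qed
  qed
  have l2: "wp w M \<tau> rows_loop m2 p (\<lambda>k m' p'. wp w M \<tau> query_post m' p' (\<lambda>l. Q (l + k + (\<Lambda> * 40 + 140))))"
    if m2: "m2 30 = p1" "m2 31 = 0" "m2 34 = 0" "m2 40 = v" "\<And>a. a \<ge> 64 \<Longrightarrow> m2 a = m a" "\<And>a. a < 30 \<Longrightarrow> m2 a = m a" for m2
  proof -
    have "wp w M \<tau> rows_loop m2 p (\<lambda>k m' p'. k \<le> R * (W * 100 + 110) + 10 \<and>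
      m' 34 = rows W (\<lambda>i x. m2 (p1 + i * S + x)) v R \<and>
      (\<forall>a. a \<notin> {30, 31, 33, 34, 35, 36, 37, 38, 41} \<longrightarrow> m' a = m2 a) \<and> p' = p)"
    proof (rule wp_rows)
      show "params m2" using par m2 by (simp add: params_def)
      show "m2 a < 2 ^ w" if "64 \<le> a" for a using that m2 wf by simp
      show "v < 2 ^ w" by (rule vw)
    qed (use m2 base64 blk in \<open>auto simp: p1_def\<close>)
    then show ?thesis
    proof (rule wp_mono, elim conjE)
      fix k m3 p3
      assume *: "k \<le> R * (W * 100 + 110) + 10" "m3 34 = rows W (\<lambda>i x. m2 (p1 + i * S + x)) v R"
        "\<forall>a. a \<notin> {30, 31, 33, 34, 35, 36, 37, 38, 41} \<longrightarrow> m3 a = m2 a" "p3 = p"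
      have "m3 34 = r" unfolding * r_def using m2(5) base64 by (simp add: p1_def)
      then have "wp w M \<tau> query_post m3 p (\<lambda>l. Q (l + (\<Lambda> * 40 + R * (W * 100 + 110) + 150)))"
        by (rule post) (use * m2 in auto)
      then show "wp w M \<tau> query_post m3 p3 (\<lambda>l. Q (l + k + (\<Lambda> * 40 + 140)))"
        unfolding * by (rule wp_mono) (erule Qm, use * in simp)
    qed
  qed
  have l3: "wp w M \<tau> rows_loop m2 p (\<lambda>k m' p'. wp w M \<tau> query_post m' p' (\<lambda>l. Q (d + (k + l))))"
    if m2: "m2 30 = p1" "m2 31 = 0" "m2 34 = 0" "m2 40 = v" "\<And>a. a \<ge> 64 \<Longrightarrow> m2 a = m a" "\<And>a. a < 30 \<Longrightarrow> m2 a = m a"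
      and d: "d \<le> \<Lambda> * 40 + 140" for m2 d
    by (rule wp_mono[OF l2[OF m2]], assumption+) (erule wp_mono, erule Qm, use d in simp)
  have pw: "2 ^ lev < (2 ^ w :: nat)" using levL Lam_w power_strict_increasing[of lev \<Lambda> "2::nat"] by simp
  have l4: "wp w M \<tau> level_loop m1 p (\<lambda>k m' p'. k \<le> \<Lambda> * 40 + 20 \<and> m' 31 = lev \<and>
      m' 32 = 2 ^ lev \<and> (\<forall>a. a \<notin> {31, 32} \<longrightarrow> m' a = m1 a) \<and> p' = p)"
    by (rule wp_mono[OF l1]) (use levL in \<open>auto simp: lev\<close>)
  have mid: "wp w M \<tau> (Seq (asg 40 (quo (V 29) (V 32)))
     (Seq (asg 30 (add (V 30) (mul (V 31) (mul (V 9) (V 12)))))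
     (Seq (asg 34 (Const 0))
     (Seq (asg 31 (Const 0))
     (Seq rows_loop query_post))))) m2 p (\<lambda>l. Q (l + (\<Lambda> * 40 + 100)))"
    if m2: "m2 31 = lev" "m2 32 = 2 ^ lev" "m2 30 = base" "\<And>a. a \<ge> 64 \<Longrightarrow> m2 a = m a" "\<And>a. a < 30 \<Longrightarrow> m2 a = m a" for m2
  proof -
    have m2s: "m2 29 = z div nb" "m2 9 = R" "m2 12 = S" using m2(5) mm m by auto
    define m3 where "m3 = m2(40 := v, 30 := p1, 34 := 0, 31 := 0)"
    have "wp w M \<tau> rows_loop m3 p (\<lambda>k m' p'. wp w M \<tau> query_post m' p' (\<lambda>l. Q (\<Lambda> * 40 + 140 + (k + l))))"
      by (rule l3) (use m2 in \<open>auto simp: m3_def\<close>)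
    then have "wp w M \<tau> rows_loop m3 p (\<lambda>k m' p'. wp w M \<tau> query_post m' p' (\<lambda>l. Q (26 + (k + l) + (\<Lambda> * 40 + 100))))"
      by (rule wp_mono) (erule wp_mono, erule Qm, simp)
    then show ?thesis
      using bw vw by (simp add: m2 m2s v_def[symmetric] p1_def[symmetric] m3_def add.assoc)
  qed
  define rest where "rest = Seq (asg 40 (quo (V 29) (V 32)))
     (Seq (asg 30 (add (V 30) (mul (V 31) (mul (V 9) (V 12)))))
     (Seq (asg 34 (Const 0))
     (Seq (asg 31 (Const 0))
     (Seq rows_loop query_post))))"
  have m1a: "m1 a = m a" if "a < 30 \<or> a \<ge> 64" for a using that by (auto simp: m1_def)
  have lv: "wp w M \<tau> level_loop m1 p (\<lambda>k m2 p2. wp w M \<tau> rest m2 p2 (\<lambda>l. Q (50 + (k + l))))"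
  proof (rule wp_mono[OF l4], elim conjE)
    fix k m2 p2
    assume *: "k \<le> \<Lambda> * 40 + 20" "m2 31 = lev" "m2 32 = 2 ^ lev" "\<forall>a. a \<notin> {31, 32} \<longrightarrow> m2 a = m1 a" "p2 = p"
    have "wp w M \<tau> rest m2 p (\<lambda>l. Q (l + (\<Lambda> * 40 + 100)))"
      unfolding rest_def
    proof (rule mid)
      show "m2 30 = base" using * by (simp add: m1_def)
      show "m2 a = m a" if "a \<ge> 64" for a using * m1a[of a] that by auto
      show "m2 a = m a" if "a < 30" for a using * m1a[of a] that by auto
    qed (use * in auto)
    then show "wp w M \<tau> rest m2 p2 (\<lambda>l. Q (50 + (k + l)))"
      unfolding \<open>p2 = p\<close> by (rule wp_mono) (erule Qm, use * in simp)
  qed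
  have "wp w M \<tau> query_prog m p Q"
    unfolding query_prog_def rest_def[symmetric]
    using bw base64
    apply (simp add: mm m base[symmetric])
    apply (rule wp_mono[OF lv[unfolded m1_def One_nat_def]])
    apply (erule wp_mono, erule Qm, simp)
    done
  then show ?thesis unfolding Q_def[abs_def] .
qed

end

section \<open>Locality of the decoder\<close>

lemma scan_cong:
  "(\<And>x. x \<le> 2 * c \<Longrightarrow> f x = g x) \<Longrightarrow> scan f u c = scan g u c"
proof (induction c)
  case (Suc c)
  then have "scan f u c = scan g u c" "f (1 + 2 * c) = g (1 + 2 * c)" "f (2 + 2 * c) = g (2 + 2 * c)" by auto
  then show ?case by (simp only: scan.simps)
qed simp

lemma rows_cong:
  "(\<And>i x. i < k \<Longrightarrow> x \<le> 2 * W \<Longrightarrow> f i x = g i x) \<Longrightarrow> rows W f v k = rows W g v k"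
proof (induction k)
  case (Suc k)
  then have "scan (f k) u W = scan (g k) u W" for u by (intro scan_cong) auto
  then show ?case using Suc by simp
qed simp

section \<open>The memory invariant and its preservation by an update\<close>

context layout
begin

definition eid :: "nat set \<Rightarrow> nat" where
  "eid e = Min e * n + Max e"

definition ehash :: "(nat \<Rightarrow> nat) \<Rightarrow> nat \<Rightarrow> nat set \<Rightarrow> nat" where
  "ehash tab i e = hash tab i (Min e) (Max e)"

definition edge :: "nat set \<Rightarrow> bool" where
  "edge e \<longleftrightarrow> (\<exists>u v. e = {u, v} \<and> u < v \<and> v < n)"

definition bucket :: "(nat \<Rightarrow> nat) \<Rightarrow> nat set set \<Rightarrow> nat \<Rightarrow> nat set set" where
  "bucket tab E j = {e\<in>E. ehash tab 0 e mod nb = j}"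

definition counter :: "(nat \<Rightarrow> nat) \<Rightarrow> (nat \<Rightarrow> nat) \<Rightarrow> nat set set \<Rightarrow> nat \<Rightarrow> nat \<Rightarrow> nat \<Rightarrow> nat" where
  "counter tab zs E j r i =
     (\<Sum>e\<in>bucket tab E j. weight tab (ehash tab 0 e div nb) (zs j div nb) (Min e) (Max e) r i)"

definition result :: "(nat \<Rightarrow> nat) \<Rightarrow> (nat \<Rightarrow> nat) \<Rightarrow> nat set set \<Rightarrow> nat \<Rightarrow> nat" where
  "result tab zs E j = (let l = level L (card (bucket tab E j)) in
     if zs j mod nb < s
     then rows W (\<lambda>i x. counter tab zs E j (l * R + i) x) (zs j div nb div 2 ^ l) R else 0)"

text \<open>The memory contents outside the scratch registers are determined by table, sampling
  words and current edge set. No trace of earlier updates remains, so the sample at each time is a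
  function of these three alone.\<close>

definition state :: "(nat \<Rightarrow> nat) \<Rightarrow> (nat \<Rightarrow> nat) \<Rightarrow> nat set set \<Rightarrow> (nat \<Rightarrow> nat) \<Rightarrow> bool" where
  "state tab zs E m \<longleftrightarrow> params m \<and> (\<forall>a\<ge>64. m a < 2 ^ w) \<and>
     (\<forall>k<G * P. m (64 + k) = tab k) \<and> (\<forall>j<nb. m (zb + j) = zs j) \<and>
     (\<forall>j<nb. \<forall>i<\<Lambda> * R * S. m (cb + j * (\<Lambda> * R * S) + i) = counter tab zs E j (i div S) (i mod S)) \<and>
     (\<forall>j<nb. m (ob + 2 * j) = result tab zs E j div n \<and> m (ob + 2 * j + 1) = result tab zs E j mod n)"

lemma edgeD:
  assumes "edge e"
  shows "Min e < Max e" "Max e < n" "e = {Min e, Max e}" "finite e" "eid e < n\<^sup>2" "0 < eid e"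
    "eid e div n = Min e" "eid e mod n = Max e"
proof -
  obtain u v where uv: "e = {u, v}" "u < v" "v < n" using assms unfolding edge_def by blast
  then have m: "Min e = u" "Max e = v" by auto
  show "Min e < Max e" "Max e < n" "e = {Min e, Max e}" "finite e" using uv m by auto
  have "u * n + v < Suc u * n" using uv by simp
  also have "\<dots> \<le> n * n" using uv by (intro mult_le_mono1) auto
  finally show "eid e < n\<^sup>2" by (simp add: eid_def m power2_eq_square)
  show "0 < eid e" "eid e div n = Min e" "eid e mod n = Max e" using uv by (auto simp: eid_def m)
qed

lemma edge_pair: "u < n \<Longrightarrow> v < n \<Longrightarrow> u \<noteq> v \<Longrightarrow> edge {u, v}"
  unfolding edge_def by (metis insert_commute linorder_neqE_nat)

lemma edges_card:
  assumes "\<forall>e\<in>E. edge e"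
  shows "finite E" "2 * card E \<le> n * (n - 1)"
proof -
  have sub: "E \<subseteq> {e. e \<subseteq> {..<n} \<and> card e = 2}" using assms by (auto simp: edge_def)
  have fin: "finite {e. e \<subseteq> {..<n} \<and> card e = 2}" by (rule finite_subset[of _ "Pow {..<n}"]) auto
  show "finite E" by (rule finite_subset[OF sub fin])
  have "card E \<le> n choose 2" using card_mono[OF fin sub] n_subsets[of "{..<n}" 2] by simp
  also have "\<dots> = n * (n - 1) div 2" by (rule choose_two)
  finally show "2 * card E \<le> n * (n - 1)" by linarith
qed

lemma weight_le: "edge e \<Longrightarrow> weight tab h z (Min e) (Max e) r i \<le> eid e"
  using edgeD(1)[of e] by (auto simp: weight_def eid_def)

text \<open>At most \<open>n * (n - 1) / 2\<close> edges, each of weight below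
  \<open>n\<^sup>2\<close>, leave room in a word for one further code. The factor 2 is carried along
  to avoid halving.\<close>

lemma counter_bound:
  assumes E: "\<forall>e\<in>E. edge e" and x: "x < n\<^sup>2"
  shows "counter tab zs E j r i + x < 2 ^ w" "counter tab zs E j 0 0 = card (bucket tab E j)" "card (bucket tab E j) < n\<^sup>2"
proof -
  have sub: "bucket tab E j \<subseteq> E" by (auto simp: bucket_def)
  have fin: "finite E" "2 * card E \<le> n * (n - 1)" using edges_card[OF E] .
  have cE: "2 * card (bucket tab E j) \<le> n * (n - 1)" using card_mono[OF fin(1) sub] fin(2) by linarith
  have nn: "n * (n - 1) < n\<^sup>2" using n_ge by (simp add: power2_eq_square)
  then show "card (bucket tab E j) < n\<^sup>2" using cE by linarith
  show "counter tab zs E j 0 0 = card (bucket tab E j)" by (simp add: counter_def weight_def)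
  have "counter tab zs E j r i \<le> (\<Sum>e\<in>bucket tab E j. n\<^sup>2)"
    unfolding counter_def using sub E
    by (intro sum_mono) (meson edgeD(5) le_trans less_imp_le subsetD weight_le)
  also have "\<dots> = card (bucket tab E j) * n\<^sup>2" by simp
  finally have "2 * counter tab zs E j r i \<le> (2 * card (bucket tab E j)) * n\<^sup>2" by simp
  then have "2 * (counter tab zs E j r i + x) < (2 * card (bucket tab E j)) * n\<^sup>2 + 2 * n\<^sup>2" using x by (simp add: distrib_left)
  also have "\<dots> \<le> n * (n - 1) * n\<^sup>2 + 2 * n\<^sup>2" using cE by (intro add_mono mult_right_mono) auto
  also have "\<dots> = (n * (n - 1) + 2) * n\<^sup>2" by (simp only: add_mult_distrib)
  also have "\<dots> \<le> (2 * n\<^sup>2) * n\<^sup>2"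
  proof (rule mult_right_mono)
    have "2 \<le> n * n" using n_ge mult_le_mono[of 1 n 2 n] by simp
    then show "n * (n - 1) + 2 \<le> 2 * n\<^sup>2" using nn unfolding power2_eq_square by linarith
  qed simp
  also have "\<dots> = 2 * n ^ 4" by (simp add: power4_eq_xxxx power2_eq_square)
  finally show "counter tab zs E j r i + x < 2 ^ w" using n_w by simp
qed

text \<open>Linearity of the sketch: the counters are sums over the bucket, so an update adds or
  subtracts one weight there and leaves the other buckets alone.\<close>

lemma counter_update:
  fixes b :: nat
  assumes E: "\<forall>e\<in>E. edge e" and b: "if b = 0 then e \<in> E else e \<notin> E"
    and E': "E' = (if b = 0 then E - {e} else insert e E)"
  shows "counter tab zs E' j r i = (if ehash tab 0 e mod nb = j
      then bop b (counter tab zs E j r i) (weight tab (ehash tab 0 e div nb) (zs j div nb) (Min e) (Max e) r i)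
      else counter tab zs E j r i)"
    and "ehash tab 0 e mod nb \<noteq> j \<Longrightarrow> bucket tab E' j = bucket tab E j"
proof -
  have fin: "finite (bucket tab E j)" using edges_card(1)[OF E] by (simp add: bucket_def)
  show *: "bucket tab E' j = bucket tab E j" if "ehash tab 0 e mod nb \<noteq> j"
    using that by (auto simp: bucket_def E')
  show "counter tab zs E' j r i = (if ehash tab 0 e mod nb = j
      then bop b (counter tab zs E j r i) (weight tab (ehash tab 0 e div nb) (zs j div nb) (Min e) (Max e) r i)
      else counter tab zs E j r i)"
  proof (cases "ehash tab 0 e mod nb = j")
    case False
    then show ?thesis using * by (simp add: counter_def)
  next
    case True
    show ?thesis
    proof (cases "b = 0")
      case b0: True
      have "bucket tab E' j = bucket tab E j - {e}" using b0 by (auto simp: bucket_def E')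
      moreover have "e \<in> bucket tab E j" using b b0 True by (simp add: bucket_def)
      ultimately show ?thesis using True b0 fin by (simp add: counter_def bop_def sum.remove)
    next
      case False
      have "bucket tab E' j = insert e (bucket tab E j)" using False True by (auto simp: bucket_def E')
      moreover have "e \<notin> bucket tab E j" using b False by (simp add: bucket_def)
      ultimately show ?thesis using True False fin by (simp add: counter_def bop_def)
    qed
  qed
qed

lemma result_update:
  fixes b :: nat
  assumes E: "\<forall>e\<in>E. edge e" and b: "if b = 0 then e \<in> E else e \<notin> E"
    and E': "E' = (if b = 0 then E - {e} else insert e E)" and j: "ehash tab 0 e mod nb \<noteq> j"
  shows "result tab zs E' j = result tab zs E j"
proof -
  have "counter tab zs E' j = counter tab zs E j"
    using counter_update(1)[OF E b E', of tab zs j] j by (simp add: fun_eq_iff)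
  moreover have "bucket tab E' j = bucket tab E j" using counter_update(2)[OF E b E', of tab j] j by simp
  ultimately show ?thesis unfolding result_def by (simp only:)
qed

lemma result_small:
  assumes E: "\<forall>e\<in>E. edge e"
  shows "result tab zs E j < 2 ^ w"
proof -
  have f: "counter tab zs E j r i < 2 ^ w" for r i using counter_bound(1)[OF E, of 0] n_ge by simp
  have fsc: "fst (scan (f i) u k) < 2 ^ w" if "\<And>i x. f i x < 2 ^ w" for f :: "nat \<Rightarrow> nat \<Rightarrow> nat" and u i k
    by (induction k) (use that in \<open>auto split: prod.split\<close>)
  have rwf: "rows W f u k < 2 ^ w" if "\<And>i x. f i x < 2 ^ w" for f u k
    by (induction k) (use that in \<open>auto intro: fsc\<close>)
  show ?thesis unfolding result_def Let_def by (auto intro!: rwf f)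
qed

definition update_time :: nat where
  "update_time = 600 + 50 * q + \<Lambda> * R * (200 + 50 * q) + \<Lambda> * 40 + R * (W * 100 + 110)"

text \<open>Only the block of counters of bucket \<open>j\<close> and its output slot are rewritten.
  Everything else keeps its meaning, because counters and results of other buckets are the same for
  \<open>E\<close> and \<open>E'\<close>.\<close>

lemma wp_update:
  assumes st: "state tab zs E m0" and m0: "m = m0(2 := b, 3 := u, 4 := v)"
    and uv: "u < n" "v < n" "u \<noteq> v" and E: "\<forall>e\<in>E. edge e"
    and b: "if b = 0 then {u, v} \<in> E else {u, v} \<notin> E"
    and E': "E' = (if b = 0 then E - {{u, v}} else insert {u, v} E)"
    and zw: "\<And>j. j < nb \<Longrightarrow> zs j < 2 ^ w"
  shows "wp w M \<tau> update_prog m p (\<lambda>k m' p'. k \<le> update_time \<and> state tab zs E' m' \<and> p' = p)"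
proof -
  define e where "e = {u, v}"
  define x y where "x = min u v" and "y = max u v"
  define h where "h = hash tab 0 x y"
  define j where "j = h mod nb"
  define base where "base = cb + j * (\<Lambda> * R * S)"
  define N where "N = \<Lambda> * R * S"
  have xy: "x < y" "y < n" using uv by (auto simp: x_def y_def)
  have e: "edge e" unfolding e_def by (rule edge_pair[OF uv])
  have Me: "Min e = x" "Max e = y" by (auto simp: e_def x_def y_def)
  have eh: "ehash tab 0 e = h" by (simp add: ehash_def Me h_def)
  have eid: "eid e = x * n + y" by (simp add: eid_def Me)
  have E'e: "\<forall>e\<in>E'. edge e" using E e by (auto simp: E' e_def)
  have j: "j < nb" using pos by (simp add: j_def)
  have S0: "S > 0" by (simp add: S_def)
  have cb64: "64 + G * P \<le> zb" "zb + nb = ob" "ob + 2 * nb = cb" "64 \<le> cb" by (simp_all add: cb_def ob_def zb_def)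
  have blk: "base + N \<le> top" using block_le[OF j] by (simp add: base_def N_def)
  have par0: "params m0" and wf0: "\<And>a. 64 \<le> a \<Longrightarrow> m0 a < 2 ^ w" and tab0: "\<And>k. k < G * P \<Longrightarrow> m0 (64 + k) = tab k"
    and zs0: "\<And>j. j < nb \<Longrightarrow> m0 (zb + j) = zs j"
    and cnt0: "\<And>j i. j < nb \<Longrightarrow> i < N \<Longrightarrow> m0 (cb + j * N + i) = counter tab zs E j (i div S) (i mod S)"
    and out0: "\<And>j. j < nb \<Longrightarrow> m0 (ob + 2 * j) = result tab zs E j div n \<and> m0 (ob + 2 * j + 1) = result tab zs E j mod n"
    using st unfolding state_def N_def by auto
  have m64: "m a = m0 a" if "64 \<le> a" for a using that by (auto simp: m0)
  have par: "params m" using par0 by (simp add: params_def m0)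
  have hw: "h < 2 ^ w" by (simp add: h_def hash_def)
  have zj: "zs j div nb < 2 ^ w" using zw[OF j] by (auto intro: le_less_trans[OF div_le_dividend])
  have hd: "h div nb < 2 ^ w" using hw by (auto intro: le_less_trans[OF div_le_dividend])
  \<comment> \<open>The predicted contents of the block of bucket \<open>j\<close> after the pass
    over its sketches; the next fact identifies them with the counters of the new edge set.\<close>
  define F where "F i = bop b (m0 (base + i)) (weight tab (h div nb) (zs j div nb) x y (i div S) (i mod S))" for i
  have F: "F i = counter tab zs E' j (i div S) (i mod S)" if "i < N" for i
    using counter_update(1)[OF E b[folded e_def] E'[folded e_def], of tab zs j] cnt0[OF j that]
    by (simp add: F_def base_def N_def eh j_def Me)
  have F0: "F 0 = card (bucket tab E' j)" using F[of 0] pos S0 counter_bound(2)[OF E'e, of 0 tab zs j] n_ge by (simp add: N_def)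
  define lev where "lev = level L (card (bucket tab E' j))"
  have cb2: "card (bucket tab E' j) < n\<^sup>2" using counter_bound(3)[OF E'e, of 0] n_ge by simp
  have levL: "lev < \<Lambda>" unfolding lev_def by (rule level_Lam[OF cb2])
  have locate: "wp w M \<tau> locate_prog m p (\<lambda>k m' p'. k \<le> 200 + 50 * q \<and>
     m' 20 = x \<and> m' 21 = y \<and> m' 22 = x * n + y \<and> m' 26 = h mod nb \<and> m' 27 = h div nb \<and> m' 28 = zs (h mod nb) \<and>
     m' 29 = zs (h mod nb) div nb \<and> m' 30 = cb + h mod nb * (\<Lambda> * R * S) \<and> m' 31 = 0 \<and> m' 32 = 1 \<and>
     (\<forall>a. a < 20 \<or> 64 \<le> a \<longrightarrow> m' a = m a) \<and> p' = p)"
    by (rule wp_locate[OF par _ _ uv]) (use tab0 zs0 zw cb64 in \<open>auto simp: m0 x_def y_def h_def\<close>)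
  have sketch: "wp w M \<tau> sketch_loop m1 p (\<lambda>k m' p'. k \<le> \<Lambda> * R * (200 + 50 * q) + 10 \<and>
      (\<forall>a\<ge>64. m' a = (if base \<le> a \<and> a < base + N then F (a - base) else m0 a)) \<and>
      (\<forall>a<64. a \<notin> {23, 24, 25, 30, 31, 32, 33, 39} \<longrightarrow> m' a = m1 a) \<and> p' = p)"
    if m1: "m1 20 = x" "m1 21 = y" "m1 22 = x * n + y" "m1 26 = j" "m1 27 = h div nb" "m1 28 = zs j"
      "m1 29 = zs j div nb" "m1 30 = base" "m1 31 = 0" "m1 32 = 1" "\<And>a. a < 20 \<or> 64 \<le> a \<Longrightarrow> m1 a = m a" for m1
  proof -
    have m1a: "m1 a = m0 a" if "64 \<le> a" for a using m1 m64 that by auto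
    have "wp w M \<tau> sketch_loop m1 p (\<lambda>k m' p'. k \<le> \<Lambda> * R * (200 + 50 * q) + 10 \<and>
      (\<forall>a\<ge>64. m' a = (if base \<le> a \<and> a < base + \<Lambda> * R * S
         then bop b (m1 a) (weight tab (h div nb) (zs j div nb) x y ((a - base) div S) ((a - base) mod S)) else m1 a)) \<and>
      (\<forall>a<64. a \<notin> {23, 24, 25, 30, 31, 32, 33, 39} \<longrightarrow> m' a = m1 a) \<and> p' = p)"
    proof (rule wp_sketch)
      show "params m1" using par m1 by (simp add: params_def)
      show "m1 a < 2 ^ w" if "64 \<le> a" for a using that m1a wf0 by simp
      show "m1 (64 + k) = tab k" if "k < G * P" for k using that m1a tab0 by simp
      show "m1 2 = b" using m1 by (simp add: m0)
      show "m1 a + (x * n + y) < 2 ^ w" if "base \<le> a" "a < base + \<Lambda> * R * S" for a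
      proof -
        have "a = cb + j * N + (a - base)" "a - base < N" using that by (auto simp: base_def N_def)
        then have "m0 a = counter tab zs E j ((a - base) div S) ((a - base) mod S)" using cnt0[OF j] by metis
        then show ?thesis using counter_bound(1)[OF E edgeD(5)[OF e]] m1a[of a] that cb64 by (simp add: eid base_def)
      qed
      show "base + \<Lambda> * R * S \<le> top" using blk by (simp add: N_def)
      show "cb \<le> base" by (simp add: base_def)
    qed (use m1 xy hd zj in auto)
    then show ?thesis
      by (rule wp_mono) (use m1a cb64 in \<open>auto simp: F_def N_def base_def\<close>)
  qed
  have query: "wp w M \<tau> query_prog m2 p (\<lambda>k m' p'. k \<le> \<Lambda> * 40 + R * (W * 100 + 110) + 300 \<and> state tab zs E' m' \<and> p' = p)"
    if m2: "m2 26 = j" "m2 28 = zs j" "m2 29 = zs j div nb" "params m2"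
      and m2a: "\<And>a. 64 \<le> a \<Longrightarrow> m2 a = (if base \<le> a \<and> a < base + N then F (a - base) else m0 a)" for m2
  proof -
    have b64: "64 \<le> base" using cb64 by (simp add: base_def)
    have m2b: "m2 (base + i) = counter tab zs E' j (i div S) (i mod S)" if "i < N" for i
      using m2a[of "base + i"] that b64 F by simp
    have N0: "0 < N" using pos S0 by (simp add: N_def)
    have m2base: "m2 base = card (bucket tab E' j)" using m2a[of base] b64 N0 F0 by simp
    have wf2: "m2 a < 2 ^ w" if "64 \<le> a" for a
      using m2a[OF that] wf0[OF that] F[of "a - base"] counter_bound(1)[OF E'e, of 0] n_ge by (auto simp: less_diff_conv2)
    have res: "result tab zs E' j = (if zs j mod nb < s then rows W (\<lambda>i x. m2 (base + lev * (R * S) + i * S + x)) (zs j div nb div 2 ^ lev) R else 0)"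
    proof -
      have "rows W (\<lambda>i x. counter tab zs E' j (lev * R + i) x) v R = rows W (\<lambda>i x. m2 (base + lev * (R * S) + i * S + x)) v R" for v
      proof (rule rows_cong)
        fix k x assume k: "k < R" and "x \<le> 2 * W"
        then have x: "x < S" by (simp add: S_def)
        have "lev * (R * S) + k * S + x = (lev * R + k) * S + x" by (simp add: algebra_simps)
        moreover have "(lev * R + k) * S + x < N"
        proof -
          have "lev * R + k < Suc lev * R" using k by simp
          also have "\<dots> \<le> \<Lambda> * R" using levL by (intro mult_le_mono1) simp
          finally have "Suc (lev * R + k) * S \<le> \<Lambda> * R * S" by (intro mult_le_mono1) simp
          then show ?thesis using x by (simp add: N_def)
        qed
        ultimately show "counter tab zs E' j (lev * R + k) x = m2 (base + lev * (R * S) + k * S + x)"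
          using m2b[of "lev * (R * S) + k * S + x"] x by (simp add: add.assoc)
      qed
      then show ?thesis by (simp add: result_def lev_def Let_def)
    qed
    have "wp w M \<tau> query_prog m2 p (\<lambda>k m' p'. k \<le> \<Lambda> * 40 + R * (W * 100 + 110) + 300 \<and>
      (\<forall>a\<ge>64. m' a = (m2(ob + 2 * j := result tab zs E' j div n, ob + 2 * j + 1 := result tab zs E' j mod n)) a) \<and>
      (\<forall>a<26. m' a = m2 a) \<and> p' = p)"
      by (rule wp_query[where base = base and lev = lev and z = "zs j"])
        (use m2 wf2 j zw base_def m2base cb2 lev_def res in auto)
    then show ?thesis
    proof (rule wp_mono, elim conjE, intro conjI)
      fix k m' p'
      assume a: "\<forall>a\<ge>64. m' a = (m2(ob + 2 * j := result tab zs E' j div n, ob + 2 * j + 1 := result tab zs E' j mod n)) a"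
        and lo: "\<forall>a<26. m' a = m2 a"
      have r: "result tab zs E' j div n < 2 ^ w" "result tab zs E' j mod n < 2 ^ w"
        using result_small[OF E'e, of tab zs j] by (auto intro: le_less_trans[OF div_le_dividend] le_less_trans[OF mod_less_eq_dividend])
      have m'0: "m' a = m0 a" if "64 \<le> a" "a < ob" for a
        using a m2a[of a] that cb64 by (auto simp: base_def)
      show "state tab zs E' m'"
        unfolding state_def
      proof (intro conjI allI impI)
        show "params m'" using lo m2(4) by (simp add: params_def)
        show "m' a < 2 ^ w" if "64 \<le> a" for a using a that wf2 r by auto
        show "m' (64 + k) = tab k" if "k < G * P" for k using m'0[of "64 + k"] tab0 that cb64 by simp
        show "m' (zb + j') = zs j'" if "j' < nb" for j' using m'0[of "zb + j'"] zs0 that cb64 by simp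
        show "m' (cb + j' * (\<Lambda> * R * S) + i) = counter tab zs E' j' (i div S) (i mod S)" if j': "j' < nb" and i: "i < \<Lambda> * R * S" for j' i
        proof -
          have "64 \<le> cb + j' * N + i" "cb + j' * N + i \<noteq> ob + 2 * j" "cb + j' * N + i \<noteq> ob + 2 * j + 1" using cb64 j by auto
          then have 1: "m' (cb + j' * N + i) = m2 (cb + j' * N + i)" using a by auto
          show ?thesis
          proof (cases "j' = j")
            case True
            then show ?thesis using 1 m2b[of i] i by (simp add: base_def N_def)
          next
            case False
            have "\<not> (base \<le> cb + j' * N + i \<and> cb + j' * N + i < base + N)"
            proof
              assume *: "base \<le> cb + j' * N + i \<and> cb + j' * N + i < base + N"
              have "j' < j \<or> j < j'" using False by auto
              then show False
              proof
                assume "j' < j"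
                then have "Suc j' * N \<le> j * N" by (intro mult_le_mono1) simp
                then show False using * i by (simp add: base_def N_def)
              next
                assume "j < j'"
                then have "Suc j * N \<le> j' * N" by (intro mult_le_mono1) simp
                then show False using * i by (simp add: base_def N_def)
              qed
            qed
            then have "m2 (cb + j' * N + i) = m0 (cb + j' * N + i)" using m2a[of "cb + j' * N + i"] cb64 by auto
            moreover have "counter tab zs E' j' (i div S) (i mod S) = counter tab zs E j' (i div S) (i mod S)"
              using counter_update(1)[OF E b[folded e_def] E'[folded e_def], of tab zs j'] False by (simp add: eh j_def)
            ultimately show ?thesis using 1 cnt0[OF j', of i] i by (simp add: N_def)
          qed
        qed
        have out: "m' (ob + 2 * j') = result tab zs E' j' div n \<and> m' (ob + 2 * j' + 1) = result tab zs E' j' mod n" if j': "j' < nb" for j'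
        proof (cases "j' = j")
          case True
          then show ?thesis using a cb64 by auto
        next
          case False
          have "2 * j \<noteq> 2 * j' + 1" "2 * j + 1 \<noteq> 2 * j'" by presburger+
          then have "m' (ob + 2 * j') = m2 (ob + 2 * j')" "m' (ob + 2 * j' + 1) = m2 (ob + 2 * j' + 1)" using a False cb64 by auto
          moreover have "m2 (ob + 2 * j') = m0 (ob + 2 * j')" "m2 (ob + 2 * j' + 1) = m0 (ob + 2 * j' + 1)"
            using m2a j' cb64 by (auto simp: base_def)
          ultimately show ?thesis
            using out0[OF j'] result_update[OF E b[folded e_def] E'[folded e_def], of tab j' zs] False by (simp add: eh j_def)
        qed
        show "m' (ob + 2 * j') = result tab zs E' j' div n" "m' (ob + 2 * j' + 1) = result tab zs E' j' mod n" if "j' < nb" for j'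
          using out[OF that] by auto
      qed
    qed auto
  qed
  show ?thesis
    unfolding update_prog_def wp_Seq
  proof (rule wp_mono[OF locate], elim conjE)
    fix k m1 p1
    assume k: "k \<le> 200 + 50 * q" and m1: "m1 20 = x" "m1 21 = y" "m1 22 = x * n + y" "m1 26 = h mod nb" "m1 27 = h div nb" "m1 28 = zs (h mod nb)"
      "m1 29 = zs (h mod nb) div nb" "m1 30 = cb + h mod nb * (\<Lambda> * R * S)" "m1 31 = 0" "m1 32 = 1" "\<forall>a. a < 20 \<or> 64 \<le> a \<longrightarrow> m1 a = m a"
      and p1: "p1 = p"
    show "wp w M \<tau> sketch_loop m1 p1 (\<lambda>k1 m' p'. wp w M \<tau> query_prog m' p' (\<lambda>l m' p'. k + (k1 + l) \<le> update_time \<and> state tab zs E' m' \<and> p' = p))"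
      unfolding p1
    proof (rule wp_mono[OF sketch], goal_cases)
      case (12 k1 m2 p2)
      then have m2: "k1 \<le> \<Lambda> * R * (200 + 50 * q) + 10" "\<And>a. 64 \<le> a \<Longrightarrow> m2 a = (if base \<le> a \<and> a < base + N then F (a - base) else m0 a)"
        "\<And>a. a < 64 \<Longrightarrow> a \<notin> {23, 24, 25, 30, 31, 32, 33, 39} \<Longrightarrow> m2 a = m1 a" "p2 = p" by auto
      have "params m2" using par m1 m2(3) by (simp add: params_def)
      then have "wp w M \<tau> query_prog m2 p (\<lambda>k m' p'. k \<le> \<Lambda> * 40 + R * (W * 100 + 110) + 300 \<and> state tab zs E' m' \<and> p' = p)"
        by (intro query) (use m1 m2 in \<open>auto simp: j_def\<close>)
      then show ?case unfolding \<open>p2 = p\<close>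
        by (rule wp_mono) (use k m2(1) in \<open>auto simp: update_time_def\<close>)
    qed (use m1 in \<open>auto simp: j_def base_def\<close>)
  qed
qed

end

section \<open>Initialisation\<close>

text \<open>Rounding sizes up to powers of two lets bucket, cell and column numbers be read off as
  low binary digits of a random word, at the price of a factor below 2.\<close>

definition clog :: "nat \<Rightarrow> nat" where
  "clog x = (LEAST i. x \<le> 2 ^ i)"

lemma clog_le: "x \<le> 2 ^ clog x"
proof -
  have "x \<le> 2 ^ x" by (simp add: less_imp_le)
  then show ?thesis unfolding clog_def by (rule LeastI)
qed

lemma clog_less: "i < clog x \<Longrightarrow> 2 ^ i < x"
  using not_less_Least[of i "\<lambda>i. x \<le> 2 ^ i"] by (auto simp: clog_def)

text \<open>The first bit read is the most significant one, as produced by doubling an accumulator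
  and adding the next bit.\<close>

primrec word :: "(nat \<Rightarrow> bool) \<Rightarrow> nat \<Rightarrow> nat \<Rightarrow> nat" where
  "word \<rho> i 0 = 0"
| "word \<rho> i (Suc b) = 2 * word \<rho> i b + of_bool (\<rho> (i + b))"

lemma word_less: "word \<rho> i b < 2 ^ b"
  by (induction b) (auto simp: of_bool_def)

definition "pow_prog a c k =
  Seq (asg a (Const 1))
 (Seq (asg c (Const 0))
 (While (lt (V a) (V k)) (Seq (asg a (mul (V a) (Const 2))) (asg c (add (V c) (Const 1))))))"

definition "flip_loop r =
  While (lt (V 32) (V 18))
   (Seq (Flip r (Const 33))
   (Seq (asg 31 (add (mul (V 31) (Const 2)) (V 33)))
        (asg 32 (add (V 32) (Const 1)))))"

definition "fill_loop r k =
  While (lt (V 30) (V k))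
   (Seq (asg 31 (Const 0))
   (Seq (asg 32 (Const 0))
   (Seq (flip_loop r)
   (Seq (Store (V 30) (V 31))
        (asg 30 (add (V 30) (Const 1)))))))"

definition "size_prog D C \<kappa> =
  Seq (asg 18 (mul (Const \<kappa>) (V 7)))
 (Seq (asg 9 (mul (Const D) (V 7)))
 (Seq (asg 8 (mul (Const 2) (V 9)))
 (Seq (asg 10 (mul (Const C) (V 7)))
      (asg 22 (mul (Const 32) (mul (V 10) (V 10)))))))"

definition "address_prog =
  Seq (asg 12 (add (mul (Const 2) (V 11)) (Const 1)))
 (Seq (asg 19 (mul (add (V 9) (Const 1)) (V 8)))
 (Seq (asg 13 (mul (V 19) (V 0)))
 (Seq (asg 14 (mul (add (mul (Const 2) (V 7)) (Const 1)) (V 9)))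
 (Seq (asg 16 (add (Const 64) (mul (V 19) (V 13))))
 (Seq (asg 5 (add (V 16) (V 6)))
 (Seq (asg 17 (add (V 5) (mul (Const 2) (V 6))))
      (asg 30 (Const 64))))))))"

text \<open>\<open>D\<close>, \<open>C\<close> and \<open>\<kappa>\<close> are literals of the
  program because they are independent of \<open>n\<close> and \<open>s\<close>; everything that
  depends on the input is computed at run time.\<close>

definition "init_prog D C \<kappa> =
  Seq (pow_prog 20 7 0)
 (Seq (size_prog D C \<kappa>)
 (Seq (pow_prog 11 21 22)
 (Seq (pow_prog 6 21 1)
 (Seq address_prog
 (Seq (fill_loop Setup 16) (fill_loop Sampling 5))))))"

text \<open>With \<open>l\<close> about \<open>log 2 n\<close>: \<open>\<Lambda> = 2 * l + 1\<close>
  gives \<open>n\<^sup>2 \<le> 2 ^ \<Lambda>\<close>; \<open>W \<ge> (4 * L)\<^sup>2\<close> makes a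
  row separate a cell of at most \<open>4 * L\<close> edges with probability at least one half;
  \<open>q = 2 * R\<close> is the order of the moment bound, so that unbalance and failure of all
  \<open>R\<close> rows both have probability exponentially small in \<open>R\<close>.\<close>

locale sizes = layout +
  fixes l D C \<kappa> :: nat
  assumes w_def: "w = \<kappa> * l" and R_def: "R = D * l" and q_def: "q = 2 * R" and L_def: "L = C * l"
    and W_def: "W = 2 ^ clog (32 * (L * L))" and Lam_def: "\<Lambda> = 2 * l + 1" and nb_def: "nb = 2 ^ clog s"
    and l_def: "l = clog n"
    and const_w: "\<kappa> < 2 ^ w" "D < 2 ^ w" "C < 2 ^ w"
begin

lemma wp_pow:
  assumes m: "m k = x" and k: "k < 64" "a < 64" "c < 64" "k \<noteq> a" "k \<noteq> c" "a \<noteq> c" and x: "2 ^ clog x < (2 ^ w :: nat)"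
  shows "wp w M \<tau> (pow_prog a c k) m p (\<lambda>k m' p'. m' = m(a := 2 ^ clog x, c := clog x) \<and> p' = p)"
proof -
  have kc: "k mod 2 ^ w = k" "a mod 2 ^ w = a" "c mod 2 ^ w = c" using k two_w by auto
  have kM: "a < M" "c < M" using M_ge k by auto
  have "wp w M \<tau> (While (lt (V a) (V k)) (Seq (asg a (mul (V a) (Const 2))) (asg c (add (V c) (Const 1)))))
    (m(a := 1, c := 0)) p (\<lambda>k m' p'. m' = m(a := 2 ^ clog x, c := clog x) \<and> p' = p)"
  proof (rule wp_While[where N = "clog x" and B = 20 and I = "\<lambda>i m' p'. m' = m(a := 2 ^ i, c := i) \<and> p' = p"])
    fix i m' p' assume i: "i < clog x" and I: "m' = m(a := 2 ^ i, c := i) \<and> p' = p"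
    have 1: "(2::nat) ^ i * 2 \<le> 2 ^ clog x" using power_increasing[of "Suc i" "clog x" "2::nat"] i by simp
    have 2: "i < (2::nat) ^ i" by simp
    have b: "(2::nat) ^ i * 2 < 2 ^ w" "Suc i < 2 ^ w" using 1 2 x by linarith+
    show "expr_val w m' (lt (V a) (V k)) \<noteq> 0 \<and> wp w M \<tau> (Seq (asg a (mul (V a) (Const 2))) (asg c (add (V c) (Const 1)))) m' p'
       (\<lambda>k m' p'. k \<le> 20 \<and> m' = m(a := 2 ^ Suc i, c := Suc i) \<and> p' = p)"
      using clog_less[OF i] b I k m by (simp add: kc kM fun_upd_twist fun_eq_iff)
  next
    fix m' p' assume "m' = m(a := 2 ^ clog x, c := clog x) \<and> p' = p"
    then show "expr_val w m' (lt (V a) (V k)) = 0" using clog_le[of x] k m by (simp add: kc)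
  qed auto
  then show ?thesis unfolding pow_prog_def using k by (simp add: kc kM)
qed

lemma wp_flip:
  assumes m: "m 31 = 0" "m 32 = 0" "m 18 = w"
  shows "wp w M \<tau> (flip_loop r) m p (\<lambda>k m' p'. k \<le> w * 40 + 10 \<and> m' 31 = word (\<tau> r) (p r) w \<and>
     (\<forall>a. a \<notin> {31, 32, 33} \<longrightarrow> m' a = m a) \<and> p' = p(r := p r + w))"
  unfolding flip_loop_def
proof (rule wp_While[where N = w and B = 25 and I = "\<lambda>b m' p'. m' 32 = b \<and> m' 31 = word (\<tau> r) (p r) b \<and>
     (\<forall>a. a \<notin> {31, 32, 33} \<longrightarrow> m' a = m a) \<and> p' = p(r := p r + b)"])
  fix b m' p' assume b: "b < w" and I: "m' 32 = b \<and> m' 31 = word (\<tau> r) (p r) b \<and>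
     (\<forall>a. a \<notin> {31, 32, 33} \<longrightarrow> m' a = m a) \<and> p' = p(r := p r + b)"
  have "word (\<tau> r) (p r) (Suc b) < 2 ^ Suc b" by (rule word_less)
  also have "(2::nat) ^ Suc b \<le> 2 ^ w" using b by (intro power_increasing) auto
  finally have 1: "2 * word (\<tau> r) (p r) b + of_bool (\<tau> r (p r + b)) < 2 ^ w" by simp
  then have 2: "2 * word (\<tau> r) (p r) b < 2 ^ w" by linarith
  have "w < 2 ^ w" by simp
  then have 3: "Suc b < 2 ^ w" using b by linarith
  have w1: "(1::nat) < 2 ^ w" using two_w by linarith
  show "expr_val w m' (lt (V 32) (V 18)) \<noteq> 0 \<and> wp w M \<tau> (Seq (Flip r (Const 33))
   (Seq (asg 31 (add (mul (V 31) (Const 2)) (V 33)))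
        (asg 32 (add (V 32) (Const 1))))) m' p' (\<lambda>k m' p'. k \<le> 25 \<and> m' 32 = Suc b \<and> m' 31 = word (\<tau> r) (p r) (Suc b) \<and>
     (\<forall>a. a \<notin> {31, 32, 33} \<longrightarrow> m' a = m a) \<and> p' = p(r := p r + Suc b))"
    using I m b 1 2 3 w1 by (cases "\<tau> r (p r + b)") (simp_all add: mult.commute)
qed (use m in auto)

lemma wp_fill:
  assumes m: "m 30 = a0" "m k = a0 + c" "m 18 = w" and k: "k < 30" and a0: "64 \<le> a0" "a0 + c \<le> top"
  shows "wp w M \<tau> (fill_loop r k) m p (\<lambda>_ m' p'. m' 30 = a0 + c \<and>
     (\<forall>a. a \<notin> {30, 31, 32, 33} \<longrightarrow> m' a = (if a0 \<le> a \<and> a < a0 + c then word (\<tau> r) (p r + (a - a0) * w) w else m a)) \<and>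
     p' = p(r := p r + c * w))"
  unfolding fill_loop_def
proof (rule wp_While[where N = c and B = "w * 40 + 50" and I = "\<lambda>i m' p'. m' 30 = a0 + i \<and>
     (\<forall>a. a \<notin> {30, 31, 32, 33} \<longrightarrow> m' a = (if a0 \<le> a \<and> a < a0 + i then word (\<tau> r) (p r + (a - a0) * w) w else m a)) \<and>
     p' = p(r := p r + i * w)"])
  fix i m' p' assume i: "i < c" and I: "m' 30 = a0 + i \<and>
     (\<forall>a. a \<notin> {30, 31, 32, 33} \<longrightarrow> m' a = (if a0 \<le> a \<and> a < a0 + i then word (\<tau> r) (p r + (a - a0) * w) w else m a)) \<and>
     p' = p(r := p r + i * w)"
  have kk: "k mod 2 ^ w = k" using k two_w by auto
  have ad: "a0 + i < M" "Suc (a0 + i) < 2 ^ w" using i a0 top_M top_w by linarith+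
  have fr: "m' a = (if a0 \<le> a \<and> a < a0 + i then word (\<tau> r) (p r + (a - a0) * w) w else m a)" if "a \<notin> {30, 31, 32, 33}" for a
    using I that by blast
  have mm: "m' k = a0 + c" "m' 18 = w" "m' 30 = a0 + i" "p' r = p r + i * w" using fr[of k] fr[of 18] I m k a0 by auto
  define m1 where "m1 = m'(31 := 0, 32 := 0)"
  have fl: "wp w M \<tau> (flip_loop r) m1 p' (\<lambda>k m2 p2. k \<le> w * 40 + 10 \<and> m2 31 = word (\<tau> r) (p' r) w \<and>
     (\<forall>a. a \<notin> {31, 32, 33} \<longrightarrow> m2 a = m1 a) \<and> p2 = p'(r := p' r + w))"
    by (rule wp_flip) (auto simp: m1_def mm)
  have "wp w M \<tau> (flip_loop r) m1 p' (\<lambda>k m2 p2. wp w M \<tau> (Seq (Store (V 30) (V 31)) (asg 30 (add (V 30) (Const 1)))) m2 p2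
    (\<lambda>j m' p'. k + j \<le> w * 40 + 40 \<and> m' 30 = a0 + Suc i \<and>
     (\<forall>a. a \<notin> {30, 31, 32, 33} \<longrightarrow> m' a = (if a0 \<le> a \<and> a < a0 + Suc i then word (\<tau> r) (p r + (a - a0) * w) w else m a)) \<and>
     p' = p(r := p r + Suc i * w)))"
  proof (rule wp_mono[OF fl], elim conjE)
    fix j m2 p2
    assume j: "j \<le> w * 40 + 10" and m2: "m2 31 = word (\<tau> r) (p' r) w" "\<forall>a. a \<notin> {31, 32, 33} \<longrightarrow> m2 a = m1 a"
      and p2: "p2 = p'(r := p' r + w)"
    have 30: "m2 30 = a0 + i" using m2 by (simp add: m1_def mm)
    have fr2: "m2 a = (if a0 \<le> a \<and> a < a0 + i then word (\<tau> r) (p r + (a - a0) * w) w else m a)" if "a \<notin> {30, 31, 32, 33}" for a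
      using m2 fr[OF that] that by (auto simp: m1_def)
    have pe: "p2 = p(r := p r + Suc i * w)" using I by (simp add: p2 algebra_simps)
    have "a0 + i \<noteq> 30" "a0 + i \<noteq> 31" using a0 by auto
    then show "wp w M \<tau> (Seq (Store (V 30) (V 31)) (asg 30 (add (V 30) (Const 1)))) m2 p2
    (\<lambda>l m' p'. j + l \<le> w * 40 + 40 \<and> m' 30 = a0 + Suc i \<and>
     (\<forall>a. a \<notin> {30, 31, 32, 33} \<longrightarrow> m' a = (if a0 \<le> a \<and> a < a0 + Suc i then word (\<tau> r) (p r + (a - a0) * w) w else m a)) \<and>
     p' = p(r := p r + Suc i * w))"
      using j ad a0 by (auto simp: 30 m2(1) mm fr2 pe)
  qed
  note fl2 = this
  show "expr_val w m' (lt (V 30) (V k)) \<noteq> 0 \<and> wp w M \<tau> (Seq (asg 31 (Const 0))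
   (Seq (asg 32 (Const 0))
   (Seq (flip_loop r)
   (Seq (Store (V 30) (V 31))
        (asg 30 (add (V 30) (Const 1))))))) m' p' (\<lambda>j m' p'. j \<le> w * 40 + 50 \<and> m' 30 = a0 + Suc i \<and>
     (\<forall>a. a \<notin> {30, 31, 32, 33} \<longrightarrow> m' a = (if a0 \<le> a \<and> a < a0 + Suc i then word (\<tau> r) (p r + (a - a0) * w) w else m a)) \<and>
     p' = p(r := p r + Suc i * w))"
  proof
    show "expr_val w m' (lt (V 30) (V k)) \<noteq> 0" using i by (simp add: kk mm)
    show "wp w M \<tau> (Seq (asg 31 (Const 0))
   (Seq (asg 32 (Const 0))
   (Seq (flip_loop r)
   (Seq (Store (V 30) (V 31))
        (asg 30 (add (V 30) (Const 1))))))) m' p' (\<lambda>j m' p'. j \<le> w * 40 + 50 \<and> m' 30 = a0 + Suc i \<and>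
     (\<forall>a. a \<notin> {30, 31, 32, 33} \<longrightarrow> m' a = (if a0 \<le> a \<and> a < a0 + Suc i then word (\<tau> r) (p r + (a - a0) * w) w else m a)) \<and>
     p' = p(r := p r + Suc i * w))"
      apply (simp del: wp_Seq add: wp_Seq[of _ _ _ "asg 31 _"] wp_Seq[of _ _ _ "asg 32 _"] wp_Seq[of _ _ _ "flip_loop _"])
      apply (rule wp_mono[OF fl2[unfolded m1_def]])
      apply (simp del: wp_Seq)
      apply (erule wp_mono)
      apply auto
      done
  qed
next
  fix m' p' assume I: "m' 30 = a0 + c \<and>
     (\<forall>a. a \<notin> {30, 31, 32, 33} \<longrightarrow> m' a = (if a0 \<le> a \<and> a < a0 + c then word (\<tau> r) (p r + (a - a0) * w) w else m a)) \<and>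
     p' = p(r := p r + c * w)"
  have kk: "k mod 2 ^ w = k" using k two_w by auto
  have "m' k = a0 + c" using I m k a0 by auto
  then show "expr_val w m' (lt (V 30) (V k)) = 0" using I by (simp add: kk)
qed (use m in auto)

text \<open>An empty row counts as usable and yields 0. The counters and the output belonging to the
  empty graph are therefore all 0, and initialisation leaves that part of the memory
  untouched.\<close>

lemma rows_zero: "rows W (\<lambda>_ _. 0) v k = 0"
proof -
  have "scan (\<lambda>_. 0) u c = (0, 0)" for u c by (induction c) auto
  then show ?thesis by (induction k) auto
qed

text \<open>The time bound concerns updates only, so the postcondition forgets the step count and
  keeps the invariant for the empty graph.\<close>

lemma wp_init:
  "wp w M \<tau> (init_prog D C \<kappa>) (mem (initial n s)) (pos (initial n s))
    (\<lambda>k m p. state (\<lambda>i. word (\<tau> Setup) (i * w) w) (\<lambda>j. word (\<tau> Sampling) (j * w) w) {} m)"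
proof -
  define m0 where "m0 = (\<lambda>_ :: nat. 0 :: nat)(0 := n, 1 := s)"
  have top_ge: "zb \<le> top" "ob \<le> top" "cb \<le> top" "64 \<le> zb" "zb = 64 + G * P" "ob = zb + nb"
    by (simp_all add: top_def cb_def ob_def zb_def)
  have l1: "2 ^ clog n < (2 ^ w :: nat)"
  proof -
    have "(2::nat) ^ l \<le> 2 ^ \<Lambda>" by (rule power_increasing) (auto simp: Lam_def)
    then show ?thesis using Lam_w by (simp add: l_def)
  qed
  have "l > 0" using pos by (cases l) (auto simp: L_def)
  have RG: "(R + 1) * q < 2 ^ w" "2 * R < 2 ^ w" "R < 2 ^ w" "R + 1 < 2 ^ w" "G * n < 2 ^ w" "G * P < 2 ^ w"
  proof -
    have G1: "G > 0" using pos by (simp add: G_def)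
    then have 1: "P \<le> G * P" by simp
    have 2: "G \<le> P" using n_ge by (simp add: P_def)
    have 3: "R + 1 \<le> G" unfolding G_def using mult_le_mono2[of 1 q "R + 1"] pos by simp
    have 4: "2 * R \<le> G" unfolding G_def q_def by simp
    have 5: "64 + G * P < 2 ^ w" using top_ge top_w by linarith
    show "(R + 1) * q < 2 ^ w" "2 * R < 2 ^ w" "R < 2 ^ w" "R + 1 < 2 ^ w" "G * n < 2 ^ w" "G * P < 2 ^ w"
      using 1 2 3 4 5 unfolding G_def[symmetric] P_def[symmetric] by linarith+
  qed
  have LR: "\<Lambda> * R < 2 ^ w" "S < 2 ^ w" "\<Lambda> < 2 ^ w" "nb < 2 ^ w" "W < 2 ^ w" "2 * W < 2 ^ w" "2 * nb < 2 ^ w" "2 * l < 2 ^ w"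
  proof -
    have S1: "S > 0" by (simp add: S_def)
    have "\<Lambda> * R * 1 \<le> \<Lambda> * R * S" using S1 by (intro mult_le_mono2) simp
    then show "\<Lambda> * R < 2 ^ w" using small(2) by linarith
    have "1 * S \<le> R * S" using pos by (intro mult_le_mono1) simp
    then have "S < 2 ^ w" using small(4) by linarith
    have "\<Lambda> * 1 \<le> \<Lambda> * R" using pos by (intro mult_le_mono2) simp
    then have "\<Lambda> < 2 ^ w" using \<open>\<Lambda> * R < 2 ^ w\<close> by linarith
    show "nb < 2 ^ w" by (rule small(3))
    show "S < 2 ^ w" "\<Lambda> < 2 ^ w" by fact+
    then show "W < 2 ^ w" "2 * W < 2 ^ w" "2 * l < 2 ^ w" unfolding S_def Lam_def by linarith+
    show "2 * nb < 2 ^ w" using top_ge top_w unfolding cb_def by linarith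
  qed
  have Lw: "32 * (L * L) < 2 ^ w" using clog_le[of "32 * (L * L)"] LR by (simp add: W_def)
  then have L2: "L * L < 2 ^ w" "L < 2 ^ w" using le_square[of L] by linarith+
  have ww: "w < 2 ^ w" by simp
  define m1 where "m1 = m0(20 := 2 ^ l, 7 := l)"
  define m2 where "m2 = m1(18 := w, 9 := R, 8 := q, 10 := L, 22 := 32 * (L * L))"
  define m3 where "m3 = m2(11 := W, 21 := clog (32 * (L * L)))"
  define m4 where "m4 = m3(6 := nb, 21 := clog s)"
  define m5 where "m5 = m4(12 := S, 19 := G, 13 := P, 14 := \<Lambda> * R, 16 := zb, 5 := ob, 17 := cb, 30 := 64)"
  have s1: "wp w M \<tau> (pow_prog 20 7 0) m0 p (\<lambda>k m' p'. m' = m1 \<and> p' = p)" for p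
    using wp_pow[of m0 0 n 20 7 \<tau> p] l1 by (simp add: m0_def m1_def l_def)
  have s2: "wp w M \<tau> (size_prog D C \<kappa>) m1 p (\<lambda>k m' p'. m' = m2 \<and> p' = p)" for p
    using const_w L2 Lw RG ww by (simp add: size_prog_def m1_def m2_def w_def[symmetric] R_def[symmetric] L_def[symmetric] q_def)
  have s3: "wp w M \<tau> (pow_prog 11 21 22) m2 p (\<lambda>k m' p'. m' = m3 \<and> p' = p)" for p
    using wp_pow[of m2 22 "32 * (L * L)" 11 21 \<tau> p] LR by (simp add: m2_def m3_def W_def)
  have s4: "wp w M \<tau> (pow_prog 6 21 1) m3 p (\<lambda>k m' p'. m' = m4 \<and> p' = p)" for p
    using wp_pow[of m3 1 s 6 21 \<tau> p] LR by (simp add: m0_def m1_def m2_def m3_def m4_def nb_def)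
  have s5: "wp w M \<tau> address_prog m4 p (\<lambda>k m' p'. m' = m5 \<and> p' = p)" for p
  proof -
    have "m4 0 = n" "m4 7 = l" "m4 9 = R" "m4 8 = q" "m4 11 = W" "m4 6 = nb" by (simp_all add: m0_def m1_def m2_def m3_def m4_def)
    note m4s = this
    have b: "zb < 2 ^ w" "ob < 2 ^ w" "cb < 2 ^ w" using top_ge top_w by linarith+
    have ev: "2 * W mod 2 ^ w = 2 * W" "Suc (2 * W) mod 2 ^ w = S" "Suc R mod 2 ^ w = Suc R" "Suc R * q mod 2 ^ w = G"
      "G * n mod 2 ^ w = P" "2 * l mod 2 ^ w = 2 * l" "Suc (2 * l) mod 2 ^ w = \<Lambda>" "\<Lambda> * R mod 2 ^ w = \<Lambda> * R"
      "G * P mod 2 ^ w = G * P" "(64 + G * P) mod 2 ^ w = zb" "(zb + nb) mod 2 ^ w = ob" "2 * nb mod 2 ^ w = 2 * nb"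
      "(ob + 2 * nb) mod 2 ^ w = cb"
      using LR RG b by (simp_all add: S_def G_def P_def Lam_def zb_def ob_def cb_def del: mult_Suc)
    show ?thesis
      by (simp add: address_prog_def m5_def m4s ev del: mult_Suc)
  qed
  have s6: "wp w M \<tau> (fill_loop Setup 16) m5 (\<lambda>_. 0) (\<lambda>_ m' p'. m' 30 = zb \<and>
     (\<forall>a. a \<notin> {30, 31, 32, 33} \<longrightarrow> m' a = (if 64 \<le> a \<and> a < zb then word (\<tau> Setup) ((a - 64) * w) w else m5 a)) \<and>
     p' = (\<lambda>_. 0)(Setup := G * P * w))"
  proof -
    have m5v: "m5 30 = 64" "m5 16 = 64 + G * P" "m5 18 = w" by (simp_all add: m5_def m4_def m3_def m2_def zb_def)
    show ?thesis
      by (rule wp_mono[OF wp_fill[OF m5v]]) (use top_ge in auto)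
  qed
  have s7: "wp w M \<tau> (fill_loop Sampling 5) m6 p6 (\<lambda>_ m' p'. 
     (\<forall>a. a \<notin> {30, 31, 32, 33} \<longrightarrow> m' a = (if zb \<le> a \<and> a < ob then word (\<tau> Sampling) ((a - zb) * w) w
         else if 64 \<le> a \<and> a < zb then word (\<tau> Setup) ((a - 64) * w) w else m5 a)))"
    if m6: "m6 30 = zb" "\<forall>a. a \<notin> {30, 31, 32, 33} \<longrightarrow> m6 a = (if 64 \<le> a \<and> a < zb then word (\<tau> Setup) ((a - 64) * w) w else m5 a)"
      and p6: "p6 = (\<lambda>_. 0)(Setup := G * P * w)" for m6 p6
  proof -
    have "m6 5 = zb + nb" "m6 18 = w" using m6(2) top_ge by (simp_all add: m5_def m4_def m3_def m2_def)
    from wp_fill[OF m6(1) this, of \<tau> Sampling p6] show ?thesis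
      by (rule wp_mono) (use top_ge m6 p6 in auto)
  qed
  have fin: "state (\<lambda>i. word (\<tau> Setup) (i * w) w) (\<lambda>j. word (\<tau> Sampling) (j * w) w) {} m'"
    if m': "\<forall>a. a \<notin> {30, 31, 32, 33} \<longrightarrow> m' a = (if zb \<le> a \<and> a < ob then word (\<tau> Sampling) ((a - zb) * w) w
         else if 64 \<le> a \<and> a < zb then word (\<tau> Setup) ((a - 64) * w) w else m5 a)" for m'
  proof -
    have m5z: "m5 a = 0" if "64 \<le> a" for a using that by (simp add: m5_def m4_def m3_def m2_def m1_def m0_def)
    have c0: "counter tab zs {} j r i = 0" for tab zs j r i by (simp add: counter_def bucket_def)
    have "counter tab zs {} j r = (\<lambda>_. 0)" for tab zs j r by (simp add: c0 fun_eq_iff)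
    then have r0: "result tab zs {} j = 0" for tab zs j by (simp add: result_def rows_zero Let_def)
    have hi: "m' a = 0" if "ob \<le> a" for a using m' m5z[of a] that top_ge by auto
    show ?thesis
      unfolding state_def
    proof (intro conjI allI impI)
      show "params m'" using m' top_ge unfolding params_def by (simp add: m5_def m4_def m3_def m2_def m1_def m0_def)
      show "m' a < 2 ^ w" if "64 \<le> a" for a using m' m5z[OF that] that word_less by auto
      show "m' (64 + k) = word (\<tau> Setup) (k * w) w" if "k < G * P" for k using m' that top_ge by auto
      show "m' (zb + j) = word (\<tau> Sampling) (j * w) w" if "j < nb" for j using m' that top_ge by auto
      show "m' (cb + j * (\<Lambda> * R * S) + i) = counter (\<lambda>i. word (\<tau> Setup) (i * w) w) (\<lambda>j. word (\<tau> Sampling) (j * w) w) {} j (i div S) (i mod S)" for i j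
        using hi[of "cb + j * (\<Lambda> * R * S) + i"] c0 by (simp add: cb_def)
      show "m' (ob + 2 * j) = result (\<lambda>i. word (\<tau> Setup) (i * w) w) (\<lambda>j. word (\<tau> Sampling) (j * w) w) {} j div n" for j
        using hi[of "ob + 2 * j"] r0 by simp
      show "m' (ob + 2 * j + 1) = result (\<lambda>i. word (\<tau> Setup) (i * w) w) (\<lambda>j. word (\<tau> Sampling) (j * w) w) {} j mod n" for j
        using hi[of "ob + 2 * j + 1"] r0 by simp
    qed
  qed
  have init: "mem (initial n s) = m0" "pos (initial n s) = (\<lambda>_. 0)" by (simp_all add: initial_def m0_def)
  show ?thesis
    unfolding init_prog_def wp_Seq init
    apply (rule wp_mono[OF s1], elim conjE, hypsubst)
    apply (rule wp_mono[OF s2], elim conjE, hypsubst)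
    apply (rule wp_mono[OF s3], elim conjE, hypsubst)
    apply (rule wp_mono[OF s4], elim conjE, hypsubst)
    apply (rule wp_mono[OF s5], elim conjE, hypsubst)
    apply (rule wp_mono[OF s6], elim conjE)
    apply (rule wp_mono[OF s7], assumption, assumption, assumption)
    apply (rule fin, assumption)
    done
qed

end

context layout
begin

section \<open>The maintained sample\<close>

definition cell :: "(nat \<Rightarrow> nat) \<Rightarrow> nat set set \<Rightarrow> nat \<Rightarrow> nat \<Rightarrow> nat \<Rightarrow> nat set set" where
  "cell tab E j l r = {e\<in>bucket tab E j. (ehash tab 0 e div nb) mod 2 ^ l = r}"

definition column :: "(nat \<Rightarrow> nat) \<Rightarrow> nat \<Rightarrow> nat set \<Rightarrow> nat" where
  "column tab i e = ehash tab (Suc i) e mod W"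

definition sampled :: "(nat \<Rightarrow> nat) \<Rightarrow> (nat \<Rightarrow> nat) \<Rightarrow> nat set set \<Rightarrow> nat set set" where
  "sampled tab zs E = {e\<in>E. result tab zs E (ehash tab 0 e mod nb) = eid e}"

lemma eid_inj: "edge e \<Longrightarrow> edge e' \<Longrightarrow> eid e = eid e' \<Longrightarrow> e = e'"
  using edgeD(3,7,8)[of e] edgeD(3,7,8)[of e'] by metis

text \<open>Row \<open>l * R + i\<close> compares exactly \<open>l\<close> digits with the sampling
  word, so its counters describe the cell of that word at level \<open>l\<close> as hashed by
  repetition \<open>i\<close>.\<close>

lemma counter_cell:
  assumes E: "\<forall>e\<in>E. edge e" and i: "i < R" and c: "c < W"
    and C: "C = cell tab E j l ((zs j div nb) mod 2 ^ l)"
  shows "counter tab zs E j (l * R + i) 0 = card C"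
    "counter tab zs E j (l * R + i) (1 + 2 * c) = card {e\<in>C. column tab i e = c}"
    "counter tab zs E j (l * R + i) (2 + 2 * c) = (\<Sum>e | e \<in> C \<and> column tab i e = c. eid e)"
proof -
  have fin: "finite (bucket tab E j)" using edges_card(1)[OF E] by (simp add: bucket_def)
  have d: "(l * R + i) div R = l" "(l * R + i) mod R = i" using i by auto
  have par: "1 + 2 * c \<noteq> 2 + 2 * c'" "2 + 2 * c \<noteq> 1 + 2 * c'" for c' by presburger+
  have w0: "weight tab (ehash tab 0 e div nb) (zs j div nb) (Min e) (Max e) (l * R + i) 0 = of_bool (e \<in> C)" if "e \<in> bucket tab E j" for e
    using that d by (simp add: weight_def C cell_def)
  have w1: "weight tab (ehash tab 0 e div nb) (zs j div nb) (Min e) (Max e) (l * R + i) (1 + 2 * c) = of_bool (e \<in> C \<and> column tab i e = c)" if "e \<in> bucket tab E j" for e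
    using that d by (auto simp: weight_def C cell_def column_def ehash_def)
  have w2: "weight tab (ehash tab 0 e div nb) (zs j div nb) (Min e) (Max e) (l * R + i) (2 + 2 * c) = (if e \<in> C \<and> column tab i e = c then eid e else 0)" if "e \<in> bucket tab E j" for e
    using that d par(2) by (auto simp: weight_def C cell_def column_def ehash_def eid_def)
  have CB: "C \<subseteq> bucket tab E j" by (auto simp: C cell_def)
  show "counter tab zs E j (l * R + i) 0 = card C"
  proof -
    have "bucket tab E j \<inter> C = C" using CB by auto
    then show ?thesis unfolding counter_def using w0 fin by simp
  qed
  have *: "bucket tab E j \<inter> {e. e \<in> C \<and> column tab i e = c} = {e\<in>C. column tab i e = c}" using CB by auto
  show "counter tab zs E j (l * R + i) (1 + 2 * c) = card {e\<in>C. column tab i e = c}"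
    unfolding counter_def using w1 fin * by (simp add: sum.If_cases of_bool_def del: of_bool_eq_iff)
  show "counter tab zs E j (l * R + i) (2 + 2 * c) = (\<Sum>e | e \<in> C \<and> column tab i e = c. eid e)"
    unfolding counter_def using w2 fin * by (simp add: sum.If_cases)
qed

text \<open>One function \<open>g\<close> serves all ranks \<open>k\<close>: scans for different
  ranks visit the same columns with a single edge and differ only in which of their codes is kept.
  Thus \<open>g\<close> lists these codes without repetition, and ranks from \<open>r\<close> on
  find nothing.\<close>

lemma scan_spec:
  assumes C: "\<forall>e\<in>C. edge e" and finC: "finite C"
    and f1: "\<And>c. c < W \<Longrightarrow> f (1 + 2 * c) = card {e\<in>C. col e = c}"
    and f2: "\<And>c. c < W \<Longrightarrow> f (2 + 2 * c) = (\<Sum>e | e \<in> C \<and> col e = c. eid e)"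
    and c: "c \<le> W"
  shows "\<exists>r g. (\<forall>k. scan f k c = (g k, r)) \<and> r = card {b. b < c \<and> card {e\<in>C. col e = b} = 1} \<and> (\<forall>k\<ge>r. g k = 0) \<and>
    inj_on g {..<r} \<and> g ` {..<r} \<subseteq> eid ` {e\<in>C. col e < c}"
  using c
proof (induction c)
  case 0
  then show ?case by auto
next
  case (Suc c)
  then obtain r g where IH: "\<forall>k. scan f k c = (g k, r)" "r = card {b. b < c \<and> card {e\<in>C. col e = b} = 1}" "\<forall>k\<ge>r. g k = 0"
    "inj_on g {..<r}" "g ` {..<r} \<subseteq> eid ` {e\<in>C. col e < c}" by auto
  have cW: "c < W" using Suc by simp
  show ?case
  proof (cases "card {e\<in>C. col e = c} = 1")
    case False
    then have "scan f k (Suc c) = (g k, r)" for k using IH(1) f1[OF cW] by simp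
    moreover have "{b. b < Suc c \<and> card {e\<in>C. col e = b} = 1} = {b. b < c \<and> card {e\<in>C. col e = b} = 1}"
      using False less_Suc_eq by auto
    moreover have "g ` {..<r} \<subseteq> eid ` {e\<in>C. col e < Suc c}" using IH(5) by fastforce
    ultimately show ?thesis using IH by (intro exI[of _ r] exI[of _ g]) auto
  next
    case True
    \<comment> \<open>If a column contains a single edge, the sum of codes stored there is the code
      of that edge.\<close>
    then obtain e where e: "{e\<in>C. col e = c} = {e}" by (auto simp: card_1_singleton_iff)
    define g' where "g' = g(r := eid e)"
    have "scan f k (Suc c) = (g' k, Suc r)" for k
      using IH(1) f1[OF cW] f2[OF cW] True e by (simp only: scan.simps) (auto simp: g'_def)
    moreover have "Suc r = card {b. b < Suc c \<and> card {e\<in>C. col e = b} = 1}"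
    proof -
      have "{b. b < Suc c \<and> card {e\<in>C. col e = b} = 1} = insert c {b. b < c \<and> card {e\<in>C. col e = b} = 1}"
        using True less_Suc_eq by auto
      then show ?thesis using IH(2) by simp
    qed
    moreover have "\<forall>k\<ge>Suc r. g' k = 0" using IH(3) by (auto simp: g'_def)
    moreover have eC: "e \<in> C" "col e = c" using e by auto
    have ne: "eid e \<notin> g ` {..<r}"
    proof
      assume "eid e \<in> g ` {..<r}"
      then obtain e' where "e' \<in> C" "col e' < c" "eid e = eid e'" using IH(5) by auto
      then show False using eid_inj C eC by blast
    qed
    have "inj_on g' {..<Suc r}"
    proof (rule inj_onI)
      fix a b assume ab: "a \<in> {..<Suc r}" "b \<in> {..<Suc r}" "g' a = g' b"
      have *: "g x \<noteq> eid e" if "x < r" for x using ne that by (metis imageI lessThan_iff)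
      show "a = b"
        using ab IH(4) *[of a] *[of b] by (auto simp: g'_def inj_on_def less_Suc_eq split: if_splits)
    qed
    moreover have "g' ` {..<Suc r} \<subseteq> eid ` {e\<in>C. col e < Suc c}"
    proof
      fix a assume "a \<in> g' ` {..<Suc r}"
      then have "a = eid e \<or> a \<in> g ` {..<r}" by (auto simp: g'_def lessThan_Suc split: if_splits)
      then show "a \<in> eid ` {e\<in>C. col e < Suc c}" using eC IH(5) by fastforce
    qed
    ultimately show ?thesis by blast
  qed
qed

lemma singles_card:
  assumes "finite C" "\<And>e. e \<in> C \<Longrightarrow> col e < W" "inj_on col C"
  shows "card {b. b < W \<and> card {e\<in>C. col e = b} = 1} = card C"
proof -
  have "{b. b < W \<and> card {e\<in>C. col e = b} = 1} = col ` C"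
  proof (intro set_eqI iffI)
    fix b assume "b \<in> {b. b < W \<and> card {e\<in>C. col e = b} = 1}"
    then have "card {e\<in>C. col e = b} = 1" by simp
    then have "{e\<in>C. col e = b} \<noteq> {}" by (metis card.empty zero_neq_one)
    then show "b \<in> col ` C" by auto
  next
    fix b assume "b \<in> col ` C"
    then obtain e where e: "e \<in> C" "b = col e" by auto
    then have "{e'\<in>C. col e' = b} = {e}" using assms(3) by (auto simp: inj_on_def)
    then show "b \<in> {b. b < W \<and> card {e\<in>C. col e = b} = 1}" using e assms(2) by simp
  qed
  then show ?thesis using card_image[OF assms(3)] by simp
qed

text \<open>A code is read only from a column whose count is 1, so it is genuine even if the hash
  functions are bad. This is why the sample is contained in the edge set for all random
  bits.\<close>

lemma rows_sound:
  assumes C: "\<forall>e\<in>C. edge e" and finC: "finite C"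
    and f1: "\<And>i c. i < K \<Longrightarrow> c < W \<Longrightarrow> f i (1 + 2 * c) = card {e\<in>C. col i e = c}"
    and f2: "\<And>i c. i < K \<Longrightarrow> c < W \<Longrightarrow> f i (2 + 2 * c) = (\<Sum>e | e \<in> C \<and> col i e = c. eid e)"
  shows "rows W f v K = 0 \<or> rows W f v K \<in> eid ` C"
  using f1 f2
proof (induction K)
  case (Suc K)
  obtain r g where g: "\<forall>k. scan (f K) k W = (g k, r)" "\<forall>k\<ge>r. g k = 0" "g ` {..<r} \<subseteq> eid ` {e\<in>C. col K e < W}"
    using scan_spec[OF C finC, of "f K" "col K" W] Suc.prems by auto
  have "g k = 0 \<or> g k \<in> eid ` C" for k using g(2,3) by (cases "k < r") auto
  then show ?case using g(1) Suc by simp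
qed simp

text \<open>The row chosen by \<^const>\<open>rows\<close> does not depend on the rank \<open>v\<close> that is looked up in it.\<close>

lemma rows_exact:
  assumes C: "\<forall>e\<in>C. edge e" and finC: "finite C"
    and f0: "\<And>i. i < K \<Longrightarrow> f i 0 = card C"
    and f1: "\<And>i c. i < K \<Longrightarrow> c < W \<Longrightarrow> f i (1 + 2 * c) = card {e\<in>C. col i e = c}"
    and f2: "\<And>i c. i < K \<Longrightarrow> c < W \<Longrightarrow> f i (2 + 2 * c) = (\<Sum>e | e \<in> C \<and> col i e = c. eid e)"
    and colW: "\<And>i e. e \<in> C \<Longrightarrow> col i e < W"
    and good: "\<exists>i<K. inj_on (col i) C"
  shows "\<exists>g. bij_betw g {..<card C} (eid ` C) \<and> (\<forall>v. C \<noteq> {} \<longrightarrow> rows W f v K = g (v mod card C))"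
  using f0 f1 f2 good
proof (induction K)
  case (Suc K)
  obtain r g where g: "\<forall>k. scan (f K) k W = (g k, r)" "r = card {b. b < W \<and> card {e\<in>C. col K e = b} = 1}"
    "inj_on g {..<r}" "g ` {..<r} \<subseteq> eid ` {e\<in>C. col K e < W}"
    using scan_spec[OF C finC, of "f K" "col K" W] Suc.prems by auto
  have inj: "inj_on eid C" using C eid_inj by (auto simp: inj_on_def)
  show ?case
  proof (cases "r = card C")
    case True
    have "g ` {..<card C} \<subseteq> eid ` C" using g(4) True by auto
    moreover have "card (g ` {..<card C}) = card (eid ` C)" using card_image[OF g(3)] card_image[OF inj] True by simp
    ultimately have "g ` {..<card C} = eid ` C" using finC by (intro card_subset_eq) auto
    then have "bij_betw g {..<card C} (eid ` C)" using g(3) True by (simp add: bij_betw_def)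
    then show ?thesis using g(1) True Suc.prems(1)[of K] by (intro exI[of _ g]) simp
  next
    case False
    \<comment> \<open>A row that separates the cell has as many single-edge columns as there are
      edges and would be usable; the separating row granted by the hypothesis must be an earlier
      one.\<close>
    have "\<not> inj_on (col K) C"
      using singles_card[OF finC, of "col K"] colW g(2) False by auto
    then have "\<exists>i<K. inj_on (col i) C" using Suc.prems(4) less_Suc_eq by auto
    then obtain g' where "bij_betw g' {..<card C} (eid ` C)" "\<forall>v. C \<noteq> {} \<longrightarrow> rows W f v K = g' (v mod card C)"
      using Suc by auto
    then show ?thesis using g(1) False Suc.prems(1)[of K] by (intro exI[of _ g']) simp
  qed
qed simp

lemma result_sound:
  assumes E: "\<forall>e\<in>E. edge e"
  shows "result tab zs E j = 0 \<or> result tab zs E j \<in> eid ` bucket tab E j"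
proof -
  define l where "l = level L (card (bucket tab E j))"
  define C where "C = cell tab E j l ((zs j div nb) mod 2 ^ l)"
  have CB: "C \<subseteq> bucket tab E j" "bucket tab E j \<subseteq> E" by (auto simp: C_def cell_def bucket_def)
  have "rows W (\<lambda>i x. counter tab zs E j (l * R + i) x) v R = 0 \<or> rows W (\<lambda>i x. counter tab zs E j (l * R + i) x) v R \<in> eid ` C" for v
  proof (rule rows_sound[where col = "column tab"])
    show "finite C" using CB edges_card(1)[OF E] finite_subset by metis
    show "\<forall>e\<in>C. edge e" using CB E by blast
  qed (use counter_cell[OF E, where zs = zs and C = C and j = j and l = l and tab = tab] C_def in auto)
  then show ?thesis unfolding result_def Let_def l_def[symmetric] using CB by auto
qed

text \<open>The event that \<open>e\<close> is sampled fixes three independent groups of digits of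
  \<open>z\<close>: one below \<open>s\<close>, one equal to the digits of the cell, one of
  prescribed rank. The rank \<open>k\<close> is the same for all \<open>z\<close>, since the
  counters of a level depend on \<open>z\<close> only through the middle digits. The form is that of
  a counting problem.\<close>

lemma result_exact:
  assumes E: "\<forall>e\<in>E. edge e" and e: "e \<in> E" "ehash tab 0 e mod nb = j" and l: "l = level L (card (bucket tab E j))"
    and C: "C = cell tab E j l ((ehash tab 0 e div nb) mod 2 ^ l)"
    and good: "\<exists>i<R. inj_on (column tab i) C"
  shows "\<exists>k<card C. \<forall>z. result tab (\<lambda>_. z) E j = eid e \<longleftrightarrow>
    z mod nb < s \<and> (z div nb) mod 2 ^ l = (ehash tab 0 e div nb) mod 2 ^ l \<and> (z div nb div 2 ^ l) mod card C = k"
proof -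
  have CB: "C \<subseteq> bucket tab E j" "bucket tab E j \<subseteq> E" by (auto simp: C cell_def bucket_def)
  have eC: "e \<in> C" using e by (simp add: C cell_def bucket_def)
  have fin: "finite C" using CB edges_card(1)[OF E] finite_subset by metis
  have edges: "\<forall>e\<in>C. edge e" using CB E by auto
  define r where "r = (ehash tab 0 e div nb) mod 2 ^ l"
  \<comment> \<open>A representative word with the middle digits of \<open>e\<close>; all words with
    these digits see the counters of \<open>zr\<close>.\<close>
  define zr where "zr = r * nb"
  have zr: "(zr div nb) mod 2 ^ l = r" using pos by (simp add: zr_def r_def)
  define f where "f i x = counter tab (\<lambda>_. zr) E j (l * R + i) x" for i x
  have "\<exists>g. bij_betw g {..<card C} (eid ` C) \<and> (\<forall>v. C \<noteq> {} \<longrightarrow> rows W f v R = g (v mod card C))"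
  proof (rule rows_exact[where col = "column tab"])
    have C': "C = cell tab E j l (((\<lambda>_. zr) j div nb) mod 2 ^ l)" by (simp only: C zr r_def)
    show "f i 0 = card C" if "i < R" for i using counter_cell(1)[OF E that _ C', of 0] pos by (simp add: f_def)
    show "f i (1 + 2 * c) = card {e \<in> C. column tab i e = c}" if "i < R" "c < W" for i c
      using counter_cell(2)[OF E that C'] by (simp add: f_def)
    show "f i (2 + 2 * c) = (\<Sum>e | e \<in> C \<and> column tab i e = c. eid e)" if "i < R" "c < W" for i c
      using counter_cell(3)[OF E that C'] by (simp add: f_def)
    show "column tab i e < W" for i e using pos by (simp add: column_def)
  qed (use fin edges good in auto)
  then obtain g where g: "bij_betw g {..<card C} (eid ` C)" "\<And>v. rows W f v R = g (v mod card C)" using eC by auto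
  have C0: "card C > 0" using eC fin by (auto simp: card_gt_0_iff)
  obtain k where k: "k < card C" "g k = eid e" using g(1) eC unfolding bij_betw_def by (metis (no_types, lifting) imageE imageI lessThan_iff)
  have res: "result tab (\<lambda>_. z) E j = (if z mod nb < s then g ((z div nb div 2 ^ l) mod card C) else 0)" if "(z div nb) mod 2 ^ l = r" for z
  proof -
    have "counter tab (\<lambda>_. z) E j (l * R + i) x = f i x" if "i < R" for i x
    proof -
      have "weight tab h (z div nb) a b (l * R + i) x = weight tab h (zr div nb) a b (l * R + i) x" for h a b
        using \<open>(z div nb) mod 2 ^ l = r\<close> zr \<open>i < R\<close> by (simp add: weight_def)
      then show ?thesis by (simp add: counter_def f_def)
    qed
    then have "rows W (\<lambda>i x. counter tab (\<lambda>_. z) E j (l * R + i) x) v R = rows W f v R" for v by (intro rows_cong)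
    then show ?thesis unfolding result_def Let_def l[symmetric] g(2)[symmetric] by simp
  qed
  have "result tab (\<lambda>_. z) E j = eid e \<longleftrightarrow>
    z mod nb < s \<and> (z div nb) mod 2 ^ l = r \<and> (z div nb div 2 ^ l) mod card C = k" for z
  proof (cases "(z div nb) mod 2 ^ l = r")
    case True
    have "g a = eid e \<longleftrightarrow> a = k" if "a < card C" for a
      using g(1) k that unfolding bij_betw_def inj_on_def by auto
    then show ?thesis using res[OF True] True C0 edgeD(6)[of e] E e by auto
  next
    case False
    \<comment> \<open>With other middle digits only codes from another cell can be returned, and
      \<open>e\<close> belongs to one cell only.\<close>
    have "result tab (\<lambda>_. z) E j \<noteq> eid e"
    proof
      assume *: "result tab (\<lambda>_. z) E j = eid e"
      define C2 where "C2 = cell tab E j l ((z div nb) mod 2 ^ l)"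
      have CB2: "C2 \<subseteq> bucket tab E j" by (auto simp: C2_def cell_def)
      have "rows W (\<lambda>i x. counter tab (\<lambda>_. z) E j (l * R + i) x) v R = 0 \<or> rows W (\<lambda>i x. counter tab (\<lambda>_. z) E j (l * R + i) x) v R \<in> eid ` C2" for v
      proof (rule rows_sound[where col = "column tab"])
        show "finite C2" using CB2 CB edges_card(1)[OF E] finite_subset by metis
        show "\<forall>e\<in>C2. edge e" using CB2 CB E by blast
      qed (use counter_cell[OF E, where zs = "\<lambda>_. z" and C = C2 and j = j and l = l and tab = tab] C2_def in auto)
      then have "result tab (\<lambda>_. z) E j = 0 \<or> result tab (\<lambda>_. z) E j \<in> eid ` C2"
        unfolding result_def Let_def l[symmetric] by auto
      moreover have ee: "edge e" using E e by auto
      ultimately obtain e2 where e2: "e2 \<in> C2" "eid e = eid e2" using * edgeD(6)[OF ee] by auto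
      have "edge e2" using e2(1) CB2 CB E by auto
      then have "e \<in> C2" using eid_inj[OF ee _ e2(2)] e2(1) by simp
      then show False using False by (simp add: C2_def cell_def r_def)
    qed
    then show ?thesis using False by simp
  qed
  then show ?thesis using k(1) by (auto simp: r_def)
qed

text \<open>The outcome of a bucket depends on its own sampling word alone; this is the source of
  the independence between buckets.\<close>

lemma result_local: "result tab zs E j = result tab (\<lambda>_. zs j) E j"
proof -
  have "counter tab zs E j = counter tab (\<lambda>_. zs j) E j" by (simp add: fun_eq_iff counter_def)
  then show ?thesis unfolding result_def by (simp only:)
qed

lemma stored_edges_state:
  assumes st: "state tab zs E (mem \<sigma>)" and E: "\<forall>e\<in>E. edge e"
  shows "stored_edges \<sigma> = sampled tab zs E"
proof -
  define m where "m = mem \<sigma>"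
  define res where "res = result tab zs E"
  have m: "m 5 = ob" "m 6 = nb" "\<And>j. j < nb \<Longrightarrow> m (ob + 2 * j) = res j div n \<and> m (ob + 2 * j + 1) = res j mod n"
    using st unfolding state_def params_def m_def res_def by auto
  have se: "stored_edges \<sigma> = {{res j div n, res j mod n} | j. j < nb \<and> res j div n \<noteq> res j mod n}"
    unfolding stored_edges_def Let_def m_def[symmetric] m(1,2)
    by (intro Collect_cong ex_cong1) (use m(3) in auto)
  show ?thesis
  proof (intro set_eqI iffI)
    fix e assume "e \<in> stored_edges \<sigma>"
    then obtain j where j: "e = {res j div n, res j mod n}" "j < nb" "res j div n \<noteq> res j mod n" unfolding se by auto
    \<comment> \<open>A result 0 has quotient and remainder 0, hence an empty slot.\<close>
    then have "res j \<noteq> 0" by (metis div_0 mod_0)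
    then obtain e' where e': "e' \<in> bucket tab E j" "res j = eid e'" using result_sound[OF E, of tab zs j] by (auto simp: res_def)
    then have "e' \<in> E" by (auto simp: bucket_def)
    then have "e = e'" using edgeD[of e'] E j e' by auto
    then show "e \<in> sampled tab zs E" using e' by (auto simp: sampled_def res_def bucket_def)
  next
    fix e assume e: "e \<in> sampled tab zs E"
    then have "edge e" "res (ehash tab 0 e mod nb) = eid e" using E by (auto simp: sampled_def res_def)
    then have "e = {res (ehash tab 0 e mod nb) div n, res (ehash tab 0 e mod nb) mod n}"
      "res (ehash tab 0 e mod nb) div n \<noteq> res (ehash tab 0 e mod nb) mod n"
      using edgeD(1,3,7,8)[of e] by auto
    moreover have "ehash tab 0 e mod nb < nb" using pos by simp
    ultimately show "e \<in> stored_edges \<sigma>" unfolding se by blast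
  qed
qed

lemma sampled_change:
  fixes b :: nat
  assumes E: "\<forall>e\<in>E. edge e" and e: "edge e" and b: "if b = 0 then e \<in> E else e \<notin> E"
    and E': "E' = (if b = 0 then E - {e} else insert e E)"
  shows "card ((sampled tab zs E' - sampled tab zs E) \<union> (sampled tab zs E - sampled tab zs E')) \<le> 2"
proof -
  define B where "B = {e'. ehash tab 0 e' mod nb = ehash tab 0 e mod nb}"
  have E'e: "\<forall>e\<in>E'. edge e" using E e by (auto simp: E' split: if_splits)
  have one: "finite (sampled tab zs F \<inter> B) \<and> card (sampled tab zs F \<inter> B) \<le> 1" if "\<forall>e\<in>F. edge e" for F
  proof -
    have "x = y" if "x \<in> sampled tab zs F \<inter> B" "y \<in> sampled tab zs F \<inter> B" for x y
    proof (rule eid_inj)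
      show "edge x" "edge y" "eid x = eid y" using that \<open>\<forall>e\<in>F. edge e\<close> by (auto simp: sampled_def B_def)
    qed
    moreover have "finite (sampled tab zs F \<inter> B)"
      by (rule finite_subset[OF _ edges_card(1)[OF that]]) (auto simp: sampled_def)
    ultimately show ?thesis by (simp add: card_le_Suc0_iff_eq)
  qed
  have out: "x \<in> sampled tab zs E' \<longleftrightarrow> x \<in> sampled tab zs E" if "x \<notin> B" for x
  proof -
    have "result tab zs E' (ehash tab 0 x mod nb) = result tab zs E (ehash tab 0 x mod nb)"
      by (rule result_update[OF E b E']) (use that in \<open>simp add: B_def\<close>)
    moreover have "x \<noteq> e" using that by (auto simp: B_def)
    ultimately show ?thesis by (auto simp: sampled_def E')
  qed
  have "(sampled tab zs E' - sampled tab zs E) \<union> (sampled tab zs E - sampled tab zs E') \<subseteq> (sampled tab zs E' \<inter> B) \<union> (sampled tab zs E \<inter> B)"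
    using out by auto
  then have "card ((sampled tab zs E' - sampled tab zs E) \<union> (sampled tab zs E - sampled tab zs E')) \<le> card ((sampled tab zs E' \<inter> B) \<union> (sampled tab zs E \<inter> B))"
    using one[OF E] one[OF E'e] by (intro card_mono) auto
  also have "\<dots> \<le> card (sampled tab zs E' \<inter> B) + card (sampled tab zs E \<inter> B)" by (rule card_Un_le)
  also have "\<dots> \<le> 2" using one[OF E] one[OF E'e] by simp
  finally show ?thesis .
qed

end

section \<open>Running the program on a stream\<close>

context sizes
begin

definition "setup_words \<tau> = (\<lambda>i. word (\<tau> Setup) (i * w) w)"
definition "sampling_words \<tau> = (\<lambda>i. word (\<tau> Sampling) (i * w) w)"

text \<open>Merges insertion and deletion into one case distinction on \<open>b\<close>. For a
  deletion the stream promises only that the edge is present, so the bounds on its endpoints come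
  from the invariant on the edge set.\<close>

lemma valid_step:
  assumes v: "valid_stream n us T" and t: "t < T" and E: "\<forall>e\<in>edges us t. edge e"
  obtains b u v :: nat where "mem (feed (us t) \<sigma>) = (mem \<sigma>)(2 := b, 3 := u, 4 := v)" "pos (feed (us t) \<sigma>) = pos \<sigma>"
    "u < n" "v < n" "u \<noteq> v" "if b = 0 then {u, v} \<in> edges us t else {u, v} \<notin> edges us t"
    "edges us (Suc t) = (if b = 0 then edges us t - {{u, v}} else insert {u, v} (edges us t))"
proof (cases "us t")
  case (Insert u v)
  then show ?thesis using that[of 1 u v] v t by (auto simp: valid_stream_def feed_def)
next
  case (Delete u v)
  then have uv: "{u, v} \<in> edges us t" using v t by (auto simp: valid_stream_def)
  then have "edge {u, v}" using E by auto
  then have "u < n" "v < n" "u \<noteq> v" by (auto simp: edge_def doubleton_eq_iff)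
  then show ?thesis using that[of 0 u v] Delete uv by (auto simp: feed_def)
qed

lemma edges_edge:
  assumes v: "valid_stream n us T" and t: "t \<le> T"
  shows "\<forall>e\<in>edges us t. edge e"
  using t
proof (induction t)
  case (Suc t)
  then have E: "\<forall>e\<in>edges us t. edge e" by simp
  obtain b u v :: nat where "u < n" "v < n" "u \<noteq> v"
    "edges us (Suc t) = (if b = 0 then edges us t - {{u, v}} else insert {u, v} (edges us t))"
    using valid_step[OF v _ E, of undefined] Suc.prems by (metis Suc_le_lessD)
  then show ?case using E edge_pair by auto
qed simp

text \<open>Halting and invariant are proved together: \<open>config_after\<close> is built from
  \<open>final\<close>, which is informative only for halting runs.\<close>

lemma run:
  assumes v: "valid_stream n us T" and t: "t \<le> T"
  shows "state (setup_words \<tau>) (sampling_words \<tau>) (edges us t)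
      (mem (config_after w M \<tau> (init_prog D C \<kappa>) update_prog n s us t))" (is "?st t")
    and "halts w M \<tau> (init_prog D C \<kappa>) (initial n s)"
    and "t < T \<Longrightarrow> halts w M \<tau> update_prog (feed (us t) (config_after w M \<tau> (init_prog D C \<kappa>) update_prog n s us t))"
    and "t < T \<Longrightarrow> run_time w M \<tau> update_prog (feed (us t) (config_after w M \<tau> (init_prog D C \<kappa>) update_prog n s us t)) \<le> update_time"
proof -
  note init = halts_wp[OF wp_init[of \<tau>]]
  have step: "halts w M \<tau> update_prog (feed (us t) \<sigma>) \<and> run_time w M \<tau> update_prog (feed (us t) \<sigma>) \<le> update_time \<and>
     state (setup_words \<tau>) (sampling_words \<tau>) (edges us (Suc t)) (mem (final w M \<tau> update_prog (feed (us t) \<sigma>)))"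
    if t: "t < T" and st: "state (setup_words \<tau>) (sampling_words \<tau>) (edges us t) (mem \<sigma>)" for t \<sigma>
  proof -
    have E: "\<forall>e\<in>edges us t. edge e" using edges_edge[OF v, of t] t by simp
    obtain b u v' :: nat where m: "mem (feed (us t) \<sigma>) = (mem \<sigma>)(2 := b, 3 := u, 4 := v')" "pos (feed (us t) \<sigma>) = pos \<sigma>"
      and uv: "u < n" "v' < n" "u \<noteq> v'" and b: "if b = 0 then {u, v'} \<in> edges us t else {u, v'} \<notin> edges us t"
      and E': "edges us (Suc t) = (if b = 0 then edges us t - {{u, v'}} else insert {u, v'} (edges us t))"
      by (rule valid_step[OF v t E])
    have "wp w M \<tau> update_prog (mem (feed (us t) \<sigma>)) (pos (feed (us t) \<sigma>))
      (\<lambda>k m' p'. k \<le> update_time \<and> state (setup_words \<tau>) (sampling_words \<tau>) (edges us (Suc t)) m' \<and> p' = pos (feed (us t) \<sigma>))"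
      by (rule wp_update[OF st m(1) uv E b E']) (simp add: sampling_words_def word_less)
    from halts_wp[OF this] show ?thesis by simp
  qed
  have st: "?st t" if "t \<le> T" for t
    using that
  proof (induction t)
    case 0
    then show ?case using init by (simp add: setup_words_def sampling_words_def)
  next
    case (Suc t)
    then show ?case using step[of t] by simp
  qed
  show "?st t" by (rule st[OF t])
  show "halts w M \<tau> (init_prog D C \<kappa>) (initial n s)" using init by simp
  show "t < T \<Longrightarrow> halts w M \<tau> update_prog (feed (us t) (config_after w M \<tau> (init_prog D C \<kappa>) update_prog n s us t))"
    "t < T \<Longrightarrow> run_time w M \<tau> update_prog (feed (us t) (config_after w M \<tau> (init_prog D C \<kappa>) update_prog n s us t)) \<le> update_time"
    using step[of t] st[of t] by auto
qed

lemma sample_eq: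
  assumes v: "valid_stream n us T" and t: "t \<le> T"
  shows "sample w M (init_prog D C \<kappa>) update_prog n s us \<rho> \<omega> t =
    sampled (\<lambda>i. word \<rho> (i * w) w) (\<lambda>i. word \<omega> (i * w) w) (edges us t)"
  unfolding sample_def using stored_edges_state[OF run(1)[OF v t] edges_edge[OF v t]]
  by (simp add: setup_words_def sampling_words_def)

lemma processes_update:
  assumes v: "valid_stream n us T" and B: "real update_time \<le> B"
  shows "processes w M (init_prog D C \<kappa>) update_prog n s us T B"
  unfolding processes_def Let_def using run(2,3,4)[OF v] B
  by (meson less_imp_le of_nat_le_iff order_trans zero_le)

lemma sample_change:
  assumes v: "valid_stream n us T" and t: "t < T"
  shows "card ((sampled tab zs (edges us (Suc t)) - sampled tab zs (edges us t)) \<union>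
      (sampled tab zs (edges us t) - sampled tab zs (edges us (Suc t)))) \<le> 2"
proof -
  have E: "\<forall>e\<in>edges us t. edge e" using edges_edge[OF v, of t] t by simp
  obtain b u v' :: nat where "u < n" "v' < n" "u \<noteq> v'"
    "if b = 0 then {u, v'} \<in> edges us t else {u, v'} \<notin> edges us t"
    "edges us (Suc t) = (if b = 0 then edges us t - {{u, v'}} else insert {u, v'} (edges us t))"
    by (rule valid_step[OF v t E, of undefined])
  then show ?thesis by (intro sampled_change[OF E edge_pair])
qed

end

section \<open>Random words and negative association\<close>

definition words :: "nat \<Rightarrow> nat \<Rightarrow> (nat \<Rightarrow> nat) pmf" where
  "words N w = Pi_pmf {..<N} 0 (\<lambda>_. pmf_of_set {..<2 ^ w})"

text \<open>Indices from \<open>N\<close> on are set to 0, the default value of the product in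
  \<open>words\<close>, so that both sides have the same distribution on functions and not merely on
  restrictions.\<close>

definition read :: "nat \<Rightarrow> nat \<Rightarrow> (nat \<Rightarrow> bool) \<Rightarrow> nat \<Rightarrow> nat" where
  "read N w \<rho> = (\<lambda>i. if i < N then word \<rho> (i * w) w else 0)"

lemma word_eq_iff:
  "x < 2 ^ w \<Longrightarrow> word \<rho> p w = x \<longleftrightarrow> (\<forall>b<w. \<rho> (p + b) = odd (x div 2 ^ (w - 1 - b)))"
proof (induction w arbitrary: x)
  case (Suc w)
  have "x div 2 < 2 ^ w" using Suc.prems by auto
  note IH = Suc.IH[OF this]
  have "x div 2 div 2 ^ (w - 1 - b) = x div 2 ^ (w - b)" if "b < w" for b
  proof -
    have "(2 :: nat) ^ (w - b) = 2 * 2 ^ (w - 1 - b)"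
      unfolding power_Suc[symmetric] by (rule arg_cong[of _ _ "\<lambda>k. 2 ^ k"]) (use that in simp)
    then show ?thesis by (simp only: div_mult2_eq)
  qed
  then have 1: "(\<forall>b<w. \<rho> (p + b) = odd (x div 2 div 2 ^ (w - 1 - b))) \<longleftrightarrow> (\<forall>b<w. \<rho> (p + b) = odd (x div 2 ^ (w - b)))"
    by simp
  have 2: "2 * a + of_bool c = x \<longleftrightarrow> a = x div 2 \<and> c = odd x" for a c
  proof
    assume "2 * a + of_bool c = x"
    then show "a = x div 2 \<and> c = odd x" by auto
  next
    assume *: "a = x div 2 \<and> c = odd x"
    have "2 * (x div 2) + x mod 2 = x" by simp
    then show "2 * a + of_bool c = x" unfolding mod_2_eq_odd using * by simp
  qed
  show ?case
    unfolding word.simps(2) 2 IH 1 by (simp add: All_less_Suc conj_commute)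
qed simp

lemma words_eq: "words N w = pmf_of_set (PiE_dflt {..<N} 0 (\<lambda>_. {..<2 ^ w}))"
  unfolding words_def by (rule Pi_pmf_of_set) (auto simp: lessThan_empty_iff)

lemma finite_words: "finite (PiE_dflt {..<N :: nat} (0::nat) (\<lambda>_. {..<2 ^ w}))"
  by (rule finite_PiE_dflt) auto

lemma words_ne: "PiE_dflt {..<N :: nat} (0::nat) (\<lambda>_. {..<2 ^ w}) \<noteq> {}"
  by (simp add: lessThan_empty_iff)

lemma set_words: "set_pmf (words N w) = PiE_dflt {..<N} 0 (\<lambda>_. {..<2 ^ w})"
  unfolding words_eq by (rule set_pmf_of_set[OF words_ne finite_words])

lemma finite_set_words [simp]: "finite (set_pmf (words N w))"
  by (simp add: set_words finite_words)

lemma fair_bits_cylinder: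
  "{\<rho>. \<forall>k<N. \<rho> k = \<beta> k} \<in> sets fair_bits"
  "emeasure fair_bits {\<rho>. \<forall>k<N. \<rho> k = \<beta> k} = ennreal ((1 / 2) ^ N)"
proof -
  have e: "{\<rho>. \<forall>k<N. \<rho> k = \<beta> k} =
    prod_emb UNIV (\<lambda>_. measure_pmf (bernoulli_pmf (1 / 2))) {..<N} (Pi\<^sub>E {..<N} (\<lambda>k. {\<beta> k}))"
  proof (rule set_eqI)
    fix \<rho> :: "nat \<Rightarrow> bool"
    have "restrict \<rho> {..<N} \<in> Pi\<^sub>E {..<N} (\<lambda>k. {\<beta> k}) \<longleftrightarrow> (\<forall>k<N. \<rho> k = \<beta> k)"
      by (simp only: restrict_PiE_iff) auto
    then show "\<rho> \<in> {\<rho>. \<forall>k<N. \<rho> k = \<beta> k} \<longleftrightarrow>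
      \<rho> \<in> prod_emb UNIV (\<lambda>_. measure_pmf (bernoulli_pmf (1 / 2))) {..<N} (Pi\<^sub>E {..<N} (\<lambda>k. {\<beta> k}))"
      unfolding prod_emb_def by (simp only: space_measure_pmf PiE_UNIV_domain Int_iff vimage_eq mem_Collect_eq) simp
  qed
  show "{\<rho>. \<forall>k<N. \<rho> k = \<beta> k} \<in> sets fair_bits"
    unfolding e fair_bits_def by (rule sets_PiM_I) simp_all
  have "emeasure fair_bits {\<rho>. \<forall>k<N. \<rho> k = \<beta> k} = (\<Prod>k<N. emeasure (measure_pmf (bernoulli_pmf (1 / 2))) {\<beta> k})"
    unfolding e fair_bits_def
    by (rule emeasure_PiM_emb) (rule measure_pmf.prob_space_axioms | simp)+
  also have "\<dots> = (\<Prod>k<N. ennreal (1 / 2))"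
  proof (rule prod.cong)
    fix k show "emeasure (measure_pmf (bernoulli_pmf (1 / 2))) {\<beta> k} = ennreal (1 / 2)"
      by (cases "\<beta> k") (simp_all add: emeasure_pmf_single)
  qed simp
  also have "\<dots> = ennreal ((1 / 2) ^ N)"
    unfolding prod_constant card_lessThan by (rule ennreal_power) simp
  finally show "emeasure fair_bits {\<rho>. \<forall>k<N. \<rho> k = \<beta> k} = ennreal ((1 / 2) ^ N)" .
qed

lemma read_eq:
  assumes f: "f \<in> PiE_dflt {..<N} 0 (\<lambda>_. {..<2 ^ w})"
  shows "{\<rho>. read N w \<rho> = f} = {\<rho>. \<forall>k<N * w. \<rho> k = odd (f (k div w) div 2 ^ (w - 1 - k mod w))}"
proof -
  have f': "f i < 2 ^ w" if "i < N" for i using f that by (auto simp: PiE_dflt_def)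
  have 1: "read N w \<rho> = f \<longleftrightarrow> (\<forall>i<N. word \<rho> (i * w) w = f i)" for \<rho>
    using f by (auto simp: read_def fun_eq_iff PiE_dflt_def)
  have 2: "(\<forall>i<N. word \<rho> (i * w) w = f i) \<longleftrightarrow> (\<forall>i<N. \<forall>b<w. \<rho> (i * w + b) = odd (f i div 2 ^ (w - 1 - b)))" for \<rho>
    using word_eq_iff[OF f'] by auto
  have 3: "(\<forall>i<N. \<forall>b<w. \<rho> (i * w + b) = odd (f i div 2 ^ (w - 1 - b))) \<longleftrightarrow> (\<forall>k<N * w. \<rho> k = odd (f (k div w) div 2 ^ (w - 1 - k mod w)))" for \<rho>
  proof (rule iffI; intro allI impI)
    fix k assume *: "\<forall>i<N. \<forall>b<w. \<rho> (i * w + b) = odd (f i div 2 ^ (w - 1 - b))" and k: "k < N * w"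
    have w0: "0 < w" using k by (cases w) auto
    have "k div w < N" "k mod w < w" using k w0 by (auto simp: less_mult_imp_div_less)
    then have "\<rho> (k div w * w + k mod w) = odd (f (k div w) div 2 ^ (w - 1 - k mod w))" using * by blast
    then show "\<rho> k = odd (f (k div w) div 2 ^ (w - 1 - k mod w))" by simp
  next
    fix i b assume *: "\<forall>k<N * w. \<rho> k = odd (f (k div w) div 2 ^ (w - 1 - k mod w))" and i: "i < N" and b: "b < w"
    have "i * w + b < Suc i * w" using b by simp
    also have "\<dots> \<le> N * w" using i by (intro mult_le_mono1) simp
    finally have "\<rho> (i * w + b) = odd (f ((i * w + b) div w) div 2 ^ (w - 1 - (i * w + b) mod w))" using * by blast
    then show "\<rho> (i * w + b) = odd (f i div 2 ^ (w - 1 - b))" using b by simp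
  qed
  show ?thesis unfolding 1 2 3 ..
qed

lemma read_range: "read N w \<rho> \<in> PiE_dflt {..<N} 0 (\<lambda>_. {..<2 ^ w})"
  by (auto simp: read_def PiE_dflt_def word_less)

text \<open>A table of \<open>N\<close> words is the same as a pattern of the first
  \<open>N * w\<close> bits, of probability \<open>(1 / 2) ^ (N * w)\<close>. All later probability
  takes place in finite distributions, where every function is integrable.\<close>

lemma fair_bits_read:
  "read N w -` A \<in> sets fair_bits"
  "emeasure fair_bits (read N w -` A) = emeasure (measure_pmf (words N w)) A"
proof -
  define D where "D = PiE_dflt {..<N} 0 (\<lambda>_. {..<2 ^ w :: nat})"
  have fD: "finite (A \<inter> D)" using finite_words by (simp add: D_def)
  have eq: "read N w -` A = (\<Union>f\<in>A \<inter> D. {\<rho>. read N w \<rho> = f})" by (auto simp: D_def read_range)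
  have m: "{\<rho>. read N w \<rho> = f} \<in> sets fair_bits" "emeasure fair_bits {\<rho>. read N w \<rho> = f} = ennreal ((1 / 2) ^ (N * w))" if "f \<in> A \<inter> D" for f
  proof -
    have "f \<in> PiE_dflt {..<N} 0 (\<lambda>_. {..<2 ^ w})" using that by (simp add: D_def)
    note r = read_eq[OF this]
    show "{\<rho>. read N w \<rho> = f} \<in> sets fair_bits" "emeasure fair_bits {\<rho>. read N w \<rho> = f} = ennreal ((1 / 2) ^ (N * w))"
      unfolding r by (rule fair_bits_cylinder)+
  qed
  show "read N w -` A \<in> sets fair_bits" unfolding eq by (rule sets.finite_UN[OF fD]) (rule m(1))
  have "emeasure fair_bits (read N w -` A) = (\<Sum>f\<in>A \<inter> D. emeasure fair_bits {\<rho>. read N w \<rho> = f})"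
    unfolding eq by (rule sum_emeasure[symmetric]) (use fD m(1) in \<open>auto simp: disjoint_family_on_def\<close>)
  also have "\<dots> = (\<Sum>f\<in>A \<inter> D. ennreal ((1 / 2) ^ (N * w)))" by (rule sum.cong[OF refl]) (rule m(2))
  also have "\<dots> = (\<Sum>f\<in>A \<inter> D. ennreal (pmf (words N w) f))"
  proof (intro sum.cong refl arg_cong[of _ _ ennreal])
    fix f assume f: "f \<in> A \<inter> D"
    have "card D = (2 ^ w) ^ N" unfolding D_def by (subst card_PiE_dflt) auto
    moreover have "pmf (words N w) f = indicator D f / card D"
      unfolding words_eq D_def by (rule pmf_of_set[OF words_ne finite_words])
    ultimately have "pmf (words N w) f = 1 / real ((2 ^ w) ^ N)" using f by simp
    also have "real ((2 ^ w) ^ N) = 2 ^ (N * w)" by (simp add: power_mult mult.commute[of N w])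
    finally show "(1 / 2) ^ (N * w) = pmf (words N w) f" by (simp add: power_divide)
  qed
  also have "\<dots> = emeasure (measure_pmf (words N w)) (A \<inter> D)"
    unfolding emeasure_measure_pmf_finite[OF fD] by (rule sum_ennreal) simp
  also have "\<dots> = emeasure (measure_pmf (words N w)) A"
    unfolding D_def set_words[symmetric] by (rule emeasure_Int_set_pmf)
  finally show "emeasure fair_bits (read N w -` A) = emeasure (measure_pmf (words N w)) A" .
qed

lemma space_fair_bits: "space fair_bits = UNIV"
  by (simp add: fair_bits_def space_PiM)

lemma measurable_read: "read N w \<in> fair_bits \<rightarrow>\<^sub>M count_space UNIV"
  by (rule measurableI) (simp_all add: fair_bits_read space_fair_bits)

lemma distr_read: "distr fair_bits (count_space UNIV) (read N w) = measure_pmf (words N w)"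
proof (rule measure_eqI)
  fix A :: "(nat \<Rightarrow> nat) set"
  show "emeasure (distr fair_bits (count_space UNIV) (read N w)) A = emeasure (measure_pmf (words N w)) A"
    by (subst emeasure_distr[OF measurable_read]) (simp_all add: fair_bits_read space_fair_bits)
qed simp

lemma measure_fair_bits_read:
  "measure fair_bits {\<rho> \<in> space fair_bits. Q (read N w \<rho>)} = measure_pmf.prob (words N w) {f. Q f}"
proof -
  have "{\<rho> \<in> space fair_bits. Q (read N w \<rho>)} = read N w -` {f. Q f}" by (auto simp: space_fair_bits)
  then show ?thesis unfolding measure_def by (simp only: fair_bits_read)
qed

lemma integral_fair_bits_read:
  fixes F :: "(nat \<Rightarrow> nat) \<Rightarrow> real"
  shows "(\<integral>\<omega>. F (read N w \<omega>) \<partial>fair_bits) = measure_pmf.expectation (words N w) F"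
  unfolding distr_read[symmetric] by (rule integral_distr[symmetric, OF measurable_read]) simp

lemma borel_read: "(\<lambda>\<omega>. (F :: (nat \<Rightarrow> nat) \<Rightarrow> real) (read N w \<omega>)) \<in> borel_measurable fair_bits"
  by (rule measurable_compose[OF measurable_read]) simp

section \<open>Products of finite distributions and negative correlation\<close>

lemma expectation_pair_finite:
  fixes f :: "'a \<times> 'b \<Rightarrow> real"
  assumes "finite (set_pmf p)" "finite (set_pmf q)"
  shows "measure_pmf.expectation (pair_pmf p q) f =
    measure_pmf.expectation p (\<lambda>x. measure_pmf.expectation q (\<lambda>y. f (x, y)))"
proof -
  have "measure_pmf.expectation (pair_pmf p q) f = (\<Sum>a\<in>set_pmf p \<times> set_pmf q. f a * pmf (pair_pmf p q) a)"
    by (rule integral_measure_pmf_real) (use assms in auto)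
  also have "\<dots> = (\<Sum>x\<in>set_pmf p. \<Sum>y\<in>set_pmf q. f (x, y) * (pmf p x * pmf q y))"
    unfolding sum.cartesian_product by (intro sum.cong refl) (auto simp: pmf_pair)
  also have "\<dots> = (\<Sum>x\<in>set_pmf p. (\<Sum>y\<in>set_pmf q. f (x, y) * pmf q y) * pmf p x)"
    by (intro sum.cong refl, subst sum_distrib_right) (simp add: mult_ac)
  also have "\<dots> = (\<Sum>x\<in>set_pmf p. measure_pmf.expectation q (\<lambda>y. f (x, y)) * pmf p x)"
    by (intro sum.cong refl arg_cong2[of _ _ _ _ "(*)"] integral_measure_pmf_real[symmetric]) (use assms in auto)
  also have "\<dots> = measure_pmf.expectation p (\<lambda>x. measure_pmf.expectation q (\<lambda>y. f (x, y)))"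
    by (rule integral_measure_pmf_real[symmetric]) (use assms in auto)
  finally show ?thesis .
qed

lemma finite_set_Pi_pmf: "finite A \<Longrightarrow> (\<And>x. x \<in> A \<Longrightarrow> finite (set_pmf (p x))) \<Longrightarrow> finite (set_pmf (Pi_pmf A d p))"
  by (simp add: set_Pi_pmf finite_PiE_dflt)

lemma expectation_Pi_pmf_insert:
  fixes f :: "('a \<Rightarrow> 'b) \<Rightarrow> real"
  assumes "finite A" "x \<notin> A" "\<And>y. y \<in> insert x A \<Longrightarrow> finite (set_pmf (p y))"
  shows "measure_pmf.expectation (Pi_pmf (insert x A) d p) f =
    measure_pmf.expectation (Pi_pmf A d p) (\<lambda>z. measure_pmf.expectation (p x) (\<lambda>y. f (z(x := y))))"
proof -
  have "Pi_pmf (insert x A) d p = map_pmf (\<lambda>(f, y). f(x := y)) (pair_pmf (Pi_pmf A d p) (p x))"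
    using assms(1,2) by (subst pair_commute_pmf) (simp add: Pi_pmf_insert pmf.map_comp comp_def case_prod_unfold)
  then show ?thesis
    using assms by (simp add: expectation_pair_finite finite_set_Pi_pmf case_prod_unfold)
qed

text \<open>In each group at most one item is picked, so the increments of the two factors over the
  value for \<^const>\<open>None\<close> are never non-zero at the same time; groups are added one at a time.\<close>

lemma expectation_picks_neg_corr:
  fixes F G :: "('i \<Rightarrow> 'e option) \<Rightarrow> real" and pick :: "'i \<Rightarrow> 'z \<Rightarrow> 'e option"
  assumes "finite J" and fin: "\<And>j. j \<in> J \<Longrightarrow> finite (set_pmf (p j))"
    and "\<And>q j e. j \<in> J \<Longrightarrow> F (q(j := None)) \<le> F (q(j := Some e))"
    and "\<And>q j e. j \<in> J \<Longrightarrow> G (q(j := None)) \<le> G (q(j := Some e))"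
    and "\<And>j e. j \<in> J \<Longrightarrow> (\<forall>q. F (q(j := Some e)) = F (q(j := None))) \<or> (\<forall>q. G (q(j := Some e)) = G (q(j := None)))"
  shows "measure_pmf.expectation (Pi_pmf J d p) (\<lambda>z. F (\<lambda>j. if j \<in> J then pick j (z j) else None) * G (\<lambda>j. if j \<in> J then pick j (z j) else None))
    \<le> measure_pmf.expectation (Pi_pmf J d p) (\<lambda>z. F (\<lambda>j. if j \<in> J then pick j (z j) else None))
      * measure_pmf.expectation (Pi_pmf J d p) (\<lambda>z. G (\<lambda>j. if j \<in> J then pick j (z j) else None))"
  using assms
proof (induction J arbitrary: F G rule: finite_induct)
  case empty
  then show ?case by simp
next
  case (insert x J)
  have finx: "finite (set_pmf (p x))" and finJ: "\<And>j. j \<in> J \<Longrightarrow> finite (set_pmf (p j))" using insert.prems by auto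
  have int: "integrable (measure_pmf (p x)) h" for h :: "'z \<Rightarrow> real" using finx by (rule integrable_measure_pmf_finite)
  have finP: "finite (set_pmf (Pi_pmf J d p))" using insert.hyps finJ by (intro finite_set_Pi_pmf)
  have intP: "integrable (measure_pmf (Pi_pmf J d p)) h" for h :: "_ \<Rightarrow> real" using finP by (rule integrable_measure_pmf_finite)
  define \<pi> where "\<pi> = (\<lambda>z j. if j \<in> J then pick j (z j) else None)"
  have upd: "(\<lambda>j. if j \<in> insert x J then pick j ((z(x := y)) j) else None) = (\<pi> z)(x := pick x y)" for z y
    using insert.hyps by (auto simp: \<pi>_def fun_eq_iff)
  \<comment> \<open>Group \<open>x\<close> is averaged out. Averaging is monotone and preserves
    independence of a given item, so \<open>F'\<close> and \<open>G'\<close> satisfy the hypotheses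
    for the remaining groups.\<close>
  define F' where "F' q = measure_pmf.expectation (p x) (\<lambda>y. F (q(x := pick x y)))" for q
  define G' where "G' q = measure_pmf.expectation (p x) (\<lambda>y. G (q(x := pick x y)))" for q
  have E: "measure_pmf.expectation (Pi_pmf (insert x J) d p) (\<lambda>z. H (\<lambda>j. if j \<in> insert x J then pick j (z j) else None)) =
      measure_pmf.expectation (Pi_pmf J d p) (\<lambda>z. measure_pmf.expectation (p x) (\<lambda>y. H ((\<pi> z)(x := pick x y))))" for H :: "('i \<Rightarrow> 'e option) \<Rightarrow> real"
  proof -
    have "measure_pmf.expectation (Pi_pmf (insert x J) d p) (\<lambda>z. H (\<lambda>j. if j \<in> insert x J then pick j (z j) else None)) =
      measure_pmf.expectation (Pi_pmf J d p) (\<lambda>z. measure_pmf.expectation (p x) (\<lambda>y. H (\<lambda>j. if j \<in> insert x J then pick j ((z(x := y)) j) else None)))"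
      by (rule expectation_Pi_pmf_insert[OF insert.hyps insert.prems(1)])
    then show ?thesis by (simp only: upd)
  qed
  have one: "measure_pmf.expectation (p x) (\<lambda>y. F (q(x := pick x y)) * G (q(x := pick x y))) \<le> F' q * G' q" for q
  proof -
    define f0 g0 where "f0 = F (q(x := None))" and "g0 = G (q(x := None))"
    define f g where "f y = F (q(x := pick x y)) - f0" and "g y = G (q(x := pick x y)) - g0" for y
    have f: "0 \<le> f y" for y
    proof (cases "pick x y")
      case None
      then show ?thesis by (simp add: f_def f0_def)
    next
      case (Some e)
      have "F (q(x := None)) \<le> F (q(x := Some e))" by (rule insert.prems(2)) simp
      then show ?thesis unfolding f_def f0_def Some by linarith
    qed
    have g: "0 \<le> g y" for y
    proof (cases "pick x y")
      case None
      then show ?thesis by (simp add: g_def g0_def)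
    next
      case (Some e)
      have "G (q(x := None)) \<le> G (q(x := Some e))" by (rule insert.prems(3)) simp
      then show ?thesis unfolding g_def g0_def Some by linarith
    qed
    have fg: "f y * g y = 0" for y
    proof (cases "pick x y")
      case None
      then show ?thesis by (simp add: f_def f0_def)
    next
      case (Some e)
      have "(\<forall>q. F (q(x := Some e)) = F (q(x := None))) \<or> (\<forall>q. G (q(x := Some e)) = G (q(x := None)))"
        by (rule insert.prems(4)) simp
      then have "f y = 0 \<or> g y = 0" unfolding f_def f0_def g_def g0_def Some right_minus_eq by blast
      then show ?thesis by auto
    qed
    have F: "F (q(x := pick x y)) = f0 + f y" and G: "G (q(x := pick x y)) = g0 + g y" for y by (simp_all add: f_def g_def)
    have "measure_pmf.expectation (p x) (\<lambda>y. F (q(x := pick x y)) * G (q(x := pick x y))) =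
      measure_pmf.expectation (p x) (\<lambda>y. f0 * g0 + f0 * g y + g0 * f y)"
      unfolding F G by (intro Bochner_Integration.integral_cong refl) (use fg in \<open>auto simp: algebra_simps\<close>)
    also have "\<dots> = f0 * g0 + f0 * measure_pmf.expectation (p x) g + g0 * measure_pmf.expectation (p x) f"
      using int by simp
    \<comment> \<open>The cross term \<open>f * g\<close> has vanished pointwise, whereas the
      product on the right contains the non-negative product of the two expectations.\<close>
    also have "\<dots> \<le> (f0 + measure_pmf.expectation (p x) f) * (g0 + measure_pmf.expectation (p x) g)"
      using f g by (simp add: algebra_simps)
    also have "f0 + measure_pmf.expectation (p x) f = F' q" unfolding F'_def F using int by simp
    also have "g0 + measure_pmf.expectation (p x) g = G' q" unfolding G'_def G using int by simp
    finally show ?thesis .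
  qed
  have "measure_pmf.expectation (Pi_pmf (insert x J) d p) (\<lambda>z. F (\<lambda>j. if j \<in> insert x J then pick j (z j) else None) * G (\<lambda>j. if j \<in> insert x J then pick j (z j) else None))
    = measure_pmf.expectation (Pi_pmf J d p) (\<lambda>z. measure_pmf.expectation (p x) (\<lambda>y. F ((\<pi> z)(x := pick x y)) * G ((\<pi> z)(x := pick x y))))"
    using E[of "\<lambda>q. F q * G q"] .
  also have "\<dots> \<le> measure_pmf.expectation (Pi_pmf J d p) (\<lambda>z. F' (\<pi> z) * G' (\<pi> z))"
    using one intP by (intro integral_mono) auto
  also have "\<dots> \<le> measure_pmf.expectation (Pi_pmf J d p) (\<lambda>z. F' (\<pi> z)) * measure_pmf.expectation (Pi_pmf J d p) (\<lambda>z. G' (\<pi> z))"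
    unfolding \<pi>_def
  proof (rule insert.IH[OF finJ])
    fix q j and e :: 'e assume j: "j \<in> J"
    then have jx: "j \<noteq> x" using insert.hyps by auto
    show "F' (q(j := None)) \<le> F' (q(j := Some e))" "G' (q(j := None)) \<le> G' (q(j := Some e))"
      unfolding F'_def G'_def fun_upd_twist[OF jx]
      by (rule integral_mono[OF int int], rule insert.prems, use j in simp)+
  next
    fix j and e :: 'e assume j: "j \<in> J"
    then have jx: "j \<noteq> x" using insert.hyps by auto
    show "(\<forall>q. F' (q(j := Some e)) = F' (q(j := None))) \<or> (\<forall>q. G' (q(j := Some e)) = G' (q(j := None)))"
      unfolding F'_def G'_def fun_upd_twist[OF jx]
      using insert.prems(4)[OF insertI2[OF j], of e] by (elim disjE) (simp_all only: simp_thms)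
  qed
  also have "\<dots> = measure_pmf.expectation (Pi_pmf (insert x J) d p) (\<lambda>z. F (\<lambda>j. if j \<in> insert x J then pick j (z j) else None))
      * measure_pmf.expectation (Pi_pmf (insert x J) d p) (\<lambda>z. G (\<lambda>j. if j \<in> insert x J then pick j (z j) else None))"
    unfolding F'_def G'_def E ..
  finally show ?case .
qed

section \<open>Negative association of the sample\<close>

context layout
begin

lemma neg_associated_sampled:
  assumes E: "\<forall>e\<in>E. edge e"
  shows "neg_associated fair_bits E (\<lambda>e \<omega>. of_bool (e \<in> sampled tab (\<lambda>i. word \<omega> (i * w) w) E))"
proof -
  \<comment> \<open>The edge contributed by bucket \<open>j\<close> under sampling word
    \<open>z\<close>, if any; injectivity of codes makes it unique.\<close>
  define pick where "pick j z = (if \<exists>e\<in>bucket tab E j. result tab (\<lambda>_. z) E j = eid e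
     then Some (THE e. e \<in> bucket tab E j \<and> result tab (\<lambda>_. z) E j = eid e) else None)" for j z
  have pick: "pick j z = Some e \<longleftrightarrow> e \<in> bucket tab E j \<and> result tab (\<lambda>_. z) E j = eid e" for j z e
  proof -
    have u: "e1 = e2" if "e1 \<in> bucket tab E j" "e2 \<in> bucket tab E j" "eid e1 = eid e2" for e1 e2
      using that E eid_inj by (auto simp: bucket_def)
    show ?thesis
    proof
      assume *: "pick j z = Some e"
      then obtain e1 where e1: "e1 \<in> bucket tab E j" "result tab (\<lambda>_. z) E j = eid e1" by (auto simp: pick_def split: if_splits)
      then have "(THE e. e \<in> bucket tab E j \<and> result tab (\<lambda>_. z) E j = eid e) = e1" using u by (intro the_equality) auto
      then show "e \<in> bucket tab E j \<and> result tab (\<lambda>_. z) E j = eid e" using * e1 by (auto simp: pick_def split: if_splits)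
    next
      assume *: "e \<in> bucket tab E j \<and> result tab (\<lambda>_. z) E j = eid e"
      then have "(THE e. e \<in> bucket tab E j \<and> result tab (\<lambda>_. z) E j = eid e) = e" using u by (intro the_equality) auto
      then show "pick j z = Some e" using * by (auto simp: pick_def)
    qed
  qed
  define \<pi> where "\<pi> = (\<lambda>z j. if j \<in> {..<nb} then pick j (z j) else None)"
  have mem: "e \<in> sampled tab (\<lambda>i. word \<omega> (i * w) w) E \<longleftrightarrow> (\<exists>j. \<pi> (read nb w \<omega>) j = Some e)" for e \<omega>
  proof
    assume "e \<in> sampled tab (\<lambda>i. word \<omega> (i * w) w) E"
    then have e: "e \<in> E" "result tab (\<lambda>i. word \<omega> (i * w) w) E (ehash tab 0 e mod nb) = eid e" by (auto simp: sampled_def)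
    have "ehash tab 0 e mod nb < nb" using pos by simp
    then show "\<exists>j. \<pi> (read nb w \<omega>) j = Some e"
      using e by (intro exI[of _ "ehash tab 0 e mod nb"]) (simp add: \<pi>_def pick read_def bucket_def result_local[symmetric, of tab "\<lambda>i. word \<omega> (i * w) w"])
  next
    assume "\<exists>j. \<pi> (read nb w \<omega>) j = Some e"
    then obtain j where "j < nb" "pick j (word \<omega> (j * w) w) = Some e" by (auto simp: \<pi>_def read_def split: if_splits)
    then show "e \<in> sampled tab (\<lambda>i. word \<omega> (i * w) w) E"
      unfolding pick using result_local[of tab "\<lambda>i. word \<omega> (i * w) w" E j] by (auto simp: sampled_def bucket_def)
  qed
  \<comment> \<open>\<open>X\<close> is defined for arbitrary assignments \<open>q\<close>, even
    those in which several buckets pick the same edge; monotonicity in each bucket is then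
    immediate.\<close>
  define X where "X e q = (of_bool (\<exists>j. q j = Some e) :: real)" for e :: "nat set" and q :: "nat \<Rightarrow> nat set option"
  have X: "(of_bool (e \<in> sampled tab (\<lambda>i. word \<omega> (i * w) w) E) :: real) = X e (\<pi> (read nb w \<omega>))" for e \<omega>
    by (simp add: X_def mem)
  show ?thesis
    unfolding neg_associated_def Let_def X
  proof (intro conjI allI impI ballI)
    show "(\<lambda>\<omega>. X e (\<pi> (read nb w \<omega>))) \<in> borel_measurable fair_bits" for e by (rule borel_read)
  next
    fix I J and f g :: "(nat set \<Rightarrow> real) \<Rightarrow> real"
    assume a: "I \<subseteq> E \<and> J \<subseteq> E \<and> I \<inter> J = {} \<and> mono f \<and> mono g \<and>
          integrable fair_bits (\<lambda>x. f (\<lambda>i\<in>I. X i (\<pi> (read nb w x)))) \<and>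
          integrable fair_bits (\<lambda>x. g (\<lambda>j\<in>J. X j (\<pi> (read nb w x)))) \<and>
          integrable fair_bits (\<lambda>x. f (\<lambda>i\<in>I. X i (\<pi> (read nb w x))) * g (\<lambda>j\<in>J. X j (\<pi> (read nb w x))))"
    define F where "F q = f (\<lambda>i\<in>I. X i q)" for q
    define G where "G q = g (\<lambda>i\<in>J. X i q)" for q
    have Xmono: "X i (q(j := None)) \<le> X i (q(j := Some e))" for i q j e by (auto simp: X_def split: if_splits)
    have Xeq: "X i (q(j := None)) = X i (q(j := Some e))" if "i \<noteq> e" for i q j e using that by (auto simp: X_def)
    have "measure_pmf.expectation (words nb w) (\<lambda>z. F (\<pi> z) * G (\<pi> z)) \<le>
      measure_pmf.expectation (words nb w) (\<lambda>z. F (\<pi> z)) * measure_pmf.expectation (words nb w) (\<lambda>z. G (\<pi> z))"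
      unfolding words_def \<pi>_def
    proof (rule expectation_picks_neg_corr)
      show "F (q(j := None)) \<le> F (q(j := Some e))" for q j e
        unfolding F_def using a Xmono by (intro monoD[of f]) (auto simp: le_fun_def)
      show "G (q(j := None)) \<le> G (q(j := Some e))" for q j e
        unfolding G_def using a Xmono by (intro monoD[of g]) (auto simp: le_fun_def)
      \<comment> \<open>Disjointness of \<open>I\<close> and \<open>J\<close> enters here: picking
        \<open>e\<close> instead of nothing can change an indicator of at most one of the two
        sets.\<close>
      show "(\<forall>q. F (q(j := Some e)) = F (q(j := None))) \<or> (\<forall>q. G (q(j := Some e)) = G (q(j := None)))" for j e
      proof (cases "e \<in> I")
        case True
        then have "e \<notin> J" using a by auto
        then have "G (q(j := Some e)) = G (q(j := None))" for q
          unfolding G_def by (intro arg_cong[of _ _ g] restrict_ext Xeq[symmetric]) auto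
        then show ?thesis by blast
      next
        case False
        then have "F (q(j := Some e)) = F (q(j := None))" for q
          unfolding F_def by (intro arg_cong[of _ _ f] restrict_ext Xeq[symmetric]) auto
        then show ?thesis by blast
      qed
    qed (auto simp: lessThan_empty_iff)
    then show "(\<integral>x. f (\<lambda>i\<in>I. X i (\<pi> (read nb w x))) * g (\<lambda>j\<in>J. X j (\<pi> (read nb w x))) \<partial>fair_bits)
       \<le> (\<integral>x. f (\<lambda>i\<in>I. X i (\<pi> (read nb w x))) \<partial>fair_bits) * (\<integral>x. g (\<lambda>j\<in>J. X j (\<pi> (read nb w x))) \<partial>fair_bits)"
      unfolding F_def G_def integral_fair_bits_read[symmetric] .
  qed
qed

end

section \<open>Limited independence\<close>

text \<open>Expanding the product leaves joint probabilities of at most \<open>k\<close> of the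
  events, all given by the hypothesis. The right-hand side no longer mentions the distribution,
  which is the point: any two families with this property have equal moments.\<close>

lemma expectation_prod_centered:
  fixes M :: "'a pmf" and B :: "'e \<Rightarrow> 'a \<Rightarrow> bool" and p :: real
  assumes fin: "finite (set_pmf M)"
    and indep: "\<And>A. A \<subseteq> E \<Longrightarrow> card A \<le> k \<Longrightarrow> finite A \<Longrightarrow> measure_pmf.prob M {\<omega>. \<forall>e\<in>A. B e \<omega>} = p ^ card A"
    and f: "\<And>i. i < k \<Longrightarrow> f i \<in> E"
  shows "measure_pmf.expectation M (\<lambda>\<omega>. \<Prod>i<k. of_bool (B (f i) \<omega>) - p) =
    (\<Sum>X\<in>Pow {..<k}. p ^ card (f ` X) * (- p) ^ card ({..<k} - X))"
proof -
  have int: "integrable (measure_pmf M) h" for h :: "'a \<Rightarrow> real" using fin by (rule integrable_measure_pmf_finite)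
  have "(\<Prod>i<k. of_bool (B (f i) \<omega>) - p) =
    (\<Sum>X\<in>Pow {..<k}. indicator {\<omega>. \<forall>e\<in>f ` X. B e \<omega>} \<omega> * (- p) ^ card ({..<k} - X))" for \<omega>
  proof -
    have "(\<Prod>i<k. of_bool (B (f i) \<omega>) - p) = (\<Prod>i<k. of_bool (B (f i) \<omega>) + (- p))" by simp
    also have "\<dots> = (\<Sum>X\<in>Pow {..<k}. (\<Prod>i\<in>X. of_bool (B (f i) \<omega>)) * (\<Prod>i\<in>{..<k} - X. - p))"
      by (rule prod_add) simp
    also have "\<dots> = (\<Sum>X\<in>Pow {..<k}. indicator {\<omega>. \<forall>e\<in>f ` X. B e \<omega>} \<omega> * (- p) ^ card ({..<k} - X))"
    proof (rule sum.cong[OF refl])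
      fix X assume "X \<in> Pow {..<k}"
      then have "finite X" by (auto intro: finite_subset)
      then have "(\<Prod>i\<in>X. of_bool (B (f i) \<omega>)) = (indicator {\<omega>. \<forall>e\<in>f ` X. B e \<omega>} \<omega> :: real)"
        by (induction X rule: finite_induct) (auto simp: indicator_def)
      then show "(\<Prod>i\<in>X. of_bool (B (f i) \<omega>)) * (\<Prod>i\<in>{..<k} - X. - p) =
        indicator {\<omega>. \<forall>e\<in>f ` X. B e \<omega>} \<omega> * (- p) ^ card ({..<k} - X)" by simp
    qed
    finally show ?thesis .
  qed
  then have "measure_pmf.expectation M (\<lambda>\<omega>. \<Prod>i<k. of_bool (B (f i) \<omega>) - p) =
    measure_pmf.expectation M (\<lambda>\<omega>. \<Sum>X\<in>Pow {..<k}. indicator {\<omega>. \<forall>e\<in>f ` X. B e \<omega>} \<omega> * (- p) ^ card ({..<k} - X))"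
    by (simp only:)
  also have "\<dots> = (\<Sum>X\<in>Pow {..<k}. measure_pmf.prob M {\<omega>. \<forall>e\<in>f ` X. B e \<omega>} * (- p) ^ card ({..<k} - X))"
    using int by (subst Bochner_Integration.integral_sum) auto
  also have "\<dots> = (\<Sum>X\<in>Pow {..<k}. p ^ card (f ` X) * (- p) ^ card ({..<k} - X))"
  proof (rule sum.cong[OF refl])
    fix X assume X: "X \<in> Pow {..<k}"
    then have fX: "finite X" by (auto intro: finite_subset)
    have "card (f ` X) \<le> card X" using fX by (rule card_image_le)
    also have "\<dots> \<le> k" using X card_mono[of "{..<k}" X] by auto
    finally have "measure_pmf.prob M {\<omega>. \<forall>e\<in>f ` X. B e \<omega>} = p ^ card (f ` X)"
      using X f fX by (intro indep) auto
    then show "measure_pmf.prob M {\<omega>. \<forall>e\<in>f ` X. B e \<omega>} * (- p) ^ card ({..<k} - X) = p ^ card (f ` X) * (- p) ^ card ({..<k} - X)" by simp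
  qed
  finally show ?thesis .
qed

text \<open>The same formula holds for fully independent indicators, so a moment up to the order of
  independence may be computed in the product distribution, where exponential moments are
  available.\<close>

lemma expectation_power_centered:
  fixes M :: "'a pmf" and B :: "'e \<Rightarrow> 'a \<Rightarrow> bool" and p :: real
  assumes fin: "finite (set_pmf M)" and E: "finite E"
    and indep: "\<And>A. A \<subseteq> E \<Longrightarrow> card A \<le> k \<Longrightarrow> finite A \<Longrightarrow> measure_pmf.prob M {\<omega>. \<forall>e\<in>A. B e \<omega>} = p ^ card A"
  shows "measure_pmf.expectation M (\<lambda>\<omega>. (\<Sum>e\<in>E. of_bool (B e \<omega>) - p) ^ k) =
    (\<Sum>f\<in>PiE {..<k} (\<lambda>_. E). \<Sum>X\<in>Pow {..<k}. p ^ card (f ` X) * (- p) ^ card ({..<k} - X))"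
proof -
  have int: "integrable (measure_pmf M) h" for h :: "'a \<Rightarrow> real" using fin by (rule integrable_measure_pmf_finite)
  have "(\<Sum>e\<in>E. of_bool (B e \<omega>) - p) ^ k = (\<Sum>f\<in>PiE {..<k} (\<lambda>_. E). \<Prod>i<k. of_bool (B (f i) \<omega>) - p)" for \<omega>
  proof -
    have "(\<Sum>e\<in>E. of_bool (B e \<omega>) - p) ^ k = (\<Prod>i<k. \<Sum>e\<in>E. of_bool (B e \<omega>) - p)" by simp
    also have "\<dots> = (\<Sum>f\<in>PiE {..<k} (\<lambda>_. E). \<Prod>i<k. of_bool (B (f i) \<omega>) - p)"
      using E by (intro prod_sum_PiE) auto
    finally show ?thesis .
  qed
  then have "measure_pmf.expectation M (\<lambda>\<omega>. (\<Sum>e\<in>E. of_bool (B e \<omega>) - p) ^ k) =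
    measure_pmf.expectation M (\<lambda>\<omega>. \<Sum>f\<in>PiE {..<k} (\<lambda>_. E). \<Prod>i<k. of_bool (B (f i) \<omega>) - p)" by (simp only:)
  also have "\<dots> = (\<Sum>f\<in>PiE {..<k} (\<lambda>_. E). measure_pmf.expectation M (\<lambda>\<omega>. \<Prod>i<k. of_bool (B (f i) \<omega>) - p))"
    using int by (intro Bochner_Integration.integral_sum)
  also have "\<dots> = (\<Sum>f\<in>PiE {..<k} (\<lambda>_. E). \<Sum>X\<in>Pow {..<k}. p ^ card (f ` X) * (- p) ^ card ({..<k} - X))"
    by (intro sum.cong refl expectation_prod_centered[OF fin indep]) (auto simp: PiE_iff)
  finally show ?thesis .
qed

section \<open>Even moments of sums of independent indicators\<close>

lemma exp_le_quadratic:
  fixes x :: real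
  assumes "\<bar>x\<bar> \<le> 1"
  shows "exp x \<le> 1 + x + x\<^sup>2"
proof (cases "x \<ge> 0")
  case True
  then show ?thesis using exp_bound[of x] assms by simp
next
  case False
  \<comment> \<open>For negative arguments the bound is inverted:
    \<open>(1 - y + y\<^sup>2) * exp y \<ge> 1\<close> follows from the quadratic Taylor bound for
    \<open>exp y\<close>.\<close>
  define y where "y = - x"
  have y: "0 \<le> y" "y \<le> 1" using False assms by (auto simp: y_def)
  have pos: "0 < 1 - y + y\<^sup>2"
  proof -
    have "1 - y + y\<^sup>2 = (y - 1 / 2)\<^sup>2 + 3 / 4" by (simp add: power2_eq_square algebra_simps)
    then show ?thesis by (simp add: add_nonneg_pos)
  qed
  have "1 \<le> (1 - y + y\<^sup>2) * (1 + y + y\<^sup>2 / 2)"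
  proof -
    have "(1 - y + y\<^sup>2) * (1 + y + y\<^sup>2 / 2) = 1 + y\<^sup>2 / 2 + y ^ 3 / 2 + y ^ 4 / 2"
      by (simp add: power2_eq_square power3_eq_cube power4_eq_xxxx algebra_simps add_divide_distrib diff_divide_distrib)
    then show ?thesis using y by simp
  qed
  also have "\<dots> \<le> (1 - y + y\<^sup>2) * exp y"
    using pos exp_lower_Taylor_quadratic[OF y(1)] by (intro mult_left_mono) auto
  finally have "exp (- y) \<le> 1 - y + y\<^sup>2" by (simp add: exp_minus field_simps)
  then show ?thesis by (simp add: y_def)
qed

text \<open>One term of the exponential series is at most the sum.\<close>

lemma power_le_fact_exp:
  fixes x :: real
  assumes "0 \<le> x"
  shows "x ^ k \<le> fact k * exp x"
proof -
  have "(\<Sum>n\<in>{k}. x ^ n /\<^sub>R fact n) \<le> (\<Sum>n. x ^ n /\<^sub>R fact n)"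
    using assms summable_exp_generic[of x] by (intro sum_le_suminf) auto
  then have "x ^ k / fact k \<le> exp x" by (simp add: exp_def divide_inverse mult.commute)
  then show ?thesis by (simp add: field_simps)
qed

lemma expectation_exp_bernoulli:
  fixes p \<theta> :: real
  assumes p: "0 \<le> p" "p \<le> 1" and \<theta>: "\<bar>\<theta>\<bar> \<le> 1"
  shows "measure_pmf.expectation (bernoulli_pmf p) (\<lambda>b. exp (\<theta> * (of_bool b - p))) \<le> exp (p * \<theta>\<^sup>2)"
proof -
  have "measure_pmf.expectation (bernoulli_pmf p) (\<lambda>b. exp (\<theta> * (of_bool b - p))) =
    exp (\<theta> * (1 - p)) * p + exp (\<theta> * (0 - p)) * (1 - p)"
    using p by (subst integral_bernoulli_pmf) auto
  also have "\<dots> = exp (- \<theta> * p) * (1 + p * (exp \<theta> - 1))"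
    by (simp add: algebra_simps exp_diff exp_minus field_simps)
  also have "\<dots> \<le> exp (- \<theta> * p) * exp (p * (exp \<theta> - 1))"
    by (intro mult_left_mono exp_ge_add_one_self) auto
  also have "\<dots> = exp (p * (exp \<theta> - 1 - \<theta>))" by (simp add: exp_add[symmetric] algebra_simps)
  also have "\<dots> \<le> exp (p * \<theta>\<^sup>2)"
    using exp_le_quadratic[OF \<theta>] p by (simp add: mult_left_mono)
  finally show ?thesis .
qed

definition bernoulli_product :: "'e set \<Rightarrow> real \<Rightarrow> ('e \<Rightarrow> bool) pmf" where
  "bernoulli_product E p = Pi_pmf E False (\<lambda>_. bernoulli_pmf p)"

lemma finite_set_bernoulli_product: "finite E \<Longrightarrow> finite (set_pmf (bernoulli_product E p))"
  unfolding bernoulli_product_def by (simp add: set_Pi_pmf finite_PiE_dflt)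

lemma prob_bernoulli_product:
  assumes E: "finite E" and A: "A \<subseteq> E" and p: "0 \<le> p" "p \<le> 1"
  shows "measure_pmf.prob (bernoulli_product E p) {\<omega>. \<forall>e\<in>A. \<omega> e} = p ^ card A"
proof -
  have "measure_pmf.prob (bernoulli_product E p) {\<omega>. \<forall>e\<in>A. \<omega> e} =
    measure_pmf.prob (bernoulli_product E p) (Pi E (\<lambda>e. if e \<in> A then {True} else UNIV))"
  proof (intro arg_cong[of _ _ "measure_pmf.prob _"] set_eqI iffI)
    fix \<omega> assume *: "\<omega> \<in> Pi E (\<lambda>e. if e \<in> A then {True} else UNIV)"
    have "\<omega> e" if "e \<in> A" for e using Pi_mem[OF *, of e] A that by auto
    then show "\<omega> \<in> {\<omega>. \<forall>e\<in>A. \<omega> e}" by simp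
  qed auto
  also have "\<dots> = (\<Prod>e\<in>E. measure_pmf.prob (bernoulli_pmf p) (if e \<in> A then {True} else UNIV))"
    unfolding bernoulli_product_def using E by (rule measure_Pi_pmf_Pi)
  also have "\<dots> = (\<Prod>e\<in>E. if e \<in> A then p else 1)"
    using p by (intro prod.cong) (auto simp: measure_pmf_single)
  also have "\<dots> = p ^ card A" using E A by (simp add: prod.If_cases Int_absorb1)
  finally show ?thesis .
qed

lemma expectation_exp_bernoulli_product:
  fixes p \<theta> :: real
  assumes E: "finite E" and p: "0 \<le> p" "p \<le> 1" and \<theta>: "\<bar>\<theta>\<bar> \<le> 1"
  shows "measure_pmf.expectation (bernoulli_product E p) (\<lambda>\<omega>. exp (\<theta> * (\<Sum>e\<in>E. of_bool (\<omega> e) - p)))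
    \<le> exp (card E * p * \<theta>\<^sup>2)"
proof -
  have "measure_pmf.expectation (bernoulli_product E p) (\<lambda>\<omega>. exp (\<theta> * (\<Sum>e\<in>E. of_bool (\<omega> e) - p))) =
    measure_pmf.expectation (bernoulli_product E p) (\<lambda>\<omega>. \<Prod>e\<in>E. exp (\<theta> * (of_bool (\<omega> e) - p)))"
    using E by (simp add: sum_distrib_left exp_sum)
  also have "\<dots> = (\<Prod>e\<in>E. measure_pmf.expectation (bernoulli_pmf p) (\<lambda>b. exp (\<theta> * (of_bool b - p))))"
    unfolding bernoulli_product_def using E
    by (intro expectation_prod_Pi_pmf) (auto intro: integrable_measure_pmf_finite)
  also have "\<dots> \<le> (\<Prod>e\<in>E. exp (p * \<theta>\<^sup>2))"
    using expectation_exp_bernoulli[OF p \<theta>] by (intro prod_mono) auto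
  also have "\<dots> = exp (card E * p * \<theta>\<^sup>2)" by (simp add: exp_of_nat_mult[symmetric] mult.assoc)
  finally show ?thesis .
qed

text \<open>A \<open>k\<close>-th power is dominated by
  \<open>exp (\<theta> * y) + exp (- \<theta> * y)\<close> up to the factor
  \<open>fact k / \<theta> ^ k\<close>, and each exponential moment is at most
  \<open>exp (\<mu> * \<theta>\<^sup>2)\<close>. The two exponentials give the factor 2; the 9
  bounds \<open>exp 2\<close> through \<open>exp 1 \<le> 3\<close>.\<close>

lemma moment_bernoulli_product:
  fixes p :: real
  assumes E: "finite E" and p: "0 \<le> p" "p \<le> 1" and h: "0 < h" and k: "k = 2 * h"
    and \<mu>: "\<mu> = card E * p" "k \<le> \<mu>"
  shows "measure_pmf.expectation (bernoulli_product E p) (\<lambda>\<omega>. (\<Sum>e\<in>E. of_bool (\<omega> e) - p) ^ k) \<le> 2 * (9 * real k * \<mu>) ^ h"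
proof -
  have \<mu>0: "\<mu> > 0" using \<mu> h k by linarith
  \<comment> \<open>This choice makes the exponential moment \<open>exp k\<close>; it is at most 1,
    as the moment bound requires, because \<open>k \<le> \<mu>\<close>.\<close>
  define \<theta> where "\<theta> = sqrt (k / \<mu>)"
  have k0: "real k > 0" using h k by simp
  have \<theta>2: "\<theta>\<^sup>2 = k / \<mu>" using \<mu>0 by (simp add: \<theta>_def)
  have \<theta>0: "\<theta> > 0" using \<mu>0 k0 by (simp add: \<theta>_def)
  have \<theta>1: "\<theta> \<le> 1" using \<mu> \<mu>0 by (simp add: \<theta>_def)
  have \<theta>k: "\<theta> ^ k = (k / \<mu>) ^ h" by (simp add: k power_mult \<theta>2)
  have int: "integrable (measure_pmf (bernoulli_product E p)) g" for g :: "_ \<Rightarrow> real"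
    using finite_set_bernoulli_product[OF E] by (rule integrable_measure_pmf_finite)
  have pw: "y ^ k \<le> (fact k / \<theta> ^ k) * (exp (\<theta> * y) + exp (- \<theta> * y))" for y :: real
  proof -
    have "y ^ k = \<bar>y\<bar> ^ k" by (simp add: k power_mult)
    also have "\<theta> ^ k * \<bar>y\<bar> ^ k = (\<theta> * \<bar>y\<bar>) ^ k" by (simp add: power_mult_distrib)
    then have "\<bar>y\<bar> ^ k = (\<theta> * \<bar>y\<bar>) ^ k / \<theta> ^ k" using \<theta>0 by (simp add: field_simps)
    also have "\<dots> \<le> fact k * exp (\<theta> * \<bar>y\<bar>) / \<theta> ^ k"
      using \<theta>0 by (intro divide_right_mono power_le_fact_exp) auto
    also have "exp (\<theta> * \<bar>y\<bar>) \<le> exp (\<theta> * y) + exp (- \<theta> * y)"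
      by (cases "y \<ge> 0") (auto simp: add_increasing add_increasing2)
    then have "fact k * exp (\<theta> * \<bar>y\<bar>) / \<theta> ^ k \<le> fact k * (exp (\<theta> * y) + exp (- \<theta> * y)) / \<theta> ^ k"
      using \<theta>0 by (intro divide_right_mono mult_left_mono) auto
    finally show ?thesis by simp
  qed
  let ?Y = "\<lambda>\<omega>. \<Sum>e\<in>E. of_bool (\<omega> e) - p"
  have "measure_pmf.expectation (bernoulli_product E p) (\<lambda>\<omega>. ?Y \<omega> ^ k) \<le>
    measure_pmf.expectation (bernoulli_product E p) (\<lambda>\<omega>. (fact k / \<theta> ^ k) * (exp (\<theta> * ?Y \<omega>) + exp (- \<theta> * ?Y \<omega>)))"
    using int pw by (intro integral_mono)
  also have "\<dots> = (fact k / \<theta> ^ k) * (measure_pmf.expectation (bernoulli_product E p) (\<lambda>\<omega>. exp (\<theta> * ?Y \<omega>)) +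
     measure_pmf.expectation (bernoulli_product E p) (\<lambda>\<omega>. exp (- \<theta> * ?Y \<omega>)))"
    using int by simp
  also have "\<dots> \<le> (fact k / \<theta> ^ k) * (exp (card E * p * \<theta>\<^sup>2) + exp (card E * p * (- \<theta>)\<^sup>2))"
    using \<theta>0 \<theta>1 expectation_exp_bernoulli_product[OF E p, of \<theta>] expectation_exp_bernoulli_product[OF E p, of "- \<theta>"]
    by (intro mult_left_mono add_mono) auto
  also have "\<dots> = 2 * (fact k / \<theta> ^ k * exp k)" using \<mu>0 by (simp add: \<mu>(1)[symmetric] \<theta>2)
  also have "\<dots> \<le> 2 * (9 * real k * \<mu>) ^ h"
  proof -
    have "fact k \<le> real (k ^ k)" by (rule fact_le_power)
    also have "real (k ^ k) = (real k * real k) ^ h" unfolding k by (simp add: power_mult power2_eq_square)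
    finally have 1: "fact k \<le> (real k * real k) ^ h" .
    have "exp (real k) = (exp 1 * exp 1) ^ h" by (simp add: k exp_of_nat_mult[symmetric] exp_add[symmetric] mult.commute)
    also have "\<dots> \<le> (3 * 3) ^ h" by (intro power_mono mult_mono exp_le) auto
    finally have 2: "exp (real k) \<le> 9 ^ h" by simp
    have "fact k / \<theta> ^ k * exp k \<le> (real k * real k) ^ h / (k / \<mu>) ^ h * 9 ^ h"
      unfolding \<theta>k using 1 2 k0 \<mu>0 by (intro mult_mono divide_right_mono) auto
    also have "\<dots> = ((real k * real k) / (k / \<mu>) * 9) ^ h" by (simp add: power_mult_distrib power_divide)
    also have "(real k * real k) / (k / \<mu>) * 9 = 9 * real k * \<mu>" using k0 \<mu>0 by (simp add: field_simps)
    finally show ?thesis by simp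
  qed
  finally show ?thesis .
qed

text \<open>Markov's inequality for the \<open>k\<close>-th power of the deviation, \<open>k\<close>
  even, with the moment transferred to independent indicators. The constant 36 is
  \<open>4 * 9\<close>, which turns the base of the \<open>h\<close>-th power into
  \<open>1 / 4\<close>.\<close>

lemma limited_independence_tail:
  fixes M :: "'a pmf" and B :: "'e \<Rightarrow> 'a \<Rightarrow> bool" and p \<delta> \<mu> :: real
  assumes fin: "finite (set_pmf M)" and E: "finite E" and p: "0 \<le> p" "p \<le> 1"
    and h: "0 < h" and k: "k = 2 * h"
    and indep: "\<And>A. A \<subseteq> E \<Longrightarrow> card A \<le> k \<Longrightarrow> finite A \<Longrightarrow> measure_pmf.prob M {\<omega>. \<forall>e\<in>A. B e \<omega>} = p ^ card A"
    and \<mu>: "\<mu> = card E * p" and \<delta>: "0 < \<delta>" "\<delta> \<le> 1" and large: "36 * real k \<le> \<delta>\<^sup>2 * \<mu>"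
  shows "measure_pmf.prob M {\<omega>. \<delta> * \<mu> \<le> \<bar>card {e\<in>E. B e \<omega>} - \<mu>\<bar>} \<le> 2 * (1 / 4) ^ h"
proof -
  have \<delta>2: "\<delta>\<^sup>2 \<le> 1" using \<delta> by (simp add: power_le_one)
  have \<mu>0: "0 \<le> \<mu>" using p by (simp add: \<mu>)
  have "\<delta>\<^sup>2 * \<mu> \<le> 1 * \<mu>" using \<delta>2 \<mu>0 by (rule mult_right_mono)
  then have k\<mu>: "k \<le> \<mu>" using large by linarith
  then have \<mu>1: "0 < \<mu>" using h k by linarith
  have int: "integrable (measure_pmf M) g" for g :: "_ \<Rightarrow> real" using fin by (rule integrable_measure_pmf_finite)
  let ?Y = "\<lambda>\<omega>. \<Sum>e\<in>E. of_bool (B e \<omega>) - p"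
  have Y: "?Y \<omega> = card {e\<in>E. B e \<omega>} - \<mu>" for \<omega>
    using E by (simp add: sum_subtractf \<mu> Int_def)
  define c where "c = (\<delta> * \<mu>) ^ k"
  have c0: "c > 0" using \<delta> \<mu>1 by (simp add: c_def)
  let ?A = "{\<omega>. \<delta> * \<mu> \<le> \<bar>card {e\<in>E. B e \<omega>} - \<mu>\<bar>}"
  have "measure_pmf.prob M ?A * c = measure_pmf.expectation M (\<lambda>\<omega>. indicator ?A \<omega> * c)" by simp
  also have "\<dots> \<le> measure_pmf.expectation M (\<lambda>\<omega>. ?Y \<omega> ^ k)"
  proof (intro integral_mono int)
    fix \<omega>
    have "?Y \<omega> ^ k = \<bar>?Y \<omega>\<bar> ^ k" by (simp add: k power_mult)
    moreover have "c \<le> \<bar>?Y \<omega>\<bar> ^ k" if "\<omega> \<in> ?A" unfolding c_def Y using that \<delta> \<mu>0 by (intro power_mono) auto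
    ultimately show "indicator ?A \<omega> * c \<le> ?Y \<omega> ^ k" by (auto simp: indicator_def)
  qed
  also have "\<dots> = measure_pmf.expectation (bernoulli_product E p) (\<lambda>\<omega>. (\<Sum>e\<in>E. of_bool (\<omega> e) - p) ^ k)"
  proof -
    have "measure_pmf.expectation M (\<lambda>\<omega>. (\<Sum>e\<in>E. of_bool (B e \<omega>) - p) ^ k) =
      (\<Sum>f\<in>PiE {..<k} (\<lambda>_. E). \<Sum>X\<in>Pow {..<k}. p ^ card (f ` X) * (- p) ^ card ({..<k} - X))"
      by (rule expectation_power_centered[OF fin E]) (rule indep)
    moreover have "measure_pmf.expectation (bernoulli_product E p) (\<lambda>\<omega>. (\<Sum>e\<in>E. of_bool (\<omega> e) - p) ^ k) =
      (\<Sum>f\<in>PiE {..<k} (\<lambda>_. E). \<Sum>X\<in>Pow {..<k}. p ^ card (f ` X) * (- p) ^ card ({..<k} - X))"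
      by (rule expectation_power_centered[OF finite_set_bernoulli_product[OF E] E]) (rule prob_bernoulli_product[OF E _ p])
    ultimately show ?thesis by (simp only:)
  qed
  also have "\<dots> \<le> 2 * (9 * real k * \<mu>) ^ h" by (rule moment_bernoulli_product[OF E p h k \<mu> k\<mu>])
  finally have "measure_pmf.prob M ?A \<le> 2 * (9 * real k * \<mu>) ^ h / c" using c0 by (simp add: field_simps)
  also have "\<dots> = 2 * ((9 * real k * \<mu>) / (\<delta> * \<mu>)\<^sup>2) ^ h" by (simp add: c_def k power_mult power_divide)
  also have "\<dots> \<le> 2 * (1 / 4) ^ h"
  proof -
    have "36 * real k * \<mu> \<le> \<delta>\<^sup>2 * \<mu> * \<mu>" using large \<mu>0 by (rule mult_right_mono)
    then have "(9 * real k * \<mu>) / (\<delta> * \<mu>)\<^sup>2 \<le> 1 / 4" using \<delta> \<mu>1 by (simp add: divide_simps power2_eq_square)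
    then show ?thesis using \<mu>0 by (intro mult_left_mono power_mono) auto
  qed
  finally show ?thesis .
qed

section \<open>Uniform digits and conditioning on part of the table\<close>

lemma card_residue: "0 < (a::nat) \<Longrightarrow> c < a \<Longrightarrow> card {y. y < a * k \<and> y mod a = c} = k"
proof -
  assume a: "0 < a" "c < a"
  have "{y. y < a * k \<and> y mod a = c} = (\<lambda>j. c + a * j) ` {..<k}"
  proof (intro set_eqI iffI)
    fix y assume "y \<in> {y. y < a * k \<and> y mod a = c}"
    then have y: "y < a * k" "y mod a = c" by auto
    then have "y div a < k" using a by (simp add: less_mult_imp_div_less mult.commute)
    moreover have "y = c + a * (y div a)" using y(2) by auto
    ultimately show "y \<in> (\<lambda>j. c + a * j) ` {..<k}" by blast
  next
    fix y assume "y \<in> (\<lambda>j. c + a * j) ` {..<k}"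
    then obtain j where j: "y = c + a * j" "j < k" by auto
    have "a * Suc j \<le> a * k" using j(2) by (intro mult_le_mono2) simp
    then show "y \<in> {y. y < a * k \<and> y mod a = c}" using a j by auto
  qed
  moreover have "inj_on (\<lambda>j. c + a * j) {..<k}" using a by (auto simp: inj_on_def)
  ultimately show ?thesis by (simp add: card_image)
qed

lemma card_shifted_residue:
  assumes "b \<le> w" "x < 2 ^ b"
  shows "card {y. y < 2 ^ w \<and> (y + r) mod 2 ^ b = (x :: nat)} = 2 ^ (w - b)"
proof -
  define a :: nat where "a = 2 ^ b"
  \<comment> \<open>The residue of \<open>x - r\<close>, written without negative numbers.\<close>
  define c where "c = (x + (a - r mod a)) mod a"
  have a: "0 < a" "x < a" using assms by (auto simp: a_def)
  have "(y + r) mod a = x \<longleftrightarrow> y mod a = c" for y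
  proof
    assume "(y + r) mod a = x"
    then have "c = ((y + r) mod a + (a - r mod a)) mod a" by (simp add: c_def)
    also have "\<dots> = (y + (r + (a - r mod a))) mod a" by (simp add: mod_add_left_eq add.assoc)
    also have "r + (a - r mod a) = a * (r div a) + a"
      using a mod_less_divisor[of a r] mult_div_mod_eq[of a r] by linarith
    also have "y + (a * (r div a) + a) = y + a * (r div a + 1)" by simp
    finally show "y mod a = c" by (simp only: mod_mult_self2)
  next
    assume "y mod a = c"
    then have "(y + r) mod a = (c + r) mod a" by (metis mod_add_left_eq)
    also have "\<dots> = (x + ((a - r mod a) + r)) mod a" by (simp add: c_def mod_add_left_eq add.assoc)
    also have "(a - r mod a) + r = a * (r div a) + a"
      using a mod_less_divisor[of a r] mult_div_mod_eq[of a r] by linarith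
    also have "x + (a * (r div a) + a) = x + a * (r div a + 1)" by simp
    finally show "(y + r) mod a = x" using a by (simp only: mod_mult_self2 mod_less)
  qed
  moreover have "(2 :: nat) ^ w = a * 2 ^ (w - b)" using assms by (simp add: a_def power_add[symmetric])
  ultimately show ?thesis
    using card_residue[of a c "2 ^ (w - b)"] a by (simp add: a_def[symmetric] c_def)
qed

lemma prob_as_expectation: "measure_pmf.prob M {f. Q f} = measure_pmf.expectation M (\<lambda>f. of_bool (Q f))"
proof -
  have "(\<lambda>f. of_bool (Q f)) = (indicator {f. Q f} :: _ \<Rightarrow> real)" by (auto simp: fun_eq_iff indicator_def)
  then show ?thesis by simp
qed

text \<open>The one-time pad argument: with all other coordinates fixed, \<open>r f\<close> is a
  constant shift and the uniform word \<open>f i\<close> hides it.\<close>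

lemma prob_uniform_coordinate:
  assumes i: "i < N" and b: "b \<le> w" "x < 2 ^ b"
    and r: "\<And>f v. r (f(i := v)) = r f" and Q: "\<And>f v. Q (f(i := v)) = Q f"
  shows "measure_pmf.prob (words N w) {f. (f i + r f) mod 2 ^ b = x \<and> Q f} = measure_pmf.prob (words N w) {f. Q f} / 2 ^ b"
proof -
  define J where "J = {..<N} - {i}"
  define U where "U = pmf_of_set {..<2 ^ w :: nat}"
  have J: "{..<N} = insert i J" "finite J" "i \<notin> J" using i by (auto simp: J_def)
  have fU: "finite (set_pmf U)" by (simp add: U_def lessThan_empty_iff)
  have E: "measure_pmf.expectation (words N w) F = measure_pmf.expectation (Pi_pmf J 0 (\<lambda>_. U)) (\<lambda>z. measure_pmf.expectation U (\<lambda>y. F (z(i := y))))" for F :: "_ \<Rightarrow> real"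
    unfolding words_def U_def[symmetric] J(1) by (rule expectation_Pi_pmf_insert[OF J(2,3)]) (rule fU)
  have u: "measure_pmf.expectation U (\<lambda>y. of_bool ((y + c) mod 2 ^ b = x)) = (1 / 2 ^ b :: real)" for c
  proof -
    have "measure_pmf.expectation U (\<lambda>y. of_bool ((y + c) mod 2 ^ b = x)) = measure_pmf.prob U {y. (y + c) mod 2 ^ b = x}"
      by (rule prob_as_expectation[symmetric])
    also have "\<dots> = card ({..<2 ^ w} \<inter> {y. (y + c) mod 2 ^ b = x}) / card {..<2 ^ w :: nat}"
      unfolding U_def by (rule measure_pmf_of_set) (auto simp: lessThan_empty_iff)
    also have "{..<2 ^ w} \<inter> {y. (y + c) mod 2 ^ b = x} = {y. y < 2 ^ w \<and> (y + c) mod 2 ^ b = x}" by auto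
    also have "card \<dots> = 2 ^ (w - b)" by (rule card_shifted_residue[OF b])
    also have "real (2 ^ (w - b)) / card {..<2 ^ w :: nat} = 1 / 2 ^ b"
    proof -
      have "(2 :: real) ^ w = 2 ^ (w - b) * 2 ^ b" using b by (simp add: power_add[symmetric])
      then show ?thesis by simp
    qed
    finally show ?thesis .
  qed
  have "measure_pmf.prob (words N w) {f. (f i + r f) mod 2 ^ b = x \<and> Q f} =
    measure_pmf.expectation (Pi_pmf J 0 (\<lambda>_. U)) (\<lambda>z. measure_pmf.expectation U (\<lambda>y. of_bool ((y + r z) mod 2 ^ b = x \<and> Q z)))"
    unfolding prob_as_expectation E by (simp add: r Q)
  also have "\<dots> = measure_pmf.expectation (Pi_pmf J 0 (\<lambda>_. U)) (\<lambda>z. of_bool (Q z) / 2 ^ b)"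
  proof (rule Bochner_Integration.integral_cong[OF refl])
    fix z show "measure_pmf.expectation U (\<lambda>y. of_bool ((y + r z) mod 2 ^ b = x \<and> Q z)) = (of_bool (Q z) / 2 ^ b :: real)"
      by (cases "Q z") (simp_all add: u)
  qed
  also have "\<dots> = measure_pmf.expectation (Pi_pmf J 0 (\<lambda>_. U)) (\<lambda>z. of_bool (Q z)) / 2 ^ b" by simp
  also have "measure_pmf.expectation (Pi_pmf J 0 (\<lambda>_. U)) (\<lambda>z. of_bool (Q z)) = measure_pmf.prob (words N w) {f. Q f}"
    unfolding prob_as_expectation E by (simp add: Q)
  finally show ?thesis .
qed

text \<open>Fubini for the coordinates below and above \<open>N1\<close>. The set \<open>c f\<close>
  is random but determined by the first part, so the bound may be applied with it frozen. It serves
  to add the rows of a sketch one at a time.\<close>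

lemma prob_independent_bound:
  assumes N: "N1 \<le> N"
    and A: "\<And>f f'. (\<And>i. i < N1 \<Longrightarrow> f i = f' i) \<Longrightarrow> A f = A f'"
    and c: "\<And>f f'. (\<And>i. i < N1 \<Longrightarrow> f i = f' i) \<Longrightarrow> c f = c f'"
    and bad: "\<And>C f f'. (\<And>i. N1 \<le> i \<Longrightarrow> f i = f' i) \<Longrightarrow> bad C f = bad C f'"
    and bound: "\<And>f. A f \<Longrightarrow> measure_pmf.prob (words N w) {g. bad (c f) g} \<le> \<beta>"
  shows "measure_pmf.prob (words N w) {f. A f \<and> bad (c f) f} \<le> \<beta> * measure_pmf.prob (words N w) {f. A f}"
proof -
  define U where "U = pmf_of_set {..<2 ^ w :: nat}"
  define P1 where "P1 = Pi_pmf {..<N1} 0 (\<lambda>_. U)"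
  define P2 where "P2 = Pi_pmf {N1..<N} 0 (\<lambda>_. U)"
  have fU: "finite (set_pmf U)" by (simp add: U_def lessThan_empty_iff)
  have fin: "finite (set_pmf P1)" "finite (set_pmf P2)" unfolding P1_def P2_def by (auto intro!: finite_set_Pi_pmf fU)
  have N': "{..<N} = {..<N1} \<union> {N1..<N}" using N by auto
  define comb where "comb f g = (\<lambda>i. if i \<in> {..<N1} then f i else g i)" for f g :: "nat \<Rightarrow> nat"
  have "words N w = map_pmf (\<lambda>(f, g). comb f g) (pair_pmf P1 P2)"
    unfolding words_def U_def[symmetric] N' P1_def P2_def comb_def by (rule Pi_pmf_union) auto
  then have E: "measure_pmf.expectation (words N w) F = measure_pmf.expectation P1 (\<lambda>f. measure_pmf.expectation P2 (\<lambda>g. F (comb f g)))" for F :: "_ \<Rightarrow> real"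
    using expectation_pair_finite[OF fin, of "\<lambda>(f, g). F (comb f g)"] by (simp add: case_prod_unfold)
  have int1: "integrable (measure_pmf P1) F" and int2: "integrable (measure_pmf P2) F" for F :: "_ \<Rightarrow> real"
    using fin by (auto intro: integrable_measure_pmf_finite)
  have Ac: "A (comb f g) = A f" "c (comb f g) = c f" for f g by (rule A c; simp add: comb_def)+
  have evc: "bad C (comb f g) = bad C g" for C f g by (rule bad) (simp add: comb_def)
  have p2: "measure_pmf.expectation P2 (\<lambda>g. of_bool (bad C g)) = measure_pmf.prob (words N w) {g. bad C g}" for C
    unfolding prob_as_expectation E by (simp add: evc)
  have "measure_pmf.prob (words N w) {f. A f \<and> bad (c f) f} =
    measure_pmf.expectation P1 (\<lambda>f. of_bool (A f) * measure_pmf.expectation P2 (\<lambda>g. of_bool (bad (c f) g)))"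
    unfolding prob_as_expectation E by (simp add: Ac evc of_bool_conj)
  also have "\<dots> \<le> measure_pmf.expectation P1 (\<lambda>f. \<beta> * of_bool (A f))"
    by (intro integral_mono int1) (use bound p2 in auto)
  also have "\<dots> = \<beta> * measure_pmf.prob (words N w) {f. A f}"
    unfolding prob_as_expectation E by (simp add: Ac)
  finally show ?thesis .
qed

section \<open>The hash functions given by lines\<close>

context layout
begin

lemma table_range: "i \<le> R \<Longrightarrow> g < i * q + q \<Longrightarrow> g < G"
proof -
  assume "i \<le> R" "g < i * q + q"
  moreover have "i * q \<le> R * q" using \<open>i \<le> R\<close> by (rule mult_le_mono1)
  moreover have "G = R * q + q" by (simp add: G_def)
  ultimately show "g < G" by linarith
qed

lemma table_address:
  assumes "edge e" "g < G"
  shows "g * Max e + Min e < P" "g * (P + Max e) + Min e = g * P + (g * Max e + Min e)"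
    "g * (P + Max e) + Min e < G * P" "(g * (P + Max e) + Min e) div P = g" "(g * (P + Max e) + Min e) mod P = g * Max e + Min e"
proof -
  have e: "Min e < n" "Max e < n" using edgeD(1,2)[OF assms(1)] by auto
  show *: "g * Max e + Min e < P" "g * (P + Max e) + Min e < G * P" using index_less[OF assms(2) e] by auto
  show eq: "g * (P + Max e) + Min e = g * P + (g * Max e + Min e)" by (simp add: algebra_simps)
  show "(g * (P + Max e) + Min e) div P = g" "(g * (P + Max e) + Min e) mod P = g * Max e + Min e"
    unfolding eq using * by auto
qed

text \<open>Two edges share an entry in at most one table, because two distinct lines
  \<open>g \<mapsto> g * Max e + Min e\<close> meet in at most one point.\<close>

lemma private_entry:
  assumes e: "edge e" and A: "finite A" "\<forall>a\<in>A. edge a" "e \<notin> A" "card A < q" and i: "i \<le> R"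
  shows "\<exists>g\<in>{i * q..<i * q + q}. \<forall>a\<in>A. g * (P + Max e) + Min e \<noteq> g * (P + Max a) + Min a"
proof (rule ccontr)
  assume "\<not> ?thesis"
  then have *: "\<forall>g\<in>{i * q..<i * q + q}. \<exists>a\<in>A. g * (P + Max e) + Min e = g * (P + Max a) + Min a" by auto
  then obtain a where a: "\<And>g. g \<in> {i * q..<i * q + q} \<Longrightarrow> a g \<in> A \<and> g * (P + Max e) + Min e = g * (P + Max (a g)) + Min (a g)" by metis
  \<comment> \<open>If every point of the block were covered, \<open>a\<close> would choose a
    covering line for each of \<open>q\<close> points; injectivity contradicts that \<open>A\<close>
    has fewer than \<open>q\<close> lines.\<close>
  have "inj_on a {i * q..<i * q + q}"
  proof (rule inj_onI)
    fix g g' assume g: "g \<in> {i * q..<i * q + q}" "g' \<in> {i * q..<i * q + q}" "a g = a g'"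
    have l: "g * Max e + Min e = g * Max (a g) + Min (a g)" "g' * Max e + Min e = g' * Max (a g) + Min (a g)"
      using a[OF g(1)] a[OF g(2)] g(3) by (simp_all add: algebra_simps)
    show "g = g'"
    proof (rule ccontr)
      assume ne: "g \<noteq> g'"
      \<comment> \<open>Subtracting the two incidences in the integers leaves the product of the
        differences of abscissae and of slopes.\<close>
      have "int g * int (Max e) + int (Min e) = int g * int (Max (a g)) + int (Min (a g))"
        "int g' * int (Max e) + int (Min e) = int g' * int (Max (a g)) + int (Min (a g))"
        using l by (metis of_nat_add of_nat_mult)+
      then have "(int g - int g') * (int (Max e) - int (Max (a g))) = 0" by (simp add: algebra_simps)
      then have mx: "Max e = Max (a g)" using ne by simp
      then have mn: "Min e = Min (a g)" using l(1) by simp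
      have "edge (a g)" "a g \<in> A" using a[OF g(1)] A by auto
      then have "e = a g" using edgeD(3)[OF e] edgeD(3)[of "a g"] mx mn by metis
      then show False using \<open>a g \<in> A\<close> A(3) by simp
    qed
  qed
  then have "card {i * q..<i * q + q} \<le> card A"
    using a A(1) by (intro card_inj_on_le[of a]) auto
  then show False using A(4) by simp
qed

text \<open>Edges are added one at a time, each with an entry that no earlier edge reads. A common
  target \<open>x\<close> suffices, since cells and collisions are both events of this kind.\<close>

lemma hash_independent:
  assumes "finite A" "\<forall>a\<in>A. edge a" "card A \<le> q" and i: "i \<le> R" and b: "b \<le> w" "x < 2 ^ b"
  shows "measure_pmf.prob (words (G * P) w) {tab. \<forall>e\<in>A. ehash tab i e mod 2 ^ b = x} = (1 / 2 ^ b) ^ card A"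
  using assms(1-3)
proof (induction A rule: finite_induct)
  case empty
  then show ?case by simp
next
  case (insert e A)
  have e: "edge e" and A: "\<forall>a\<in>A. edge a" "card A < q" using insert by auto
  obtain g where g: "g \<in> {i * q..<i * q + q}" "\<forall>a\<in>A. g * (P + Max e) + Min e \<noteq> g * (P + Max a) + Min a"
    using private_entry[OF e insert.hyps(1) A(1) insert.hyps(2) A(2) i] by auto
  define k where "k = g * (P + Max e) + Min e"
  have gG: "g' < G" if "g' \<in> {i * q..<i * q + q}" for g' using table_range[OF i] that by auto
  have k: "k < G * P" unfolding k_def by (rule table_address(3)[OF e gG[OF g(1)]])
  define r where "r tab = (\<Sum>g'\<in>{i * q..<i * q + q} - {g}. tab (g' * (P + Max e) + Min e))" for tab :: "nat \<Rightarrow> nat"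
  have other: "g' * (P + Max a) + Min a \<noteq> k" if "edge a" "g' \<in> {i * q..<i * q + q}" "g' \<noteq> g" for g' a
    using table_address(4)[OF that(1) gG[OF that(2)]] table_address(4)[OF e gG[OF g(1)]] that(3) by (auto simp: k_def)
  have r: "r (f(k := v)) = r f" for f v
    unfolding r_def by (rule sum.cong[OF refl]) (use other[OF e] in auto)
  have Ah: "ehash (f(k := v)) i a = ehash f i a" if "a \<in> A" for f v a
  proof -
    have "g' * (P + Max a) + Min a \<noteq> k" if "g' \<in> {i * q..<i * q + q}" for g'
      using other[of a g'] A(1) \<open>a \<in> A\<close> that g(2) by (cases "g' = g") (auto simp: k_def)
    then show ?thesis unfolding ehash_def hash_def by (intro arg_cong[of _ _ "\<lambda>x. x mod 2 ^ w"] sum.cong refl) auto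
  qed
  have eh: "ehash tab i e mod 2 ^ b = (tab k + r tab) mod 2 ^ b" for tab
  proof -
    have "(\<Sum>g'\<in>{i * q..<i * q + q}. tab (g' * (P + Max e) + Min e)) = tab k + r tab"
      unfolding r_def k_def using g(1) by (intro sum.remove) auto
    then have "ehash tab i e mod 2 ^ b = (tab k + r tab) mod 2 ^ w mod 2 ^ b" by (simp only: ehash_def hash_def)
    \<comment> \<open>Overflow of the machine sum is harmless, as \<open>2 ^ b\<close> divides
      \<open>2 ^ w\<close>.\<close>
    also have "\<dots> = (tab k + r tab) mod 2 ^ b" using b by (intro mod_mod_cancel le_imp_power_dvd)
    finally show ?thesis .
  qed
  have "measure_pmf.prob (words (G * P) w) {tab. \<forall>e\<in>insert e A. ehash tab i e mod 2 ^ b = x} =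
    measure_pmf.prob (words (G * P) w) {tab. (tab k + r tab) mod 2 ^ b = x \<and> (\<forall>a\<in>A. ehash tab i a mod 2 ^ b = x)}"
    by (simp only: ball_insert eh)
  also have "\<dots> = measure_pmf.prob (words (G * P) w) {tab. \<forall>a\<in>A. ehash tab i a mod 2 ^ b = x} / 2 ^ b"
    by (rule prob_uniform_coordinate[OF k b]) (use r Ah in auto)
  also have "\<dots> = (1 / 2 ^ b) ^ card (insert e A)"
    using insert A by simp
  finally show ?case .
qed

text \<open>Hash function \<open>i\<close> reads only the \<open>i\<close>-th block of table rows.
  Different hash functions thus use disjoint parts of the table and are independent of each
  other.\<close>

lemma ehash_cong:
  assumes "edge e" "i \<le> R" "\<And>k. i * q * P \<le> k \<Longrightarrow> k < (i + 1) * q * P \<Longrightarrow> f k = f' k"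
  shows "ehash f i e = ehash f' i e"
proof -
  have "f (g * (P + Max e) + Min e) = f' (g * (P + Max e) + Min e)" if g: "g \<in> {i * q..<i * q + q}" for g
  proof (rule assms(3))
    have gG: "g < G" using table_range[OF assms(2)] g by auto
    note t = table_address[OF assms(1) gG]
    have "i * q * P \<le> g * P" using g by (intro mult_le_mono1) simp
    then show "i * q * P \<le> g * (P + Max e) + Min e" unfolding t(2) by linarith
    have "g * (P + Max e) + Min e < Suc g * P" unfolding t(2) using t(1) by simp
    also have "\<dots> \<le> (i + 1) * q * P" using g by (intro mult_le_mono1) simp
    finally show "g * (P + Max e) + Min e < (i + 1) * q * P" .
  qed
  then show ?thesis unfolding ehash_def hash_def by (intro arg_cong[of _ _ "\<lambda>x. x mod 2 ^ w"] sum.cong refl) auto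
qed

lemma prob_collision:
  assumes C: "finite C" "\<forall>e\<in>C. edge e" and i: "i < R" and W: "W = 2 ^ b" "b \<le> w" and q: "2 \<le> q"
  shows "measure_pmf.prob (words (G * P) w) {tab. \<not> inj_on (column tab i) C} \<le> (real (card C))\<^sup>2 / (2 * real W)"
proof -
  \<comment> \<open>Ordering by code lists each unordered pair once, which gives the 2 in the
    denominator. The further union over the \<open>W\<close> columns reduces a collision to two
    edges having a common given value.\<close>
  define D where "D = {(e, e') \<in> C \<times> C. eid e < eid e'}"
  have DC: "D \<subseteq> C \<times> C" by (auto simp: D_def)
  have finD: "finite D" using DC C(1) by (meson finite_SigmaI finite_subset)
  have "card D + card (prod.swap ` D) = card (D \<union> prod.swap ` D)"
    using finD by (intro card_Un_disjoint[symmetric]) (auto simp: D_def)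
  also have "\<dots> \<le> card (C \<times> C)" using DC C(1) by (intro card_mono) (auto simp: D_def)
  also have "card (prod.swap ` D) = card D" by (intro card_image) (auto simp: inj_on_def)
  finally have cD: "2 * card D \<le> card C * card C" by (simp add: card_cartesian_product)
  have sub: "{tab. \<not> inj_on (column tab i) C} \<subseteq> (\<Union>d\<in>D. \<Union>x\<in>{..<W}. {tab. \<forall>e\<in>{fst d, snd d}. ehash tab (Suc i) e mod 2 ^ b = x})"
  proof
    fix tab assume "tab \<in> {tab. \<not> inj_on (column tab i) C}"
    then obtain e e' where e: "e \<in> C" "e' \<in> C" "e \<noteq> e'" "column tab i e = column tab i e'" by (auto simp: inj_on_def)
    have "eid e \<noteq> eid e'" using eid_inj e C(2) by blast
    then have disj: "(e, e') \<in> D \<or> (e', e) \<in> D" using e by (auto simp: D_def)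
    have cW: "ehash tab (Suc i) e mod 2 ^ b < W" by (simp add: W(1))
    have eq: "ehash tab (Suc i) e' mod 2 ^ b = ehash tab (Suc i) e mod 2 ^ b"
      using e(4) unfolding column_def by (simp add: W(1)[symmetric])
    from disj show "tab \<in> (\<Union>d\<in>D. \<Union>x\<in>{..<W}. {tab. \<forall>e\<in>{fst d, snd d}. ehash tab (Suc i) e mod 2 ^ b = x})"
    proof
      assume "(e, e') \<in> D"
      then show ?thesis
        by (rule UN_I) (rule UN_I[of "ehash tab (Suc i) e mod 2 ^ b"], use cW eq in auto)
    next
      assume "(e', e) \<in> D"
      then show ?thesis
        by (rule UN_I) (rule UN_I[of "ehash tab (Suc i) e mod 2 ^ b"], use cW eq in auto)
    qed
  qed
  have one: "measure_pmf.prob (words (G * P) w) {tab. \<forall>e\<in>{fst d, snd d}. ehash tab (Suc i) e mod 2 ^ b = x} = (1 / real W)\<^sup>2"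
    if "d \<in> D" "x < W" for d x
  proof -
    have d: "fst d \<in> C" "snd d \<in> C" "fst d \<noteq> snd d" using that(1) by (auto simp: D_def)
    then have "card {fst d, snd d} = 2" by simp
    then show ?thesis
      using hash_independent[of "{fst d, snd d}" "Suc i" b x] d C(2) i q W that(2) by (simp add: power2_eq_square)
  qed
  have "measure_pmf.prob (words (G * P) w) {tab. \<not> inj_on (column tab i) C} \<le>
    measure_pmf.prob (words (G * P) w) (\<Union>d\<in>D. \<Union>x\<in>{..<W}. {tab. \<forall>e\<in>{fst d, snd d}. ehash tab (Suc i) e mod 2 ^ b = x})"
    using sub by (intro measure_pmf.finite_measure_mono) auto
  also have "\<dots> \<le> (\<Sum>d\<in>D. measure_pmf.prob (words (G * P) w) (\<Union>x\<in>{..<W}. {tab. \<forall>e\<in>{fst d, snd d}. ehash tab (Suc i) e mod 2 ^ b = x}))"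
    using finD by (intro measure_pmf.finite_measure_subadditive_finite) auto
  also have "\<dots> \<le> (\<Sum>d\<in>D. \<Sum>x<W. measure_pmf.prob (words (G * P) w) {tab. \<forall>e\<in>{fst d, snd d}. ehash tab (Suc i) e mod 2 ^ b = x})"
    by (intro sum_mono measure_pmf.finite_measure_subadditive_finite) auto
  also have "\<dots> = (\<Sum>d\<in>D. \<Sum>x<W. (1 / real W)\<^sup>2)" using one by (intro sum.cong) auto
  also have "\<dots> = card D / W" using pos by (simp add: power2_eq_square)
  also have "\<dots> \<le> (real (card C))\<^sup>2 / (2 * real W)"
  proof -
    have "2 * real (card D) \<le> (real (card C))\<^sup>2" using cD by (metis of_nat_le_iff of_nat_mult of_nat_numeral power2_eq_square)
    then show ?thesis using pos by (simp add: field_simps)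
  qed
  finally show ?thesis .
qed

text \<open>As \<open>nb * 2 ^ l\<close> is a power of two, the digits of bucket and cell together
  form one residue, and buckets and cells of all levels become instances of a single notion.\<close>

definition cell_at :: "(nat \<Rightarrow> nat) \<Rightarrow> nat set set \<Rightarrow> nat \<Rightarrow> nat \<Rightarrow> nat set set" where
  "cell_at tab E b x = {e\<in>E. ehash tab 0 e mod 2 ^ b = x}"

text \<open>The cell is determined by hash function 0 and row \<open>i\<close> by function
  \<open>i + 1\<close>, so given a small cell the rows fail independently, each with probability at
  most one half.\<close>

lemma prob_no_good_row:
  assumes E: "\<forall>e\<in>E. edge e" and W: "W = 2 ^ b'" "b' \<le> w" and q: "2 \<le> q" and c: "c\<^sup>2 \<le> W"
  shows "measure_pmf.prob (words (G * P) w)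
    {tab. card (cell_at tab E b x) \<le> c \<and> (\<forall>i<R. \<not> inj_on (column tab i) (cell_at tab E b x))} \<le> (1 / 2) ^ R"
proof -
  have finE: "finite E" using edges_card(1)[OF E] .
  have ce: "\<forall>e\<in>cell_at tab E b x. edge e" "finite (cell_at tab E b x)" for tab using E finE by (auto simp: cell_at_def)
  have cell_cong: "cell_at f E b x = cell_at f' E b x" if "\<And>k. k < q * P \<Longrightarrow> f k = f' k" for f f'
  proof -
    have "ehash f 0 e = ehash f' 0 e" if "e \<in> E" for e
      by (rule ehash_cong) (use that \<open>\<And>k. k < q * P \<Longrightarrow> f k = f' k\<close> E in auto)
    then show ?thesis by (auto simp: cell_at_def)
  qed
  have "measure_pmf.prob (words (G * P) w)
    {tab. card (cell_at tab E b x) \<le> c \<and> (\<forall>i<r. \<not> inj_on (column tab i) (cell_at tab E b x))} \<le> (1 / 2) ^ r" if "r \<le> R" for r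
    using that
  proof (induction r)
    case 0
    then show ?case by simp
  next
    case (Suc r)
    define A where "A tab \<longleftrightarrow> card (cell_at tab E b x) \<le> c \<and> (\<forall>i<r. \<not> inj_on (column tab i) (cell_at tab E b x))" for tab
    \<comment> \<open>The condition on edges is part of the event because its locality has to hold
      for every set \<open>C\<close>, not only for cells.\<close>
    define bad where "bad C tab \<longleftrightarrow> (\<forall>e\<in>C. edge e) \<and> \<not> inj_on (column tab r) C" for C tab
    have "{tab. card (cell_at tab E b x) \<le> c \<and> (\<forall>i<Suc r. \<not> inj_on (column tab i) (cell_at tab E b x))} =
      {tab. A tab \<and> bad (cell_at tab E b x) tab}" using ce(1) by (simp add: A_def bad_def All_less_Suc conj_ac)
    also have "measure_pmf.prob (words (G * P) w) \<dots> \<le> 1 / 2 * measure_pmf.prob (words (G * P) w) {tab. A tab}"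
    proof (rule prob_independent_bound[where c = "\<lambda>tab. cell_at tab E b x" and bad = bad])
      \<comment> \<open>The blocks of hash functions 0 to \<open>r\<close> decide the cell and the
        columns of rows below \<open>r\<close>; row \<open>r\<close> reads the next block.\<close>
      show "(r + 1) * q * P \<le> G * P" using Suc.prems unfolding G_def by (intro mult_le_mono1) simp
      fix f f' :: "nat \<Rightarrow> nat" assume *: "\<And>i. i < (r + 1) * q * P \<Longrightarrow> f i = f' i"
      have "q * P \<le> (r + 1) * q * P" by simp
      then show ceq: "cell_at f E b x = cell_at f' E b x" using * by (intro cell_cong) (meson less_le_trans)
      have "column f i e = column f' i e" if "i < r" "e \<in> cell_at f E b x" for i e
      proof -
        have "(Suc i + 1) * q * P \<le> (r + 1) * q * P" using that(1) by (intro mult_le_mono1) simp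
        then have "f k = f' k" if "k < (Suc i + 1) * q * P" for k using that by (intro *) linarith
        then have "ehash f (Suc i) e = ehash f' (Suc i) e"
          using that ce(1) Suc.prems by (intro ehash_cong) auto
        then show ?thesis by (simp add: column_def)
      qed
      then have "inj_on (column f i) (cell_at f E b x) = inj_on (column f' i) (cell_at f E b x)" if "i < r" for i
        using that by (intro inj_on_cong) auto
      then show "A f = A f'" by (simp add: A_def ceq)
    next
      fix C and f f' :: "nat \<Rightarrow> nat" assume *: "\<And>i. (r + 1) * q * P \<le> i \<Longrightarrow> f i = f' i"
      have "column f r e = column f' r e" if "edge e" for e
      proof -
        have "ehash f (Suc r) e = ehash f' (Suc r) e"
          using that Suc.prems by (intro ehash_cong) (auto intro!: * simp: algebra_simps)
        then show ?thesis by (simp add: column_def)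
      qed
      then have "inj_on (column f r) C = inj_on (column f' r) C" if "\<forall>e\<in>C. edge e"
        using that by (intro inj_on_cong) auto
      then show "bad C f = bad C f'" by (auto simp: bad_def)
    next
      fix f assume "A f"
      then have "card (cell_at f E b x) \<le> c" by (simp add: A_def)
      then have "(card (cell_at f E b x))\<^sup>2 \<le> W" using c power_mono[of "card (cell_at f E b x)" c 2] by linarith
      then have "(real (card (cell_at f E b x)))\<^sup>2 / (2 * real W) \<le> 1 / 2"
        using pos by (simp add: field_simps)
      moreover have "{g. bad (cell_at f E b x) g} = {g. \<not> inj_on (column g r) (cell_at f E b x)}" using ce(1) by (auto simp: bad_def)
      ultimately show "measure_pmf.prob (words (G * P) w) {g. bad (cell_at f E b x) g} \<le> 1 / 2"
        using prob_collision[OF ce(2,1)[of f] _ W q, of r] Suc.prems by (simp only: Suc_le_eq) (meson order_trans)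
    qed
    also have "\<dots> \<le> 1 / 2 * (1 / 2) ^ r" using Suc unfolding A_def by (intro mult_left_mono) auto
    finally show ?case by simp
  qed
  from this[of R] show ?thesis by simp
qed

lemma prob_unbalanced_cell:
  fixes \<delta> :: real
  assumes E: "\<forall>e\<in>E. edge e" and b: "b \<le> w" "x < 2 ^ b" and q: "q = 2 * h" "0 < h"
    and \<delta>: "0 < \<delta>" "\<delta> \<le> 1" and large: "36 * real q \<le> \<delta>\<^sup>2 * (card E / 2 ^ b)"
  shows "measure_pmf.prob (words (G * P) w) {tab. \<delta> * (card E / 2 ^ b) \<le> \<bar>card (cell_at tab E b x) - card E / 2 ^ b\<bar>}
    \<le> 2 * (1 / 4) ^ h"
  unfolding cell_at_def
proof (rule limited_independence_tail[where p = "1 / 2 ^ b" and k = q])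
  show "finite E" using edges_card(1)[OF E] .
  show "measure_pmf.prob (words (G * P) w) {tab. \<forall>e\<in>A. ehash tab 0 e mod 2 ^ b = x} = (1 / 2 ^ b) ^ card A"
    if "A \<subseteq> E" "card A \<le> q" "finite A" for A
    using that E b by (intro hash_independent) auto
qed (use assms in auto)

end

section \<open>Counting the sampling words that select an edge\<close>

lemma card_digits:
  fixes s a r b c k V :: nat
  assumes s: "s \<le> a" and a: "0 < a" and r: "r < b"
  shows "card {z. z < a * b * V \<and> z mod a < s \<and> (z div a) mod b = r \<and> (z div a div b) mod c = k}
    = s * card {v. v < V \<and> v mod c = k}"
proof -
  define D where "D = {..<s} \<times> {v. v < V \<and> v mod c = k}"
  \<comment> \<open>Mixed radix notation: \<open>y\<close> is the digit in base \<open>a\<close>,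
    \<open>r\<close> the fixed digit in base \<open>b\<close>, and \<open>v\<close> the remaining
    part.\<close>
  define f where "f = (\<lambda>(y, v). y + a * (r + b * v))"
  have dm: "f (y, v) mod a = y" "f (y, v) div a = r + b * v" if "y < s" for y v
    using that s by (auto simp: f_def)
  have dm2: "(r + b * v) mod b = r" "(r + b * v) div b = v" for v using r by auto
  have "{z. z < a * b * V \<and> z mod a < s \<and> (z div a) mod b = r \<and> (z div a div b) mod c = k} = f ` D"
  proof (intro set_eqI iffI)
    fix z assume "z \<in> {z. z < a * b * V \<and> z mod a < s \<and> (z div a) mod b = r \<and> (z div a div b) mod c = k}"
    then have z: "z < a * b * V" "z mod a < s" "(z div a) mod b = r" "(z div a div b) mod c = k" by auto
    have "z = z mod a + a * (z div a)" by simp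
    also have "z div a = r + b * (z div a div b)" using z(3) by (metis add.commute mult_div_mod_eq)
    finally have "z = f (z mod a, z div a div b)" by (simp add: f_def)
    moreover have "z div a div b < V" using z(1) by (simp add: div_mult2_eq[symmetric] less_mult_imp_div_less mult.commute)
    ultimately show "z \<in> f ` D" using z by (intro image_eqI[of _ _ "(z mod a, z div a div b)"]) (auto simp: D_def)
  next
    fix z assume "z \<in> f ` D"
    then obtain y v where yv: "z = f (y, v)" "y < s" "v < V" "v mod c = k" by (auto simp: D_def)
    have "z < a * Suc (r + b * v)" using yv(2) s by (simp add: yv(1) f_def)
    also have "\<dots> \<le> a * (b * Suc v)" using r by (intro mult_le_mono2) simp
    also have "\<dots> \<le> a * (b * V)" using yv(3) by (intro mult_le_mono2) simp
    finally show "z \<in> {z. z < a * b * V \<and> z mod a < s \<and> (z div a) mod b = r \<and> (z div a div b) mod c = k}"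
      using yv dm[OF yv(2)] dm2 by (simp add: mult.assoc)
  qed
  moreover have "inj_on f D"
  proof (rule inj_onI)
    fix x x' assume x: "x \<in> D" "x' \<in> D" "f x = f x'"
    obtain y v y' v' where [simp]: "x = (y, v)" "x' = (y', v')" by (cases x, cases x') auto
    have "y < s" "y' < s" using x by (auto simp: D_def)
    then show "x = x'" using x(3) dm dm2 by (metis \<open>x = (y, v)\<close> \<open>x' = (y', v')\<close>)
  qed
  ultimately show ?thesis by (simp add: card_image D_def card_cartesian_product)
qed

lemma card_residue_bounds:
  fixes c k V :: nat
  assumes c: "0 < c" "k < c"
  shows "\<bar>card {v. v < V \<and> v mod c = k} - real V / c\<bar> \<le> 1"
proof -
  define K where "K = V div c"
  have V: "c * K \<le> V" "V \<le> c * (K + 1)" using c dividend_less_times_div[of c V] by (auto simp: K_def)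
  have fin: "finite {v. v < x \<and> v mod c = k}" for x by simp
  have "card {v. v < c * K \<and> v mod c = k} \<le> card {v. v < V \<and> v mod c = k}" using V by (intro card_mono fin) auto
  moreover have "card {v. v < V \<and> v mod c = k} \<le> card {v. v < c * (K + 1) \<and> v mod c = k}" using V by (intro card_mono fin) auto
  ultimately have 1: "K \<le> card {v. v < V \<and> v mod c = k}" "card {v. v < V \<and> v mod c = k} \<le> K + 1"
    unfolding card_residue[OF c] by auto
  have "real (c * K) \<le> real V" "real V \<le> real (c * (K + 1))" using V by (simp_all only: of_nat_le_iff)
  then have "real K \<le> real V / c" "real V / c \<le> real K + 1" using c by (simp_all add: field_simps)
  then show ?thesis using 1 by linarith
qed

lemma divide_scale_bounds:
  fixes p q r s m :: real
  assumes "0 < r" "0 \<le> s" "0 < m"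
  shows "p * r \<le> q \<Longrightarrow> p * s / m \<le> s * q / (r * m)" "q \<le> p * r \<Longrightarrow> s * q / (r * m) \<le> p * s / m"
proof -
  have sm: "0 \<le> s / m" using assms by simp
  have eq: "p * s / m = p * (s / m)" "s * q / (r * m) = q / r * (s / m)" by (simp_all add: mult.commute)
  show "p * s / m \<le> s * q / (r * m)" if "p * r \<le> q"
    unfolding eq using that assms sm by (intro mult_right_mono) (simp_all add: pos_le_divide_eq)
  show "s * q / (r * m) \<le> p * s / m" if "q \<le> p * r"
    unfolding eq using that assms sm by (intro mult_right_mono) (simp_all add: pos_divide_le_eq)
qed

lemma expectation_words_component:
  fixes F :: "nat \<Rightarrow> real"
  assumes j: "j < N"
  shows "measure_pmf.expectation (words N w) (\<lambda>f. F (f j)) = (\<Sum>z<2 ^ w. F z) / 2 ^ w"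
proof -
  have "measure_pmf.expectation (words N w) (\<lambda>f. F (f j)) = measure_pmf.expectation (map_pmf (\<lambda>f. f j) (words N w)) F" by simp
  also have "map_pmf (\<lambda>f. f j) (words N w) = pmf_of_set {..<2 ^ w}"
    unfolding words_def using j by (subst Pi_pmf_component) auto
  also have "measure_pmf.expectation \<dots> F = (\<Sum>z<2 ^ w. F z) / card {..<2 ^ w :: nat}"
    by (rule integral_pmf_of_set) (auto simp: lessThan_empty_iff)
  finally show ?thesis by simp
qed

context layout
begin

text \<open>The setup tape supplies infinitely many words, but only the first \<open>G * P\<close>
  are ever read; this replaces the tape by the finite table.\<close>

lemma sampled_cong:
  assumes E: "\<forall>e\<in>E. edge e" and tab: "\<And>k. k < G * P \<Longrightarrow> tab k = tab' k"
  shows "sampled tab zs E = sampled tab' zs E"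
proof -
  have h: "hash tab i (Min e) (Max e) = hash tab' i (Min e) (Max e)" if "e \<in> E" "i \<le> R" for e i
  proof -
    have "(i + 1) * q * P \<le> G * P" using that(2) unfolding G_def by (intro mult_le_mono1) simp
    then have "tab k = tab' k" if "k < (i + 1) * q * P" for k using that by (intro tab) linarith
    then have "ehash tab i e = ehash tab' i e" using that E by (intro ehash_cong) auto
    then show ?thesis by (simp add: ehash_def)
  qed
  have eh: "ehash tab 0 e = ehash tab' 0 e" if "e \<in> E" for e using h[OF that] by (simp add: ehash_def)
  have b: "bucket tab E j = bucket tab' E j" for j using eh by (auto simp: bucket_def)
  have bE: "bucket tab' E j \<subseteq> E" for j by (auto simp: bucket_def)
  have "j mod R + 1 \<le> R" for j using pos mod_less_divisor[of R j] by linarith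
  then have c: "counter tab zs E j = counter tab' zs E j" for j
    unfolding fun_eq_iff counter_def b using bE eh h
    by (intro allI sum.cong refl) (auto simp: weight_def subset_iff)
  have "result tab zs E j = result tab' zs E j" for j unfolding result_def b c ..
  then show ?thesis using eh by (auto simp: sampled_def)
qed

lemma expectation_sampled:
  assumes E: "\<forall>e\<in>E. edge e" and e: "e \<in> E"
  shows "(\<integral>\<omega>. of_bool (e \<in> sampled tab (\<lambda>i. word \<omega> (i * w) w) E) \<partial>fair_bits) =
    card {z. z < 2 ^ w \<and> result tab (\<lambda>_. z) E (ehash tab 0 e mod nb) = eid e} / 2 ^ w"
proof -
  define j where "j = ehash tab 0 e mod nb"
  have j: "j < nb" using pos by (simp add: j_def)
  define F where "F z = (of_bool (result tab (\<lambda>_. z) E j = eid e) :: real)" for z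
  have "e \<in> sampled tab (\<lambda>i. word \<omega> (i * w) w) E \<longleftrightarrow> result tab (\<lambda>_. read nb w \<omega> j) E j = eid e" for \<omega>
    using e result_local[of tab "\<lambda>i. word \<omega> (i * w) w" E j] j by (simp add: sampled_def j_def[symmetric] read_def)
  then have "(\<integral>\<omega>. of_bool (e \<in> sampled tab (\<lambda>i. word \<omega> (i * w) w) E) \<partial>fair_bits) = (\<integral>\<omega>. F (read nb w \<omega> j) \<partial>fair_bits)"
    by (simp add: F_def)
  also have "\<dots> = measure_pmf.expectation (words nb w) (\<lambda>f. F (f j))" by (rule integral_fair_bits_read)
  also have "\<dots> = (\<Sum>z<2 ^ w. F z) / 2 ^ w" by (rule expectation_words_component[OF j])
  also have "(\<Sum>z<2 ^ w. F z) = card ({..<2 ^ w} \<inter> {z. result tab (\<lambda>_. z) E j = eid e})" by (simp add: F_def)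
  also have "{..<2 ^ w} \<inter> {z. result tab (\<lambda>_. z) E j = eid e} = {z. z < 2 ^ w \<and> result tab (\<lambda>_. z) E j = eid e}" by auto
  finally show ?thesis by (simp add: j_def)
qed

end

section \<open>Balanced cells\<close>

text \<open>\<open>delta_w\<close> makes the rounding error in counting ranks a
  \<open>\<delta>\<close>-fraction, since cell size times number of cells is at most
  \<open>n ^ 4\<close>. \<open>delta_C\<close> gives
  \<open>36 * q \<le> \<delta>\<^sup>2 * (L / 2)\<close>, the hypothesis of the tail bound for cells
  of mean at least \<open>L / 2\<close>.\<close>

locale balanced = sizes +
  fixes \<delta> :: real
  assumes delta: "0 < \<delta>" "\<delta> \<le> 1 / 3" and delta_w: "n ^ 4 \<le> \<delta> * 2 ^ w" and delta_C: "144 * real D \<le> \<delta>\<^sup>2 * C"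
begin

text \<open>Only cells of mean at least \<open>L / 2\<close> are required to be balanced, and only
  cells of at most \<open>4 * L\<close> edges to have a separating row. Levels relevant to a query
  satisfy both restrictions, and the first also limits the number of cells in the union
  bound.\<close>

definition good :: "(nat \<Rightarrow> nat) \<Rightarrow> nat set set \<Rightarrow> bool" where
  "good tab E \<longleftrightarrow> (\<forall>l'<\<Lambda>. \<forall>x<2 ^ (clog s + l'). L * 2 ^ (clog s + l') \<le> 2 * card E \<longrightarrow>
     \<bar>card (cell_at tab E (clog s + l') x) - card E / 2 ^ (clog s + l')\<bar> < \<delta> * (card E / 2 ^ (clog s + l')) \<and>
     (card (cell_at tab E (clog s + l') x) \<le> 4 * L \<longrightarrow> (\<exists>i<R. inj_on (column tab i) (cell_at tab E (clog s + l') x))))"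

text \<open>At most \<open>\<Lambda>\<close> levels with at most \<open>n\<^sup>2\<close> cells
  each; an unbalanced cell has probability at most \<open>2 * (1 / 4) ^ R \<le> (1 / 2) ^ R\<close>,
  a cell without separating row at most \<open>(1 / 2) ^ R\<close>.\<close>

lemma prob_not_good:
  assumes E: "\<forall>e\<in>E. edge e"
  shows "measure_pmf.prob (words (G * P) w) {tab. \<not> good tab E} \<le> 2 * \<Lambda> * n\<^sup>2 * (1 / 2) ^ R"
proof -
  define B where "B l' x = {tab. \<delta> * (card E / 2 ^ (clog s + l')) \<le> \<bar>card (cell_at tab E (clog s + l') x) - card E / 2 ^ (clog s + l')\<bar>} \<union>
    {tab. card (cell_at tab E (clog s + l') x) \<le> 4 * L \<and> (\<forall>i<R. \<not> inj_on (column tab i) (cell_at tab E (clog s + l') x))}" for l' x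
  define I where "I = {l'. l' < \<Lambda> \<and> L * 2 ^ (clog s + l') \<le> 2 * card E}"
  have finI: "finite I" by (simp add: I_def)
  have sub: "{tab. \<not> good tab E} \<subseteq> (\<Union>l'\<in>I. \<Union>x\<in>{..<2 ^ (clog s + l')}. B l' x)"
  proof
    fix tab assume "tab \<in> {tab. \<not> good tab E}"
    then obtain l' x where l': "l' < \<Lambda>" "L * 2 ^ (clog s + l') \<le> 2 * card E" and x: "x < 2 ^ (clog s + l')"
      and n: "\<not> (\<bar>card (cell_at tab E (clog s + l') x) - card E / 2 ^ (clog s + l')\<bar> < \<delta> * (card E / 2 ^ (clog s + l')) \<and>
     (card (cell_at tab E (clog s + l') x) \<le> 4 * L \<longrightarrow> (\<exists>i<R. inj_on (column tab i) (cell_at tab E (clog s + l') x))))"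
      unfolding good_def by blast
    have "tab \<in> B l' x" unfolding B_def Un_iff mem_Collect_eq using n unfolding not_less[symmetric] by blast
    moreover have "l' \<in> I" "x \<in> {..<2 ^ (clog s + l')}" using l' x by (auto simp: I_def)
    ultimately show "tab \<in> (\<Union>l'\<in>I. \<Union>x\<in>{..<2 ^ (clog s + l')}. B l' x)" by blast
  qed
  have cE: "2 * card E \<le> n\<^sup>2" using edges_card(2)[OF E] by (simp add: power2_eq_square diff_mult_distrib2)
  have pw: "2 ^ (clog s + l') \<le> n\<^sup>2" if "l' \<in> I" for l'
  proof -
    have "1 * 2 ^ (clog s + l') \<le> L * 2 ^ (clog s + l')" using pos by (intro mult_le_mono1) simp
    moreover have "L * 2 ^ (clog s + l') \<le> 2 * card E" using that by (simp add: I_def)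
    ultimately show ?thesis using cE by linarith
  qed
  have n2w: "n\<^sup>2 < 2 ^ w"
  proof -
    have "n\<^sup>2 \<le> n ^ 4" by (rule power_increasing) (use n_ge in auto)
    then show ?thesis using n_w by linarith
  qed
  have R1: "R \<ge> 1" using pos by simp
  have W': "clog (32 * (L * L)) \<le> w"
  proof -
    have "nb * (\<Lambda> * R * S) \<ge> S" using pos by simp
    then have "W < 2 ^ w" using top_w unfolding top_def S_def by linarith
    then show ?thesis unfolding W_def by simp
  qed
  have one: "measure_pmf.prob (words (G * P) w) (B l' x) \<le> 2 * (1 / 2) ^ R" if l': "l' \<in> I" and x: "x < 2 ^ (clog s + l')" for l' x
  proof -
    have "2 ^ (clog s + l') < (2 :: nat) ^ w" using pw[OF l'] n2w by linarith
    then have b: "clog s + l' \<le> w" by simp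
    have large: "36 * real q \<le> \<delta>\<^sup>2 * (card E / 2 ^ (clog s + l'))"
    proof -
      have "real (L * 2 ^ (clog s + l')) \<le> real (2 * card E)" using l' unfolding I_def by (simp only: of_nat_le_iff mem_Collect_eq)
      then have "L / 2 \<le> card E / 2 ^ (clog s + l')" by (simp add: field_simps)
      then have "\<delta>\<^sup>2 * (L / 2) \<le> \<delta>\<^sup>2 * (card E / 2 ^ (clog s + l'))" by (rule mult_left_mono) simp
      moreover have "144 * real D * l \<le> \<delta>\<^sup>2 * C * l" using delta_C by (rule mult_right_mono) simp
      moreover have "36 * real q = (144 * real D * l) / 2" "\<delta>\<^sup>2 * (L / 2) = (\<delta>\<^sup>2 * C * l) / 2"
        by (simp_all add: q_def R_def L_def)
      ultimately show ?thesis by linarith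
    qed
    have "measure_pmf.prob (words (G * P) w) (B l' x) \<le> 2 * (1 / 4) ^ R + (1 / 2) ^ R"
      unfolding B_def
    proof (rule order_trans[OF measure_Un_le add_mono])
      show "measure_pmf.prob (words (G * P) w) {tab. \<delta> * (card E / 2 ^ (clog s + l')) \<le> \<bar>card (cell_at tab E (clog s + l') x) - card E / 2 ^ (clog s + l')\<bar>} \<le> 2 * (1 / 4) ^ R"
        using delta pos by (intro prob_unbalanced_cell[OF E b x q_def]) (use large in auto)
      show "measure_pmf.prob (words (G * P) w) {tab. card (cell_at tab E (clog s + l') x) \<le> 4 * L \<and> (\<forall>i<R. \<not> inj_on (column tab i) (cell_at tab E (clog s + l') x))} \<le> (1 / 2) ^ R"
      proof (rule prob_no_good_row[OF E W_def W'])
        show "2 \<le> q" using R1 by (simp add: q_def)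
        show "(4 * L)\<^sup>2 \<le> W" using clog_le[of "32 * (L * L)"] by (simp add: W_def power2_eq_square)
      qed
    qed simp_all
    also have "2 * (1 / 4 :: real) ^ R \<le> (1 / 2) ^ R"
    proof -
      have "(1 / 4 :: real) ^ R = (1 / 2) ^ R * (1 / 2) ^ R" by (simp add: power_mult_distrib[symmetric])
      moreover have "(1 / 2 :: real) ^ R \<le> 1 / 2" using power_decreasing[of 1 R "1 / 2 :: real"] R1 by simp
      ultimately show ?thesis using mult_right_mono[of "(1 / 2 :: real) ^ R" "1 / 2" "(1 / 2) ^ R"] by simp
    qed
    finally show ?thesis by simp
  qed
  have "measure_pmf.prob (words (G * P) w) {tab. \<not> good tab E} \<le>
    measure_pmf.prob (words (G * P) w) (\<Union>l'\<in>I. \<Union>x\<in>{..<2 ^ (clog s + l')}. B l' x)"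
    using sub by (intro measure_pmf.finite_measure_mono) auto
  also have "\<dots> \<le> (\<Sum>l'\<in>I. measure_pmf.prob (words (G * P) w) (\<Union>x\<in>{..<2 ^ (clog s + l')}. B l' x))"
    using finI by (intro measure_pmf.finite_measure_subadditive_finite) auto
  also have "\<dots> \<le> (\<Sum>l'\<in>I. \<Sum>x<2 ^ (clog s + l'). measure_pmf.prob (words (G * P) w) (B l' x))"
    by (intro sum_mono measure_pmf.finite_measure_subadditive_finite) auto
  also have "\<dots> \<le> (\<Sum>l'\<in>I. \<Sum>x<(2 :: nat) ^ (clog s + l'). 2 * (1 / 2) ^ R)"
    using one by (intro sum_mono) auto
  also have "\<dots> = (\<Sum>l'\<in>I. real (2 ^ (clog s + l')) * (2 * (1 / 2) ^ R))" by simp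
  also have "\<dots> \<le> (\<Sum>l'\<in>I. real (n\<^sup>2) * (2 * (1 / 2) ^ R))"
    using pw by (intro sum_mono mult_right_mono) (simp_all only: of_nat_le_iff, simp)
  also have "\<dots> = card I * (real (n\<^sup>2) * (2 * (1 / 2) ^ R))" by simp
  also have "\<dots> \<le> \<Lambda> * (real (n\<^sup>2) * (2 * (1 / 2) ^ R))"
  proof (intro mult_right_mono)
    have "card I \<le> card {..<\<Lambda>}" by (intro card_mono) (auto simp: I_def)
    then show "real (card I) \<le> \<Lambda>" by simp
  qed simp
  finally show ?thesis by (simp add: mult_ac)
qed

text \<open>The level is chosen from the actual bucket size, so balance is used twice: at level 0 to
  locate the level, then at that level to know the cell size. Two relative errors
  \<open>\<delta>\<close>, cell size and rank rounding, combine to at most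
  \<open>4 * \<delta>\<close>.\<close>

lemma good_expectation:
  assumes E: "\<forall>e\<in>E. edge e" and e: "e \<in> E" and good: "good tab E" and large: "4 * L * nb \<le> card E"
  shows "(\<integral>\<omega>. of_bool (e \<in> sampled tab (\<lambda>i. word \<omega> (i * w) w) E) \<partial>fair_bits)
    \<in> {(1 - 4 * \<delta>) * s / card E .. (1 + 4 * \<delta>) * s / card E}"
proof -
  define m where "m = real (card E)"
  define a where "a = clog s"
  define j where "j = ehash tab 0 e mod nb"
  define N where "N = card (bucket tab E j)"
  define lv where "lv = level L N"
  define b where "b = a + lv"
  define x where "x = ehash tab 0 e mod 2 ^ b"
  define Cl where "Cl = cell_at tab E b x"
  have finE: "finite E" using edges_card(1)[OF E] .
  have m0: "m > 0" using e finE by (auto simp: m_def card_gt_0_iff)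
  have nba: "nb = 2 ^ a" by (simp add: nb_def a_def)
  have bl: "bucket tab E j = cell_at tab E (a + 0) j" unfolding bucket_def cell_at_def by (simp add: nba)
  have L1: "real L \<ge> 1" using pos by simp
  have "real (4 * L * nb) \<le> real (card E)" using large by (simp only: of_nat_le_iff)
  then have large': "4 * L * 2 ^ a \<le> m" by (simp add: m_def nba)
  have N: "\<bar>N - m / 2 ^ a\<bar> < \<delta> * (m / 2 ^ a)"
  proof -
    have "j < 2 ^ (a + 0)" using pos by (simp add: j_def nba)
    moreover have "L * 2 ^ (a + 0) \<le> 2 * card E" using large by (simp add: nba)
    ultimately have "\<bar>card (cell_at tab E (a + 0) j) - card E / 2 ^ (a + 0)\<bar> < \<delta> * (card E / 2 ^ (a + 0))"
      using good pos unfolding good_def a_def[symmetric] by blast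
    then show ?thesis by (simp add: N_def bl m_def)
  qed
  have ma: "4 * L \<le> m / 2 ^ a" using large' by (simp add: field_simps)
  have \<delta>ma: "\<delta> * (m / 2 ^ a) \<le> 1 / 3 * (m / 2 ^ a)" using delta m0 by (intro mult_right_mono) auto
  have N_lo: "2 / 3 * (m / 2 ^ a) < N" and N_hi: "N < 4 / 3 * (m / 2 ^ a)" using N \<delta>ma by linarith+
  have LN: "L \<le> N" using N_lo ma L1 by linarith
  have Nn: "N < n\<^sup>2" unfolding N_def using counter_bound(3)[OF E, of 0] n_ge by simp
  have lvL: "lv < \<Lambda>" unfolding lv_def by (rule level_Lam[OF Nn])
  have lv_hi: "N < 2 * (2 ^ lv * L)" unfolding lv_def by (rule level_less)
  have lv_lo: "2 ^ lv * L \<le> N"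
  proof (cases lv)
    case 0
    then show ?thesis using LN by simp
  next
    case (Suc k)
    then have "k < level L N" by (simp add: lv_def)
    then have "\<not> N < 2 * (2 ^ k * L)" unfolding level_def by (rule not_less_Least)
    then show ?thesis by (simp add: Suc)
  qed
  have pb: "(2 :: real) ^ b = 2 ^ a * 2 ^ lv" by (simp add: b_def power_add)
  have Lb: "real L * 2 ^ b \<le> 2 * m"
  proof -
    have "real (2 ^ lv * L) \<le> N" using lv_lo by (simp only: of_nat_le_iff)
    then have "real L * 2 ^ lv * 2 ^ a \<le> real N * 2 ^ a" by (simp add: mult.commute)
    also have "\<dots> \<le> 4 / 3 * (m / 2 ^ a) * 2 ^ a" using N_hi by (intro mult_right_mono) auto
    also have "\<dots> = 4 / 3 * m" by simp
    finally show ?thesis using m0 by (simp add: pb mult_ac)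
  qed
  then have "real (L * 2 ^ (a + lv)) \<le> real (2 * card E)" by (simp add: m_def b_def)
  \<comment> \<open>The bucket may exceed its mean by a third; the factor 2 in the threshold of
    \<open>good\<close> absorbs this.\<close>
  then have Lb': "L * 2 ^ (a + lv) \<le> 2 * card E" by (simp only: of_nat_le_iff)
  have xb: "x < 2 ^ (a + lv)" by (simp add: x_def b_def)
  have gd: "\<bar>card Cl - m / 2 ^ b\<bar> < \<delta> * (m / 2 ^ b)" "card Cl \<le> 4 * L \<longrightarrow> (\<exists>i<R. inj_on (column tab i) Cl)"
    using good lvL xb Lb' unfolding good_def a_def[symmetric] Cl_def b_def m_def by blast+
  \<comment> \<open>The level gives a bucket size below \<open>2 * L * 2 ^ lv\<close>, and the mean
    is at most three halves of it. Balance at this level then keeps the cell below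
    \<open>4 * L\<close>, where a separating row exists.\<close>
  have mb: "m / 2 ^ b < 3 * L"
  proof -
    have "2 / 3 * (m / 2 ^ a) < real (2 * (2 ^ lv * L))" using N_lo lv_hi by (meson less_trans of_nat_less_iff)
    then show ?thesis by (simp add: pb field_simps)
  qed
  have mb0: "m / 2 ^ b > 0" using m0 by simp
  have "\<delta> * (m / 2 ^ b) \<le> 1 / 3 * (m / 2 ^ b)" using delta mb0 by (intro mult_right_mono) auto
  then have "card Cl < 4 * real L" using gd(1) mb by linarith
  then have "card Cl \<le> 4 * L" by linarith
  then have row: "\<exists>i<R. inj_on (column tab i) Cl" using gd(2) by blast
  have dm: "y mod 2 ^ b = nb * ((y div nb) mod 2 ^ lv) + y mod nb" for y
    by (simp add: b_def nba power_add mod_mult2_eq)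
  have CC: "Cl = cell tab E j lv ((ehash tab 0 e div nb) mod 2 ^ lv)"
  proof -
    have "ehash tab 0 f mod 2 ^ b = x \<longleftrightarrow> ehash tab 0 f mod nb = j \<and> (ehash tab 0 f div nb) mod 2 ^ lv = (ehash tab 0 e div nb) mod 2 ^ lv" for f
    proof
      assume *: "ehash tab 0 f mod 2 ^ b = x"
      have "nb dvd 2 ^ b" by (simp add: nba b_def power_add)
      then have "ehash tab 0 f mod nb = j" using * unfolding x_def j_def by (metis mod_mod_cancel)
      moreover have "(ehash tab 0 f div nb) mod 2 ^ lv = (ehash tab 0 e div nb) mod 2 ^ lv"
        using * calculation pos unfolding x_def dm by (simp add: j_def)
      ultimately show "ehash tab 0 f mod nb = j \<and> (ehash tab 0 f div nb) mod 2 ^ lv = (ehash tab 0 e div nb) mod 2 ^ lv" by simp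
    qed (simp add: x_def dm j_def)
    then show ?thesis unfolding Cl_def cell_at_def cell_def bucket_def by auto
  qed
  obtain k where k: "k < card Cl" "\<And>z. result tab (\<lambda>_. z) E j = eid e \<longleftrightarrow>
    z mod nb < s \<and> (z div nb) mod 2 ^ lv = (ehash tab 0 e div nb) mod 2 ^ lv \<and> (z div nb div 2 ^ lv) mod card Cl = k"
    using result_exact[OF E e j_def[symmetric] _ CC row] unfolding lv_def N_def by blast
  define V where "V = (2 :: nat) ^ (w - b)"
  have cEn: "2 * card E \<le> n\<^sup>2" using edges_card(2)[OF E] by (simp add: power2_eq_square diff_mult_distrib2)
  have bn: "2 ^ b \<le> n\<^sup>2"
  proof -
    have "1 * 2 ^ (a + lv) \<le> L * 2 ^ (a + lv)" using pos by (intro mult_le_mono1) simp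
    then show ?thesis using Lb' cEn unfolding b_def by linarith
  qed
  have n2w: "n\<^sup>2 < 2 ^ w"
  proof -
    have "n\<^sup>2 \<le> n ^ 4" by (rule power_increasing) (use n_ge in auto)
    then show ?thesis using n_w by linarith
  qed
  have bw: "b \<le> w"
  proof -
    have "2 ^ b < (2 :: nat) ^ w" using bn n2w by linarith
    then show ?thesis by simp
  qed
  have wV: "2 ^ w = nb * 2 ^ lv * V" using bw by (simp add: V_def nba power_add[symmetric] b_def)
  have snb: "s \<le> nb" using clog_le[of s] by (simp add: nb_def)
  have "card {z. z < 2 ^ w \<and> result tab (\<lambda>_. z) E j = eid e} = s * card {v. v < V \<and> v mod card Cl = k}"
    unfolding k(2) wV by (rule card_digits) (use snb pos in auto)
  then have int: "(\<integral>\<omega>. of_bool (e \<in> sampled tab (\<lambda>i. word \<omega> (i * w) w) E) \<partial>fair_bits) =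
      s * card {v. v < V \<and> v mod card Cl = k} / 2 ^ w"
    using expectation_sampled[OF E e, of tab] by (simp add: j_def)
  define c where "c = real (card Cl)"
  define y where "y = real (card {v. v < V \<and> v mod card Cl = k})"
  have c0: "c > 0" using k(1) by (simp add: c_def)
  have V0: "real V > 0" by (simp add: V_def)
  have y: "\<bar>y - V / c\<bar> \<le> 1" unfolding y_def c_def using k(1) by (intro card_residue_bounds) auto
  have wV': "(2 :: real) ^ w = 2 ^ b * V" using bw by (simp add: V_def power_add[symmetric])
  \<comment> \<open>The free digits of the word have \<open>V\<close> values for \<open>c\<close>
    ranks; \<open>V / c \<ge> 1 / \<delta>\<close> makes the deviation 1 in the number of words per
    rank a relative error of \<open>\<delta>\<close>.\<close>
  have cV: "c \<le> \<delta> * V"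
  proof -
    have "card Cl \<le> card E" unfolding Cl_def cell_at_def using finE by (intro card_mono) auto
    then have "card Cl * 2 ^ b \<le> n\<^sup>2 * n\<^sup>2" using bn cEn by (intro mult_le_mono) auto
    also have "\<dots> = n ^ 4" by (simp add: power4_eq_xxxx power2_eq_square)
    finally have "real (card Cl * 2 ^ b) \<le> real (n ^ 4)" by (simp only: of_nat_le_iff)
    moreover have "real (card Cl * 2 ^ b) = c * 2 ^ b" by (simp add: c_def)
    moreover have "\<delta> * 2 ^ w = (\<delta> * V) * 2 ^ b" unfolding wV' by simp
    ultimately have "c * 2 ^ b \<le> (\<delta> * V) * 2 ^ b" using delta_w by linarith
    then show ?thesis by (rule mult_right_le_imp_le) simp
  qed
  have yV: "(1 - \<delta>) * (V / c) \<le> y" "y \<le> (1 + \<delta>) * (V / c)"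
  proof -
    define v where "v = V / c"
    define z where "z = \<delta> * v"
    have z: "1 \<le> z" using cV c0 unfolding z_def v_def by (simp add: field_simps)
    have v: "y - v \<le> 1" "v - y \<le> 1" using y unfolding v_def abs_le_iff by (simp_all only: minus_diff_eq)
    have "(1 - \<delta>) * (V / c) = v - z" unfolding z_def v_def by (simp only: left_diff_distrib mult_1)
    also have "\<dots> \<le> v - 1" using z by (rule diff_left_mono)
    also have "\<dots> \<le> y" using v(2) by (simp only: diff_le_eq add.commute)
    finally show "(1 - \<delta>) * (V / c) \<le> y" .
    have "y \<le> v + 1" using v(1) by (simp only: diff_le_eq add.commute)
    also have "\<dots> \<le> v + z" using z by (rule add_left_mono)
    also have "\<dots> = (1 + \<delta>) * (V / c)" unfolding z_def v_def by (simp only: distrib_right mult_1)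
    finally show "y \<le> (1 + \<delta>) * (V / c)" .
  qed
  have cb: "(1 - \<delta>) * m \<le> c * 2 ^ b" "c * 2 ^ b \<le> (1 + \<delta>) * m"
    using gd(1) unfolding c_def[symmetric] by (simp_all add: abs_less_iff field_simps)
  have res: "s * y / 2 ^ w = s * (y * c / V) / (c * 2 ^ b)" using c0 V0 by (simp add: wV')
  have u: "1 - \<delta> \<le> y * c / V" "y * c / V \<le> 1 + \<delta>"
    using mult_right_mono[OF yV(1), of "c / V"] mult_right_mono[OF yV(2), of "c / V"] c0 V0 by simp_all
  have s0: "real s \<ge> 0" and y0: "y \<ge> 0" by (simp_all add: y_def)
  have d1: "1 - \<delta> > 0" using delta by simp
  have lower: "(1 - 4 * \<delta>) * s / m \<le> s * (y * c / V) / (c * 2 ^ b)"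
  proof -
    have "(1 - 4 * \<delta>) * (1 + \<delta>) \<le> 1 - \<delta>" using delta by (simp add: algebra_simps)
    then have "(1 - 4 * \<delta>) * s / m \<le> s * (1 - \<delta>) / ((1 + \<delta>) * m)"
      using s0 m0 delta by (intro divide_scale_bounds(1)) simp_all
    also have "\<dots> \<le> s * (y * c / V) / (c * 2 ^ b)"
      using u(1) cb(2) c0 V0 d1 s0 y0 by (intro frac_le mult_left_mono) auto
    finally show ?thesis .
  qed
  have upper: "s * (y * c / V) / (c * 2 ^ b) \<le> (1 + 4 * \<delta>) * s / m"
  proof -
    have "s * (y * c / V) / (c * 2 ^ b) \<le> s * (1 + \<delta>) / ((1 - \<delta>) * m)"
      using u(2) cb(1) m0 d1 s0 delta by (intro frac_le mult_left_mono) auto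
    also have "\<dots> \<le> (1 + 4 * \<delta>) * s / m"
    proof -
      have "0 \<le> \<delta> * (2 - 4 * \<delta>)" using delta by (intro mult_nonneg_nonneg) auto
      then have "1 + \<delta> \<le> (1 + 4 * \<delta>) * (1 - \<delta>)" by (simp add: algebra_simps)
      then show ?thesis using s0 m0 d1 by (intro divide_scale_bounds(2)) simp_all
    qed
    finally show ?thesis .
  qed
  show ?thesis
    using lower upper unfolding int of_nat_mult y_def[symmetric] res m_def[symmetric] atLeastAtMost_iff by (rule conjI)
qed

end

section \<open>Rounded logarithms\<close>

lemma clog_upper: "0 < x \<Longrightarrow> 2 ^ clog x \<le> 2 * x"
proof (cases "clog x")
  case (Suc i)
  then show "2 ^ clog x \<le> 2 * x" using clog_less[of i x] by simp
qed simp

lemma clog_eq_ceiling: "0 < n \<Longrightarrow> nat \<lceil>log 2 (real n)\<rceil> = clog n"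
proof -
  assume n: "0 < n"
  have *: "n \<le> 2 ^ i \<longleftrightarrow> nat \<lceil>log 2 (real n)\<rceil> \<le> i" for i
  proof -
    have "n \<le> 2 ^ i \<longleftrightarrow> real n \<le> 2 ^ i" by (metis of_nat_le_iff of_nat_numeral of_nat_power)
    also have "\<dots> \<longleftrightarrow> log 2 (real n) \<le> i" using n by (simp add: log_le_iff powr_realpow)
    also have "\<dots> \<longleftrightarrow> nat \<lceil>log 2 (real n)\<rceil> \<le> i" by (simp add: ceiling_le_iff nat_le_iff)
    finally show ?thesis .
  qed
  show ?thesis unfolding clog_def * by (rule Least_equality[symmetric]) auto
qed

lemma clog_le_ln:
  assumes "2 \<le> n"
  shows "real (clog n) \<le> 3 * ln (real n)" "2 / 3 \<le> ln (real n)" "0 < clog n" "clog n \<le> n"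
proof -
  have l2: "2 / 3 \<le> ln (2 :: real)" by (rule ln2_ge_two_thirds)
  have "ln 2 \<le> ln (real n)" using assms by simp
  then show n: "2 / 3 \<le> ln (real n)" using l2 by linarith
  show pos: "0 < clog n" using clog_le[of n] assms by (cases "clog n") auto
  then have "2 ^ (clog n - 1) < n" by (intro clog_less) simp
  then have "real (2 ^ (clog n - 1)) < real n" by (simp only: of_nat_less_iff)
  then have "ln (2 ^ (clog n - 1)) < ln (real n)" using assms by (subst ln_less_cancel_iff) auto
  then have "(real (clog n) - 1) * ln 2 < ln (real n)" using pos by (simp add: ln_realpow of_nat_diff)
  moreover have "(real (clog n) - 1) * (2 / 3) \<le> (real (clog n) - 1) * ln 2" using pos l2 by (intro mult_left_mono) auto
  ultimately have "(real (clog n) - 1) * (2 / 3) < ln (real n)" by (rule le_less_trans[rotated])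
  then have "real (clog n) \<le> 3 / 2 * ln (real n) + 1" by (simp add: field_simps)
  also have "\<dots> \<le> 3 * ln (real n)" using n by linarith
  finally show "real (clog n) \<le> 3 * ln (real n)" .
  show "clog n \<le> n" unfolding clog_def by (rule Least_le) (simp add: less_imp_le)
qed

section \<open>Choice of the parameters\<close>

text \<open>The exponent of \<open>n\<close> to be beaten in the union bound: with
  \<open>a = \<lceil>lambda\<rceil>\<close>, the \<open>T + 1\<close> times cost
  \<open>a + 1\<close>, the factor \<open>2 * \<Lambda>\<close> costs 4, the cells cost 2, and
  \<open>d\<close> is the required failure exponent.\<close>

definition depth :: "real \<Rightarrow> nat \<Rightarrow> nat" where
  "depth lambda d = d + nat \<lceil>lambda\<rceil> + 7"

text \<open>
  The constant is \<open>144 * 4\<^sup>2\<close>, from the hypothesis \<open>delta_C\<close> of the locale \<open>balanced\<close> for \<open>\<delta> = \<epsilon> / 4\<close>.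
\<close>

definition cell_factor :: "real \<Rightarrow> nat \<Rightarrow> real \<Rightarrow> nat" where
  "cell_factor lambda d \<epsilon> = nat \<lceil>2304 * real (depth lambda d) / \<epsilon>\<^sup>2\<rceil>"

text \<open>Chosen so that \<open>2 ^ w\<close> exceeds \<open>K0 * Y ^ 5 * n ^ 6\<close>, with
  \<open>K0\<close> the first summand and \<open>Y\<close> the rounded
  \<open>c / \<epsilon>\<close>: the three summands pay for the three factors.\<close>

definition word_factor :: "real \<Rightarrow> nat \<Rightarrow> real \<Rightarrow> real \<Rightarrow> nat" where
  "word_factor lambda d \<epsilon> c = 10000 * depth lambda d ^ 4 + 5 * nat \<lceil>c / \<epsilon>\<rceil> + 6"

text \<open>The lower bound on \<open>c\<close> expresses that \<open>c\<close> dominates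
  \<open>lambda\<close>: it makes \<open>L\<close> at most \<open>Q\<close>, and it makes the
  assumed number of edges large compared with \<open>L * nb\<close>.\<close>

locale instance_bounds =
  fixes lambda cstar \<epsilon> c :: real and d n s :: nat
  assumes lambda: "lambda \<ge> 1" and eps: "0 < \<epsilon>" "\<epsilon> < 1" "\<bar>cstar * \<epsilon>\<bar> < 1"
    and c: "c \<ge> 40 * cell_factor lambda d \<epsilon> + 40"
    and s0: "0 < s" and s: "real s \<le> 2 * (2 + cstar * \<epsilon>) * c * real n * ln (real n)"
begin

definition "D = depth lambda d"
definition "C = cell_factor lambda d \<epsilon>"
definition "Y = nat \<lceil>c / \<epsilon>\<rceil>"
definition "\<kappa> = word_factor lambda d \<epsilon> c"
definition "l = clog n"
definition "w = \<kappa> * l"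
definition "R = D * l"
definition "q = 2 * R"
definition "L = C * l"
definition "W = (2 :: nat) ^ clog (32 * (L * L))"
definition "\<Lambda> = 2 * l + 1"
definition "nb = (2 :: nat) ^ clog s"
definition "G = (R + 1) * q"
definition "P = G * n"
definition "zb = 64 + G * P"
definition "ob = zb + nb"
definition "cb = ob + 2 * nb"
definition "S = 2 * W + 1"
definition "M\<^sub>0 = cb + nb * (\<Lambda> * R * S)"
text \<open>The parameter in which all sizes are measured: each of them is at most a constant
  multiple of a power of \<open>Q\<close>, times \<open>n\<close> where the buckets or the table are
  concerned.\<close>

definition "Q = c * ln (real n) / \<epsilon>"
definition "K0 = 10000 * D ^ 4"
definition "B = (real K0 + 16) * Q ^ 5"
definition "M = nat \<lfloor>real n * B\<rfloor>"

lemma D_ge: "D \<ge> 7"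
  by (simp add: D_def depth_def)

lemma c_ge: "c \<ge> 40" "c \<ge> 40 * C"
proof -
  have "real (cell_factor lambda d \<epsilon>) \<ge> 0" by simp
  then show "c \<ge> 40" "c \<ge> 40 * C" using c unfolding C_def by linarith+
qed

lemma alpha: "1 < 2 + cstar * \<epsilon>" "2 + cstar * \<epsilon> < 3"
  using eps by linarith+

lemma n_ge: "n \<ge> 2"
proof (rule ccontr)
  assume "\<not> n \<ge> 2"
  then have "n = 0 \<or> n = 1" by auto
  \<comment> \<open>For \<open>n < 2\<close> the upper bound on \<open>s\<close> is 0, because
    \<open>n\<close> or \<open>ln n\<close> vanishes, while \<open>s\<close> is positive.\<close>
  then show False using s s0 by auto
qed

lemma l_bounds: "real l \<le> 3 * ln (real n)" "2 / 3 \<le> ln (real n)" "0 < l" "l \<le> n" "n \<le> 2 ^ l"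
  using clog_le_ln[OF n_ge] clog_le[of n] by (auto simp: l_def)

lemma cln_Q: "c * ln (real n) \<le> Q"
proof -
  have "0 \<le> c * ln (real n)" using c_ge l_bounds(2) by (intro mult_nonneg_nonneg) auto
  then have "c * ln (real n) * \<epsilon> \<le> c * ln (real n) * 1" using eps by (intro mult_left_mono) auto
  then show ?thesis using eps by (simp add: Q_def field_simps)
qed

lemma lin_Q: "40 * ln (real n) \<le> Q" "40 * (C * ln (real n)) \<le> Q" "1 \<le> Q"
proof -
  have "40 * ln (real n) \<le> c * ln (real n)" using c_ge l_bounds(2) by (intro mult_right_mono) auto
  then show 1: "40 * ln (real n) \<le> Q" using cln_Q by linarith
  have "40 * C * ln (real n) \<le> c * ln (real n)" using c_ge l_bounds(2) by (intro mult_right_mono) auto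
  then show "40 * (C * ln (real n)) \<le> Q" using cln_Q by simp
  show "1 \<le> Q" using 1 l_bounds(2) by linarith
qed

lemma C_pos: "C > 0"
proof -
  have "2304 * real (depth lambda d) / \<epsilon>\<^sup>2 > 0" using eps D_ge by (simp add: D_def)
  then have "real C > 0" unfolding C_def cell_factor_def by (smt (verit) of_nat_ceiling)
  then show ?thesis by simp
qed

lemma C_delta: "144 * real D \<le> (\<epsilon> / 4)\<^sup>2 * C"
proof -
  have "2304 * real D / \<epsilon>\<^sup>2 \<le> C" unfolding C_def cell_factor_def D_def by (rule of_nat_ceiling)
  then have "2304 * real D \<le> C * \<epsilon>\<^sup>2" using eps by (simp add: field_simps)
  then show ?thesis by (simp add: power_divide mult.commute)
qed

lemma size_bounds:
  "real l \<le> Q" "real R \<le> D * Q" "real q \<le> 2 * D * Q" "real L \<le> Q" "real W \<le> 64 * Q\<^sup>2" "real S \<le> 129 * Q\<^sup>2"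
  "real \<Lambda> \<le> 3 * Q" "real nb \<le> 12 * n * Q" "real G \<le> 4 * D\<^sup>2 * Q\<^sup>2" "real s \<le> 6 * n * Q"
proof -
  have Q1: "1 \<le> Q" by (rule lin_Q)
  show l: "real l \<le> Q" using l_bounds(1,2) lin_Q(1) by linarith
  show R: "real R \<le> D * Q" unfolding R_def of_nat_mult using l by (intro mult_left_mono) auto
  show q: "real q \<le> 2 * D * Q" unfolding q_def using R by simp
  have "real C * real l \<le> real C * (3 * ln (real n))" using l_bounds(1) by (intro mult_left_mono) auto
  moreover have "0 \<le> real C * ln (real n)" using l_bounds(2) by simp
  ultimately show L: "real L \<le> Q" unfolding L_def of_nat_mult using lin_Q(2) by linarith
  have L0: "L > 0" using C_pos l_bounds by (simp add: L_def)
  have "W \<le> 2 * (32 * (L * L))" unfolding W_def by (rule clog_upper) (use L0 in simp)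
  then have "real W \<le> real (2 * (32 * (L * L)))" by (simp only: of_nat_le_iff)
  also have "\<dots> = 64 * (real L * real L)" by simp
  also have "\<dots> \<le> 64 * (Q * Q)" using L Q1 by (intro mult_left_mono mult_mono) auto
  finally show W: "real W \<le> 64 * Q\<^sup>2" by (simp add: power2_eq_square)
  have Q2: "1 \<le> Q\<^sup>2" using Q1 by (rule one_le_power)
  show "real S \<le> 129 * Q\<^sup>2" unfolding S_def using W Q2 by simp
  show "real \<Lambda> \<le> 3 * Q" unfolding \<Lambda>_def using l Q1 by simp
  have "real s \<le> 2 * (2 + cstar * \<epsilon>) * (c * real n * ln (real n))" using s by (simp add: mult_ac)
  also have "\<dots> \<le> 6 * (c * real n * ln (real n))"
    using alpha c_ge l_bounds(2) by (intro mult_right_mono mult_nonneg_nonneg) auto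
  also have "\<dots> = 6 * n * (c * ln (real n))" by simp
  also have "\<dots> \<le> 6 * n * Q" using cln_Q by (intro mult_left_mono) auto
  finally show s6: "real s \<le> 6 * n * Q" .
  have "nb \<le> 2 * s" unfolding nb_def by (rule clog_upper[OF s0])
  then have "real nb \<le> 2 * real s" by linarith
  then show "real nb \<le> 12 * n * Q" using s6 by linarith
  have DQ: "1 \<le> D * Q" using D_ge Q1 mult_mono[of 1 "real D" 1 Q] by simp
  have "real G = (real R + 1) * real q" by (simp add: G_def algebra_simps)
  also have "\<dots> \<le> (D * Q + D * Q) * (2 * D * Q)"
  proof (rule mult_mono[OF _ q])
    show "real R + 1 \<le> D * Q + D * Q" "0 \<le> D * Q + D * Q" using R DQ by linarith+
  qed simp
  also have "\<dots> = 4 * D\<^sup>2 * Q\<^sup>2" by (simp add: power2_eq_square)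
  finally show "real G \<le> 4 * D\<^sup>2 * Q\<^sup>2" .
qed

lemma total_bound: "real M\<^sub>0 \<le> K0 * (n * Q ^ 5)"
proof -
  have Q1: "1 \<le> Q" by (rule lin_Q)
  have n1: "1 \<le> real n" using n_ge by simp
  have Q5: "Q ^ i \<le> Q ^ 5" if "i \<le> 5" for i using Q1 that by (rule power_increasing[rotated])
  have nQ: "n * Q ^ i \<le> n * Q ^ 5" if "i \<le> 5" for i using Q5[OF that] n1 by (intro mult_left_mono) auto
  have nQ1: "1 \<le> n * Q ^ 5" using mult_mono[OF n1 one_le_power[OF Q1, of 5]] n1 by simp
  have "real (G * P) = real G * real G * n" by (simp add: P_def)
  also have "\<dots> \<le> (4 * D\<^sup>2 * Q\<^sup>2) * (4 * D\<^sup>2 * Q\<^sup>2) * n" using size_bounds(9) Q1 by (intro mult_mono) auto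
  also have "\<dots> = 16 * D ^ 4 * (n * Q ^ 4)" by (simp add: power4_eq_xxxx power2_eq_square)
  also have "\<dots> \<le> 16 * D ^ 4 * (n * Q ^ 5)" by (intro mult_left_mono nQ) auto
  finally have 1: "real (G * P) \<le> 16 * D ^ 4 * (n * Q ^ 5)" .
  have "real (nb * (\<Lambda> * R * S)) = real nb * (real \<Lambda> * real R * real S)" by simp
  also have "\<dots> \<le> (12 * n * Q) * ((3 * Q) * (D * Q) * (129 * Q\<^sup>2))"
    using size_bounds Q1 by (intro mult_mono) auto
  \<comment> \<open>Here \<open>4644 = 12 * 3 * 129\<close>. The sketches dominate in the power of
    \<open>Q\<close>, the table in the power of \<open>D\<close>, and
    \<open>K0 = 10000 * D ^ 4\<close> covers both.\<close>
  also have "\<dots> = 4644 * D * (n * Q ^ 5)" by (simp add: power2_eq_square eval_nat_numeral)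
  finally have 2: "real (nb * (\<Lambda> * R * S)) \<le> 4644 * D * (n * Q ^ 5)" .
  have 3: "3 * real nb \<le> 36 * (n * Q ^ 5)" using size_bounds(8) nQ[of 1] by simp
  have "real M\<^sub>0 = 64 + real (G * P) + 3 * real nb + real (nb * (\<Lambda> * R * S))" by (simp add: M\<^sub>0_def cb_def ob_def zb_def)
  also have "\<dots> \<le> (64 + 16 * D ^ 4 + 36 + 4644 * D) * (n * Q ^ 5)"
    using 1 2 3 nQ1 by (simp add: distrib_right)
  also have "\<dots> \<le> K0 * (n * Q ^ 5)"
  proof (rule mult_right_mono)
    have D1: "1 \<le> real D" using D_ge by simp
    have "real D \<le> real D ^ 4" using power_increasing[OF _ D1, of 1 4] by simp
    moreover have "1 \<le> real D ^ 4" using D1 by (rule one_le_power)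
    ultimately have "64 + 16 * real D ^ 4 + 36 + 4644 * real D \<le> 10000 * real D ^ 4" by linarith
    then show "64 + 16 * D ^ 4 + 36 + 4644 * D \<le> real K0" by (simp add: K0_def)
  qed (use nQ1 in simp)
  finally show ?thesis .
qed

lemma Y_ge: "c / \<epsilon> \<le> Y" "40 \<le> Y" "C \<le> Y" "4 / \<epsilon> \<le> Y"
proof -
  show 1: "c / \<epsilon> \<le> Y" unfolding Y_def by (rule of_nat_ceiling)
  have "c \<le> c / \<epsilon>" using eps c_ge by (simp add: field_simps)
  then have "c \<le> Y" using 1 by linarith
  then have "40 \<le> real Y" "real C \<le> real Y" using c_ge by linarith+
  then show "40 \<le> Y" "C \<le> Y" by simp_all
  have "4 / \<epsilon> \<le> c / \<epsilon>" using eps c_ge by (intro divide_right_mono) auto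
  then show "4 / \<epsilon> \<le> Y" using 1 by linarith
qed

lemma Q_le: "Q \<le> real Y * real n"
proof -
  have "ln (real n) \<le> n" using n_ge ln_le_minus_one[of "real n"] by simp
  then have "(c / \<epsilon>) * ln (real n) \<le> real Y * real n" using Y_ge(1) l_bounds(2) by (intro mult_mono) auto
  then show ?thesis by (simp add: Q_def)
qed

lemma two_w: "(K0 + 1) * (Y ^ 5 * n ^ 6) \<le> 2 ^ w"
proof -
  have \<kappa>: "\<kappa> = K0 + 5 * Y + 6" by (simp add: \<kappa>_def word_factor_def K0_def D_def Y_def)
  have l1: "1 \<le> l" using l_bounds(3) by simp
  have "K0 + 1 \<le> 2 ^ K0" unfolding Suc_eq_plus1[symmetric] by (rule Suc_leI) (rule less_exp)
  also have "\<dots> \<le> 2 ^ (K0 * l)" using l1 by (intro power_increasing) auto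
  finally have 1: "K0 + 1 \<le> 2 ^ (K0 * l)" .
  have "Y ^ 5 \<le> (2 ^ Y) ^ 5" by (intro power_mono) (auto simp: less_imp_le)
  also have "\<dots> = 2 ^ (5 * Y)" by (simp add: power_mult[symmetric] mult.commute)
  also have "\<dots> \<le> 2 ^ (5 * Y * l)" using l1 by (intro power_increasing) auto
  finally have 2: "Y ^ 5 \<le> 2 ^ (5 * Y * l)" .
  have "n ^ 6 \<le> (2 ^ l) ^ 6" using l_bounds(5) by (intro power_mono) auto
  then have 3: "n ^ 6 \<le> 2 ^ (6 * l)" by (simp add: power_mult[symmetric] mult.commute)
  have "(K0 + 1) * (Y ^ 5 * n ^ 6) \<le> 2 ^ (K0 * l) * (2 ^ (5 * Y * l) * 2 ^ (6 * l))"
    by (intro mult_le_mono 1 2 3)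
  also have "\<dots> = 2 ^ w" by (simp add: w_def \<kappa> power_add[symmetric] algebra_simps)
  finally show ?thesis .
qed

text \<open>\<open>K0\<close> in the hypothesis against \<open>K0 + 1\<close> in
  \<open>two_w\<close> makes the inequality strict; all word-size conditions are reduced to this
  monomial.\<close>

lemma below_two_w:
  assumes "real x \<le> K0 * (real Y ^ 5 * real n ^ 6)"
  shows "x < 2 ^ w"
proof -
  have "real x \<le> real (K0 * (Y ^ 5 * n ^ 6))" using assms by simp
  then have "x \<le> K0 * (Y ^ 5 * n ^ 6)" by (simp only: of_nat_le_iff)
  also have "\<dots> < (K0 + 1) * (Y ^ 5 * n ^ 6)" using Y_ge(2) n_ge by simp
  also have "\<dots> \<le> 2 ^ w" by (rule two_w)
  finally show ?thesis .
qed

lemma monomial_bound: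
  assumes "i \<le> 5" "j \<le> 6" "a \<le> real K0" "0 \<le> a"
  shows "a * (real Y ^ i * real n ^ j) \<le> K0 * (real Y ^ 5 * real n ^ 6)"
  using assms Y_ge(2) n_ge by (intro mult_mono power_increasing) auto

lemma K0_ge: "10000 \<le> K0" "D \<le> K0"
proof -
  have "1 \<le> D ^ 4" "D ^ 1 \<le> D ^ 4" by (intro one_le_power power_increasing; use D_ge in simp)+
  then show "10000 \<le> K0" "D \<le> K0" by (simp_all add: K0_def)
qed

lemma w_bounds: "M\<^sub>0 < 2 ^ w" "n ^ 4 < 2 ^ w" "s < 2 ^ w" "n\<^sup>2 * (4 * L) < 2 ^ w" "real n ^ 4 \<le> \<epsilon> / 4 * 2 ^ w"
  "\<kappa> < 2 ^ w" "D < 2 ^ w" "C < 2 ^ w" "(2 :: nat) ^ \<Lambda> < 2 ^ w" "n < 2 ^ w"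
proof -
  have Q1: "1 \<le> Q" by (rule lin_Q)
  show "M\<^sub>0 < 2 ^ w"
  proof (rule below_two_w)
    have "real n * Q ^ 5 \<le> real n * (real Y * real n) ^ 5" using Q_le Q1 by (intro mult_left_mono power_mono) auto
    also have "\<dots> = real Y ^ 5 * real n ^ 6" by (simp add: power_mult_distrib eval_nat_numeral)
    finally show "real M\<^sub>0 \<le> K0 * (real Y ^ 5 * real n ^ 6)" using total_bound mult_left_mono[of _ _ "real K0"] by (meson of_nat_0_le_iff order_trans)
  qed
  show "n ^ 4 < 2 ^ w" using monomial_bound[of 0 4 1] K0_ge by (intro below_two_w) simp
  show "n < 2 ^ w" using monomial_bound[of 0 1 1] K0_ge by (intro below_two_w) simp
  show "s < 2 ^ w"
  proof (rule below_two_w)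
    have "real s \<le> 6 * real n * (real Y * real n)" using size_bounds(10) mult_left_mono[OF Q_le, of "6 * real n"] by simp
    then show "real s \<le> K0 * (real Y ^ 5 * real n ^ 6)" using monomial_bound[of 1 2 6] K0_ge by (simp add: power2_eq_square mult_ac)
  qed
  show "n\<^sup>2 * (4 * L) < 2 ^ w"
  proof (rule below_two_w)
    have "real L \<le> real Y * real n" using size_bounds(4) Q_le by linarith
    then have "real n ^ 2 * (4 * real L) \<le> real n ^ 2 * (4 * (real Y * real n))" by (intro mult_left_mono) auto
    then show "real (n\<^sup>2 * (4 * L)) \<le> K0 * (real Y ^ 5 * real n ^ 6)"
      using monomial_bound[of 1 3 4] K0_ge by (simp add: power2_eq_square power3_eq_cube mult_ac)
  qed
  have "1 * real n ^ 4 \<le> (\<epsilon> / 4 * Y) * real n ^ 6"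
    using Y_ge(4) eps n_ge by (intro mult_mono power_increasing) (auto simp: field_simps)
  also have "\<dots> \<le> \<epsilon> / 4 * real ((K0 + 1) * (Y ^ 5 * n ^ 6))"
  proof -
    have "Y ^ 1 \<le> Y ^ 5" using Y_ge(2) by (intro power_increasing) auto
    then have "1 * (Y * n ^ 6) \<le> (K0 + 1) * (Y ^ 5 * n ^ 6)" by (intro mult_le_mono) auto
    then have "real (Y * n ^ 6) \<le> real ((K0 + 1) * (Y ^ 5 * n ^ 6))" by (simp only: of_nat_le_iff mult_1)
    then show ?thesis using eps mult_left_mono[of "real (Y * n ^ 6)" _ "\<epsilon> / 4"] by (simp add: mult_ac)
  qed
  also have "\<dots> \<le> \<epsilon> / 4 * real (2 ^ w)" 
  proof (rule mult_left_mono)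
    show "real ((K0 + 1) * (Y ^ 5 * n ^ 6)) \<le> real (2 ^ w)" using two_w by (simp only: of_nat_le_iff)
  qed (use eps in simp)
  finally show "real n ^ 4 \<le> \<epsilon> / 4 * 2 ^ w" by simp
  have "\<kappa> < 2 ^ \<kappa>" by simp
  also have "(2 :: nat) ^ \<kappa> \<le> 2 ^ w" unfolding w_def using l_bounds(3) by (intro power_increasing) auto
  finally show \<kappa>: "\<kappa> < 2 ^ w" .
  have "D \<le> \<kappa>" "C \<le> \<kappa>" using K0_ge Y_ge by (auto simp: \<kappa>_def word_factor_def K0_def[symmetric] D_def[symmetric] Y_def[symmetric])
  then show "D < 2 ^ w" "C < 2 ^ w" using \<kappa> by linarith+
  have "6 \<le> \<kappa>" by (simp add: \<kappa>_def word_factor_def)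
  then have "6 * l \<le> w" unfolding w_def by (intro mult_le_mono1)
  then show "(2 :: nat) ^ \<Lambda> < 2 ^ w" unfolding \<Lambda>_def using l_bounds(3) by (intro power_strict_increasing) auto
qed

lemma B_bounds: "K0 * Q ^ 5 \<le> B" "M\<^sub>0 \<le> M"
proof -
  have Q1: "1 \<le> Q" by (rule lin_Q)
  show 1: "K0 * Q ^ 5 \<le> B" unfolding B_def using Q1 by (intro mult_right_mono) auto
  have "real M\<^sub>0 \<le> real n * (K0 * Q ^ 5)" using total_bound by (simp add: mult_ac)
  also have "\<dots> \<le> real n * B" using 1 by (intro mult_left_mono) auto
  finally show "M\<^sub>0 \<le> M" unfolding M_def by (rule le_nat_floor)
qed

sublocale balanced w M n s q R L W \<Lambda> nb P G zb ob cb S M\<^sub>0 l D C \<kappa> "\<epsilon> / 4"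
proof
  show "n\<^sup>2 \<le> 2 ^ \<Lambda>"
  proof -
    have "n\<^sup>2 \<le> (2 ^ l)\<^sup>2" using l_bounds(5) by (intro power_mono) auto
    also have "\<dots> \<le> 2 ^ \<Lambda>" unfolding \<Lambda>_def power_mult[symmetric] by (intro power_increasing) auto
    finally show ?thesis .
  qed
  show "0 < q" "0 < R" "0 < L" using D_ge l_bounds(3) C_pos by (auto simp: q_def R_def L_def)
  show "real (n ^ 4) \<le> \<epsilon> / 4 * 2 ^ w" using w_bounds(5) by simp
  show "144 * real D \<le> (\<epsilon> / 4)\<^sup>2 * real C" by (rule C_delta)
qed (use w_bounds B_bounds n_ge eps in \<open>simp_all add: P_def G_def zb_def ob_def cb_def S_def M\<^sub>0_def w_def R_def q_def L_def W_def \<Lambda>_def nb_def l_def\<close>)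

lemma update_time_bound: "real update_time \<le> B"
proof -
  have Q1: "1 \<le> Q" by (rule lin_Q)
  have D1: "1 \<le> real D" using D_ge by simp
  have Q5: "Q ^ i \<le> Q ^ 5" if "i \<le> 5" for i using Q1 that by (rule power_increasing[rotated])
  have D4: "real D ^ i \<le> real D ^ 4" if "i \<le> 4" for i using D1 that by (rule power_increasing[rotated])
  have DQ: "real D ^ i * Q ^ j \<le> real D ^ 4 * Q ^ 5" if "i \<le> 4" "j \<le> 5" for i j
    using Q5[OF that(2)] D4[OF that(1)] D1 Q1 by (intro mult_mono) auto
  have 1: "real (\<Lambda> * R * (200 + 50 * q)) \<le> (3 * Q) * (D * Q) * (200 + 50 * (2 * D * Q))"
    unfolding of_nat_mult of_nat_add using size_bounds Q1 by (intro mult_mono add_mono) auto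
  have 2: "real (R * (W * 100 + 110)) \<le> (D * Q) * (64 * Q\<^sup>2 * 100 + 110)"
    unfolding of_nat_mult of_nat_add using size_bounds Q1 by (intro mult_mono add_mono) auto
  have "real update_time = 600 + 50 * real q + real (\<Lambda> * R * (200 + 50 * q)) + 40 * real \<Lambda> + real (R * (W * 100 + 110))"
    by (simp add: update_time_def)
  also have "\<dots> \<le> 600 + 50 * (2 * D * Q) + (3 * Q) * (D * Q) * (200 + 50 * (2 * D * Q)) + 40 * (3 * Q) + (D * Q) * (64 * Q\<^sup>2 * 100 + 110)"
    using 1 2 size_bounds(3,7) by linarith
  also have "\<dots> = 600 * (D ^ 0 * Q ^ 0) + 210 * (D ^ 1 * Q ^ 1) + 600 * (D ^ 1 * Q ^ 2) + 300 * (D ^ 2 * Q ^ 3) + 120 * (D ^ 0 * Q ^ 1) + 6400 * (D ^ 1 * Q ^ 3)"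
    by (simp add: power2_eq_square power3_eq_cube algebra_simps)
  also have "\<dots> \<le> 8230 * (real D ^ 4 * Q ^ 5)"
    using DQ[of 0 0] DQ[of 1 1] DQ[of 1 2] DQ[of 2 3] DQ[of 0 1] DQ[of 1 3] by simp
  also have "\<dots> \<le> K0 * Q ^ 5"
    using D1 Q1 by (simp add: K0_def)
  also have "\<dots> \<le> B" by (rule B_bounds)
  finally show ?thesis .
qed

text \<open>With \<open>L \<le> 3 * C * ln n\<close> and \<open>nb \<le> 2 * s\<close>, the left
  side is at most 48 times \<open>\<alpha> * C * c * n * (ln n)\<^sup>2\<close> for
  \<open>\<alpha> = 2 + cstar * \<epsilon>\<close>; the assumption \<open>12 * C \<le> c\<close>,
  implied by the size of \<open>c\<close>, replaces \<open>C\<close> by the second factor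
  \<open>c\<close>.\<close>

lemma large_stream:
  assumes "4 * (2 + cstar * \<epsilon>) * c\<^sup>2 * real n * (ln (real n))\<^sup>2 \<le> real m"
  shows "4 * L * nb \<le> m"
proof -
  let ?x = "ln (real n)"
  have x: "0 \<le> ?x" using l_bounds(2) by linarith
  have "nb \<le> 2 * s" unfolding nb_def by (rule clog_upper[OF s0])
  then have "real nb \<le> 2 * real s" by linarith
  then have nb4: "real nb \<le> 4 * (2 + cstar * \<epsilon>) * c * real n * ?x" using s by linarith
  have L3: "real L \<le> 3 * C * ?x" unfolding L_def of_nat_mult using l_bounds(1) mult_left_mono[of "real l" "3 * ?x" "real C"] by simp
  have pos: "0 \<le> (2 + cstar * \<epsilon>) * c * real n * (?x * ?x)"
    using alpha c_ge x by (intro mult_nonneg_nonneg) auto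
  have "real (4 * L * nb) = 4 * real L * real nb" by simp
  also have "\<dots> \<le> 4 * (3 * C * ?x) * (4 * (2 + cstar * \<epsilon>) * c * real n * ?x)"
    using L3 nb4 x by (intro mult_mono) auto
  also have "\<dots> = (12 * C) * (4 * ((2 + cstar * \<epsilon>) * c * real n * (?x * ?x)))" by simp
  also have "\<dots> \<le> c * (4 * ((2 + cstar * \<epsilon>) * c * real n * (?x * ?x)))"
    using c_ge pos by (intro mult_right_mono) auto
  also have "\<dots> = 4 * (2 + cstar * \<epsilon>) * c\<^sup>2 * real n * ?x\<^sup>2" by (simp add: power2_eq_square)
  also have "\<dots> \<le> real m" by (rule assms)
  finally show ?thesis by (simp only: of_nat_le_iff)
qed

lemma union_bound: "(nat \<lceil>real n powr lambda\<rceil> + 1) * (2 * \<Lambda> * n\<^sup>2 * (1 / 2) ^ R) \<le> 1 / real n ^ d"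
proof -
  define a where "a = nat \<lceil>lambda\<rceil>"
  have n2: "2 \<le> real n" using n_ge by simp
  have pw: "real n ^ i \<le> real n ^ j" if "i \<le> j" for i j using n2 that by (intro power_increasing) auto
  have "real n powr lambda \<le> real n powr real a" unfolding a_def using n2 by (intro powr_mono of_nat_ceiling) auto
  also have "\<dots> = real (n ^ a)" using n2 by (simp add: powr_realpow)
  finally have "nat \<lceil>real n powr lambda\<rceil> \<le> n ^ a" by (simp add: ceiling_le_iff nat_le_iff)
  then have "real (nat \<lceil>real n powr lambda\<rceil>) \<le> real (n ^ a)" by (simp only: of_nat_le_iff)
  then have "real (nat \<lceil>real n powr lambda\<rceil> + 1) \<le> real n ^ a + 1" by simp
  also have "\<dots> \<le> 2 * real n ^ a" using n2 one_le_power[of "real n" a] by simp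
  also have "\<dots> \<le> real n ^ (a + 1)" using n2 mult_right_mono[OF n2, of "real n ^ a"] by simp
  finally have T: "real (nat \<lceil>real n powr lambda\<rceil> + 1) \<le> real n ^ (a + 1)" .
  have "real \<Lambda> \<le> 3 * real n" using l_bounds(3,4) by (simp add: \<Lambda>_def)
  also have "\<dots> \<le> (real n * real n) * real n" using n2 mult_mono[OF n2 n2] by (intro mult_right_mono) auto
  finally have Lam: "real \<Lambda> \<le> real n ^ 3" by (simp add: power3_eq_cube)
  have Lam: "2 * real \<Lambda> \<le> real n * real n ^ 3" using mult_mono[OF n2 Lam] n2 by simp
  have "real n ^ D \<le> (2 ^ l) ^ D" using l_bounds(5) by (intro power_mono) (metis of_nat_le_iff of_nat_numeral of_nat_power, simp)
  also have "\<dots> = 2 ^ R" by (simp add: R_def power_mult[symmetric] mult.commute)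
  finally have "(1 / 2) ^ R \<le> 1 / real n ^ D" using n2 by (simp add: power_divide frac_le)
  then have "(nat \<lceil>real n powr lambda\<rceil> + 1) * (2 * \<Lambda> * n\<^sup>2 * (1 / 2) ^ R) \<le> real n ^ (a + 1) * (real n * real n ^ 3 * real n ^ 2 * (1 / real n ^ D))"
    using T Lam n2 by (intro mult_mono) auto
  also have "\<dots> = real n ^ (a + 7) / real n ^ D" by (simp add: power_add eval_nat_numeral mult_ac)
  also have "\<dots> = 1 / real n ^ d" using n2 by (simp add: D_def depth_def a_def[symmetric] power_add)
  finally show ?thesis .
qed

text \<open>The edge sets are fixed before the table is drawn, so a table that is good for all
  \<open>T + 1\<close> of them exists up to the sum of the failure probabilities. Taking
  \<open>\<delta> = \<epsilon> / 4\<close> turns the error \<open>4 * \<delta>\<close> into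
  \<open>\<epsilon>\<close>.\<close>

lemma whp_expectation:
  assumes v: "valid_stream n us T" and T: "T = nat \<lceil>real n powr lambda\<rceil>"
  shows "measure fair_bits {\<rho> \<in> space fair_bits.
    \<forall>t\<le>T. real (card (edges us t)) \<ge> 4 * (2 + cstar * \<epsilon>) * c\<^sup>2 * real n * (ln (real n))\<^sup>2 \<longrightarrow>
      (\<forall>e\<in>edges us t. (\<integral>\<omega>. of_bool (e \<in> sampled (\<lambda>i. word \<rho> (i * w) w) (\<lambda>i. word \<omega> (i * w) w) (edges us t)) \<partial>fair_bits)
          \<in> {(1 - \<epsilon>) * real s / real (card (edges us t)) .. (1 + \<epsilon>) * real s / real (card (edges us t))})}
    \<ge> 1 - 1 / real n ^ d"
proof -
  define ok where "ok tab \<longleftrightarrow> (\<forall>t\<le>T. real (card (edges us t)) \<ge> 4 * (2 + cstar * \<epsilon>) * c\<^sup>2 * real n * (ln (real n))\<^sup>2 \<longrightarrow>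
      (\<forall>e\<in>edges us t. (\<integral>\<omega>. of_bool (e \<in> sampled tab (\<lambda>i. word \<omega> (i * w) w) (edges us t)) \<partial>fair_bits)
          \<in> {(1 - \<epsilon>) * real s / real (card (edges us t)) .. (1 + \<epsilon>) * real s / real (card (edges us t))}))" for tab
  have eq: "sampled (\<lambda>i. word \<rho> (i * w) w) zs (edges us t) = sampled (read (G * P) w \<rho>) zs (edges us t)" if "t \<le> T" for \<rho> zs t
    by (rule sampled_cong[OF edges_edge[OF v that]]) (simp add: read_def)
  have "{\<rho> \<in> space fair_bits.
    \<forall>t\<le>T. real (card (edges us t)) \<ge> 4 * (2 + cstar * \<epsilon>) * c\<^sup>2 * real n * (ln (real n))\<^sup>2 \<longrightarrow>
      (\<forall>e\<in>edges us t. (\<integral>\<omega>. of_bool (e \<in> sampled (\<lambda>i. word \<rho> (i * w) w) (\<lambda>i. word \<omega> (i * w) w) (edges us t)) \<partial>fair_bits)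
          \<in> {(1 - \<epsilon>) * real s / real (card (edges us t)) .. (1 + \<epsilon>) * real s / real (card (edges us t))})}
    = {\<rho> \<in> space fair_bits. ok (read (G * P) w \<rho>)}"
    unfolding ok_def by (simp add: eq cong: imp_cong)
  then have "measure fair_bits {\<rho> \<in> space fair_bits.
    \<forall>t\<le>T. real (card (edges us t)) \<ge> 4 * (2 + cstar * \<epsilon>) * c\<^sup>2 * real n * (ln (real n))\<^sup>2 \<longrightarrow>
      (\<forall>e\<in>edges us t. (\<integral>\<omega>. of_bool (e \<in> sampled (\<lambda>i. word \<rho> (i * w) w) (\<lambda>i. word \<omega> (i * w) w) (edges us t)) \<partial>fair_bits)
          \<in> {(1 - \<epsilon>) * real s / real (card (edges us t)) .. (1 + \<epsilon>) * real s / real (card (edges us t))})}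
    = measure_pmf.prob (words (G * P) w) {tab. ok tab}"
    using measure_fair_bits_read[of ok] by simp
  moreover have "measure_pmf.prob (words (G * P) w) {tab. \<not> ok tab} \<le> 1 / real n ^ d"
  proof -
    have "{tab. \<not> ok tab} \<subseteq> (\<Union>t\<in>{..T}. {tab. \<not> good tab (edges us t)})"
    proof
      fix tab assume "tab \<in> {tab. \<not> ok tab}"
      then obtain t e where t: "t \<le> T" "real (card (edges us t)) \<ge> 4 * (2 + cstar * \<epsilon>) * c\<^sup>2 * real n * (ln (real n))\<^sup>2" "e \<in> edges us t"
        "(\<integral>\<omega>. of_bool (e \<in> sampled tab (\<lambda>i. word \<omega> (i * w) w) (edges us t)) \<partial>fair_bits)
          \<notin> {(1 - \<epsilon>) * real s / real (card (edges us t)) .. (1 + \<epsilon>) * real s / real (card (edges us t))}"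
        unfolding ok_def by auto
      have "\<not> good tab (edges us t)"
        using good_expectation[OF edges_edge[OF v t(1)] t(3) _ large_stream[OF t(2)], of tab] t(4) by auto
      then show "tab \<in> (\<Union>t\<in>{..T}. {tab. \<not> good tab (edges us t)})" using t(1) by auto
    qed
    then have "measure_pmf.prob (words (G * P) w) {tab. \<not> ok tab} \<le> measure_pmf.prob (words (G * P) w) (\<Union>t\<in>{..T}. {tab. \<not> good tab (edges us t)})"
      by (intro measure_pmf.finite_measure_mono) auto
    also have "\<dots> \<le> (\<Sum>t\<in>{..T}. measure_pmf.prob (words (G * P) w) {tab. \<not> good tab (edges us t)})"
      by (intro measure_pmf.finite_measure_subadditive_finite) auto
    also have "\<dots> \<le> (\<Sum>t\<in>{..T}. 2 * \<Lambda> * n\<^sup>2 * (1 / 2) ^ R)"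
      using prob_not_good[OF edges_edge[OF v]] by (intro sum_mono) auto
    also have "\<dots> = (T + 1) * (2 * \<Lambda> * n\<^sup>2 * (1 / 2) ^ R)" by simp
    also have "\<dots> \<le> 1 / real n ^ d" unfolding T by (rule union_bound)
    finally show ?thesis .
  qed
  moreover have "measure_pmf.prob (words (G * P) w) {tab. ok tab} = 1 - measure_pmf.prob (words (G * P) w) {tab. \<not> ok tab}"
    using measure_pmf.prob_compl[of "{tab. \<not> ok tab}" "words (G * P) w"] by (simp add: set_diff_eq)
  ultimately show ?thesis by simp
qed

lemma sampling_guarantees:
  assumes v: "valid_stream n us T" and T: "T = nat \<lceil>real n powr lambda\<rceil>"
  defines "X \<equiv> sample w M (init_prog D C \<kappa>) update_prog n s us"
  shows "n < 2 ^ w" "s < 2 ^ w"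
    and "processes w M (init_prog D C \<kappa>) update_prog n s us T B"
    and "t \<le> T \<Longrightarrow> X \<rho> \<omega> t \<subseteq> edges us t"
    and "1 - 1 / real n ^ d \<le> measure fair_bits {\<rho> \<in> space fair_bits.
      \<forall>t\<le>T. real (card (edges us t)) \<ge> 4 * (2 + cstar * \<epsilon>) * c\<^sup>2 * real n * (ln (real n))\<^sup>2 \<longrightarrow>
        (\<forall>e\<in>edges us t. (\<integral>\<omega>. of_bool (e \<in> X \<rho> \<omega> t) \<partial>fair_bits)
          \<in> {(1 - \<epsilon>) * real s / real (card (edges us t)) .. (1 + \<epsilon>) * real s / real (card (edges us t))})}"
    and "t \<le> T \<Longrightarrow> neg_associated fair_bits (edges us t) (\<lambda>e \<omega>. of_bool (e \<in> X \<rho> \<omega> t))"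
    and "t < T \<Longrightarrow> card ((X \<rho> \<omega> (Suc t) - X \<rho> \<omega> t) \<union> (X \<rho> \<omega> t - X \<rho> \<omega> (Suc t))) \<le> 2"
proof -
  have X: "X \<rho> \<omega> t = sampled (\<lambda>i. word \<rho> (i * w) w) (\<lambda>i. word \<omega> (i * w) w) (edges us t)" if "t \<le> T" for \<rho> \<omega> t
    unfolding X_def by (rule sample_eq[OF v that])
  show "n < 2 ^ w" "s < 2 ^ w" by (rule w_bounds)+
  show "processes w M (init_prog D C \<kappa>) update_prog n s us T B" by (rule processes_update[OF v update_time_bound])
  show "X \<rho> \<omega> t \<subseteq> edges us t" if "t \<le> T" unfolding X[OF that] by (auto simp: sampled_def)
  show "1 - 1 / real n ^ d \<le> measure fair_bits {\<rho> \<in> space fair_bits.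
      \<forall>t\<le>T. real (card (edges us t)) \<ge> 4 * (2 + cstar * \<epsilon>) * c\<^sup>2 * real n * (ln (real n))\<^sup>2 \<longrightarrow>
        (\<forall>e\<in>edges us t. (\<integral>\<omega>. of_bool (e \<in> X \<rho> \<omega> t) \<partial>fair_bits)
          \<in> {(1 - \<epsilon>) * real s / real (card (edges us t)) .. (1 + \<epsilon>) * real s / real (card (edges us t))})}"
    using whp_expectation[OF v T] by (simp add: X cong: imp_cong)
  show "neg_associated fair_bits (edges us t) (\<lambda>e \<omega>. of_bool (e \<in> X \<rho> \<omega> t))" if "t \<le> T"
    unfolding X[OF that] by (rule neg_associated_sampled[OF edges_edge[OF v that]])
  show "card ((X \<rho> \<omega> (Suc t) - X \<rho> \<omega> t) \<union> (X \<rho> \<omega> t - X \<rho> \<omega> (Suc t))) \<le> 2" if "t < T"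
  proof -
    have "t \<le> T" "Suc t \<le> T" using that by auto
    then show ?thesis unfolding X[OF \<open>t \<le> T\<close>] X[OF \<open>Suc t \<le> T\<close>] by (intro sample_change[OF v that])
  qed
qed

end

lemma sampler_exists:
  fixes lambda cstar \<epsilon> c :: real and d :: nat
  assumes "lambda \<ge> 1" and eps: "0 < \<epsilon>" "\<epsilon> < 1" "\<bar>cstar * \<epsilon>\<bar> < 1"
    and c: "c \<ge> 40 * cell_factor lambda d \<epsilon> + 40"
  shows "\<exists>(\<kappa> :: nat) (init :: com) (upd :: com). real \<kappa> \<le> (real (10000 * depth lambda d ^ 4) + 16) * (c / \<epsilon>) ^ 5 \<and>
        (\<forall>(n :: nat) (s :: nat) (us :: nat \<Rightarrow> update).
          let \<alpha> = 2 + cstar * \<epsilon>;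
              T = nat \<lceil>real n powr lambda\<rceil>;
              w = \<kappa> * nat \<lceil>log 2 (real n)\<rceil>;
              B = (real (10000 * depth lambda d ^ 4) + 16) * (c * ln (real n) / \<epsilon>) ^ 5;
              M = nat \<lfloor>real n * B\<rfloor>;
              E = edges us;
              m = (\<lambda>t. real (card (E t)));
              S = sample w M init upd n s us;
              X = (\<lambda>\<rho> t e \<omega>. of_bool (e \<in> S \<rho> \<omega> t) :: real)
          in 0 < s \<and> real s \<le> 2 * \<alpha> * c * real n * ln (real n) \<and> valid_stream n us T \<longrightarrow>
             n < 2 ^ w \<and> s < 2 ^ w \<and>
             processes w M init upd n s us T B \<and>
             (\<forall>\<rho> \<omega>. \<forall>t\<le>T. S \<rho> \<omega> t \<subseteq> E t) \<and>
             measure fair_bits {\<rho> \<in> space fair_bits.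
                 \<forall>t\<le>T. m t \<ge> 4 * \<alpha> * c\<^sup>2 * real n * (ln (real n))\<^sup>2 \<longrightarrow>
                   (\<forall>e\<in>E t. (\<integral>\<omega>. X \<rho> t e \<omega> \<partial>fair_bits)
                      \<in> {(1 - \<epsilon>) * real s / m t .. (1 + \<epsilon>) * real s / m t})}
               \<ge> 1 - 1 / real n ^ d \<and>
             (\<forall>\<rho>. \<forall>t\<le>T. neg_associated fair_bits (E t) (X \<rho> t)) \<and>
             (\<forall>\<rho> \<omega>. \<forall>t<T.
                card ((S \<rho> \<omega> (Suc t) - S \<rho> \<omega> t) \<union> (S \<rho> \<omega> t - S \<rho> \<omega> (Suc t))) \<le> 2))"
proof -
  have c40: "c \<ge> 40" using c of_nat_0_le_iff[of "cell_factor lambda d \<epsilon>", where 'a = real] by linarith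
  define u where "u = c / \<epsilon>"
  define K where "K = real (10000 * depth lambda d ^ 4) + 16"
  have u: "1 \<le> u" using c40 eps by (simp add: u_def field_simps)
  \<comment> \<open>The summand 16 in \<open>K\<close> collects the 6 of the word factor, 5 for
    rounding up \<open>u\<close> five times, and the coefficient 5 of \<open>u\<close>
    itself.\<close>
  have "real (nat \<lceil>u\<rceil>) \<le> u + 1" using u by (simp add: of_nat_nat)
  then have "real (word_factor lambda d \<epsilon> c) \<le> (K - 5) * 1 + 5 * u"
    by (simp add: word_factor_def K_def u_def)
  also have "\<dots> \<le> (K - 5) * u ^ 5 + 5 * u ^ 5"
    using u one_le_power[OF u, of 5] power_increasing[of 1 5 u] by (intro add_mono mult_left_mono) (auto simp: K_def)
  finally have \<kappa>: "real (word_factor lambda d \<epsilon> c) \<le> K * (c / \<epsilon>) ^ 5" by (simp add: algebra_simps u_def)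
  show ?thesis
    unfolding Let_def K_def[symmetric]
  proof (rule exI[of _ "word_factor lambda d \<epsilon> c"],
      rule exI[of _ "init_prog (depth lambda d) (cell_factor lambda d \<epsilon>) (word_factor lambda d \<epsilon> c)"],
      rule exI[of _ update_prog], intro conjI[OF \<kappa>] allI impI, elim conjE, goal_cases)
    case (1 n s us)
    interpret I: instance_bounds lambda cstar \<epsilon> c d n s
      using assms 1 by unfold_locales auto
    have w: "word_factor lambda d \<epsilon> c * nat \<lceil>log 2 (real n)\<rceil> = I.w"
      using clog_eq_ceiling[of n] I.n_ge by (simp add: I.w_def I.\<kappa>_def I.l_def)
    have B: "K * (c * ln (real n) / \<epsilon>) ^ 5 = I.B" by (simp add: I.B_def I.Q_def I.K0_def I.D_def K_def)
    have M: "nat \<lfloor>real n * I.B\<rfloor> = I.M" by (simp add: I.M_def)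
    show ?case
      unfolding w B M unfolding I.D_def[symmetric] I.C_def[symmetric] I.\<kappa>_def[symmetric]
      by (intro conjI allI impI I.sampling_guarantees[OF 1(3) refl])
  qed
qed

text \<open>\<open>K\<close> and \<open>k\<close> are quantified before \<open>\<epsilon>\<close>,
  \<open>c\<close> and \<open>n\<close>; this order is what gives the soft-O bounds their meaning,
  as the hidden factor is one fixed polynomial in \<open>c * ln n / \<epsilon>\<close>. The programs
  are chosen before \<open>n\<close>, \<open>s\<close> and the stream, so the algorithm is uniform
  and the stream oblivious.\<close>

theorem theorem5p3:
  fixes lambda cstar :: real and d :: nat
  assumes "lambda \<ge> 1"
  shows "\<exists>\<epsilon>\<^sub>0 K :: real. \<exists>k :: nat. 0 < \<epsilon>\<^sub>0 \<and> \<epsilon>\<^sub>0 \<le> 1 \<and>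
    (\<forall>\<epsilon> :: real. 0 < \<epsilon> \<and> \<epsilon> < \<epsilon>\<^sub>0 \<longrightarrow> (\<exists>c\<^sub>0 :: real. \<forall>c :: real. c \<ge> c\<^sub>0 \<longrightarrow>
      (\<exists>(\<kappa> :: nat) (init :: com) (upd :: com). real \<kappa> \<le> K * (c / \<epsilon>) ^ k \<and>
        (\<forall>(n :: nat) (s :: nat) (us :: nat \<Rightarrow> update).
          let \<alpha> = 2 + cstar * \<epsilon>;
              T = nat \<lceil>real n powr lambda\<rceil>;
              w = \<kappa> * nat \<lceil>log 2 (real n)\<rceil>;
              B = K * (c * ln (real n) / \<epsilon>) ^ k;
              M = nat \<lfloor>real n * B\<rfloor>;
              E = edges us;
              m = (\<lambda>t. real (card (E t)));
              S = sample w M init upd n s us;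
              X = (\<lambda>\<rho> t e \<omega>. of_bool (e \<in> S \<rho> \<omega> t) :: real)
          in 0 < s \<and> real s \<le> 2 * \<alpha> * c * real n * ln (real n) \<and> valid_stream n us T \<longrightarrow>
             n < 2 ^ w \<and> s < 2 ^ w \<and>
             processes w M init upd n s us T B \<and>
             (\<forall>\<rho> \<omega>. \<forall>t\<le>T. S \<rho> \<omega> t \<subseteq> E t) \<and>
             measure fair_bits {\<rho> \<in> space fair_bits.
                 \<forall>t\<le>T. m t \<ge> 4 * \<alpha> * c\<^sup>2 * real n * (ln (real n))\<^sup>2 \<longrightarrow>
                   (\<forall>e\<in>E t. (\<integral>\<omega>. X \<rho> t e \<omega> \<partial>fair_bits)
                      \<in> {(1 - \<epsilon>) * real s / m t .. (1 + \<epsilon>) * real s / m t})}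
               \<ge> 1 - 1 / real n ^ d \<and>
             (\<forall>\<rho>. \<forall>t\<le>T. neg_associated fair_bits (E t) (X \<rho> t)) \<and>
             (\<forall>\<rho> \<omega>. \<forall>t<T.
                card ((S \<rho> \<omega> (Suc t) - S \<rho> \<omega> t) \<union> (S \<rho> \<omega> t - S \<rho> \<omega> (Suc t))) \<le> 2)))))"
proof -
  \<comment> \<open>Keeps \<open>cstar * \<epsilon>\<close> below 1 in absolute value, so that
    \<open>\<alpha>\<close> stays between 1 and 3.\<close>
  define \<epsilon>\<^sub>0 where "\<epsilon>\<^sub>0 = 1 / (\<bar>cstar\<bar> + 1)"
  have e0: "0 < \<epsilon>\<^sub>0" "\<epsilon>\<^sub>0 \<le> 1" by (simp_all add: \<epsilon>\<^sub>0_def)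
  have eps: "0 < \<epsilon>" "\<epsilon> < 1" "\<bar>cstar * \<epsilon>\<bar> < 1" if "0 < \<epsilon> \<and> \<epsilon> < \<epsilon>\<^sub>0" for \<epsilon>
  proof -
    show "0 < \<epsilon>" "\<epsilon> < 1" using that e0 by auto
    have "\<epsilon> * (\<bar>cstar\<bar> + 1) < 1" using that by (simp add: \<epsilon>\<^sub>0_def field_simps)
    then show "\<bar>cstar * \<epsilon>\<bar> < 1" using that by (simp add: abs_mult algebra_simps)
  qed
  \<comment> \<open>Unification supplies the witnesses: exponent 5,
    \<open>K = 10000 * depth lambda d ^ 4 + 16\<close>, which is free of \<open>\<epsilon>\<close>,
    and the threshold \<open>40 * cell_factor lambda d \<epsilon> + 40\<close> for
    \<open>c\<close>.\<close>
  show ?thesis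
    by (rule exI[of _ \<epsilon>\<^sub>0], rule exI, rule exI, intro conjI e0 allI impI, rule exI, intro allI impI,
        rule sampler_exists[OF assms eps], assumption+)
qed

end
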